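(* Let $d\ge1$, $s\in\{+1,-1\}$, and let $P:\mathbb{R}^d\to\mathbb{R}$ be a measurable function, not identically zero on $\mathbb{R}^d\setminus\{0\}$, such that $P\in L^1_{\rm loc}(\mathbb{R}^d)$ and $P(-x)=(-1)^{\mathfrak{r}}P(x)$ for all $x\in\mathbb{R}^d$ with some $\mathfrak{r}\in\{0,1\}$. Assume that the class $\mathcal{A}^*_s(P;d)$ is non-empty and that $P$ is admissible with respect to an exponent $1\le q\le\infty$. Then there exists a positive constant $C^*(P;d;q)$ such that $$\mathbb{A}^*_s(P;d)\ge C^*(P;d;q).$$ Moreover: (i) If $P$ satisfies the three properties - the sub-level set $\{x\in\mathbb{R}^d:|P(x)|\le\lambda\}$ has finite Lebesgue measure for some $\lambda>0$; - $P\in L^\infty_{\rm loc}(\mathbb{R}^d)$; - for each $x\in\mathbb{R}^d\setminus\{0\}$ with $P(x)\ne0$, $$\liminf_{\varepsilon\to0}\frac{\big|\{y\in\mathbb{R}^d:P(y)P(x)>0\}\cap B_\varepsilon(x)\big|}{|B_\varepsilon(x)|}>0;$$ then there exist extremizers for $\mathbb{A}^*_s(P;d)$, i.e. there is $f\in\mathcal{A}^*_s(P;d)$ with $r(Pf)=\mathbb{A}^*_s(P;d)$. (ii) If $P\in L^\infty_{\rm loc}(\mathbb{R}^d)$ and $P$ is homogeneous of degree $\gamma\ge0$ (i.e. $P(\delta x)=\delta^\gamma P(x)$ for all $\delta>0$, $x\in\mathbb{R}^d$), then, with $K:=\|P\|_{L^\infty(B_1)}$ and $C=C(P;d;q)$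 the constant in the admissibility inequality, the constant $C^*(P;d;q)$ above can be taken to satisfy $$C^*(P;d;q)\ge\left(\frac{(d+\gamma q')\,\Gamma(d/2)}{2\,\pi^{d/2}\,(2KC)^{q'}}\right)^{\frac{1}{d+\gamma q'}},$$ where, if $q=1$ (and hence $\gamma>0$), the right-hand side is understood as $(2KC)^{-1/\gamma}$.
   Context: The Fourier transform of $f\in L^1(\mathbb{R}^d)$ is $\widehat f(\xi)=\int_{\mathbb{R}^d}e^{-2\pi i x\cdot\xi}f(x)\,dx$. $|E|$ is the Lebesgue measure of $E$, $B_\varepsilon(x)$ the open ball of center $x$ and radius $\varepsilon$, $B_r=B_r(0)$, and $1/q+1/q'=1$. A measurable function $f:\mathbb{R}^d\to\mathbb{R}$ is eventually non-negative if $f(x)\ge0$ for all (not merely almost all) $x$ with $|x|$ sufficiently large; then $r(f):=\inf\{r>0:f(x)\ge0\text{ for all }|x|\ge r\}$. For $P$ with parity $\mathfrak{r}$ (that is, $P(-x)=(-1)^{\mathfrak{r}}P(x)$) and $s\in\{+1,-1\}$, $\mathcal{A}^*_s(P;d)$ is the set of continuous real-valued $f\in L^1(\mathbb{R}^d)\setminus\{\mathbf{0}\}$ such that $\widehat f=s\,i^{\mathfrak{r}}f$, $Pf\in L^1(\mathbb{R}^d)$, $\int_{\mathbb{R}^d}Pf\le0$, and $Pf$ is eventually non-negative. Define $\mathbb{A}^*_s(P;d)=\inf_{f\in\mathcal{A}^*_s(P;d)}r(Pf)$. Admissibility: $P$ (locally integrable, of parity $\mathfrak{r}$) is admissible with respect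 to $q\in[1,\infty]$ if there is a positive constant $C(P;d;q)$ such that: (a) for all $f\in L^1(\mathbb{R}^d)$ with $\widehat f=\pm i^{\mathfrak{r}}f$ and $Pf\in L^1(\mathbb{R}^d)$ one has $\|f\|_q\le C(P;d;q)\,\|Pf\|_1$ (the admissibility inequality); and (b) if $q>1$ then $P\in L^{q'}_{\rm loc}(\mathbb{R}^d)$, while if $q=1$ then $\lim_{r\to0^+}\|P\|_{L^\infty(B_r)}=0$. *)

theory Defs
  imports "HOL-Probability.Probability"
begin

definition fourier :: "('a::euclidean_space \<Rightarrow> complex) \<Rightarrow> 'a \<Rightarrow> complex" where
  "fourier f \<xi> = (\<integral>x. exp (- (2 * complex_of_real pi * \<i> * complex_of_real (x \<bullet> \<xi>))) * f x \<partial>lebesgue)"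

text \<open>The exponent ranges over \<open>[1, \<infinity>]\<close>, and the value of the norm may be infinite. The case
  split in the finite-exponent branch is only there because ennreal has no power function
  with real exponents.\<close>

definition lp_norm :: "'a measure \<Rightarrow> ennreal \<Rightarrow> ('a \<Rightarrow> 'b::real_normed_vector) \<Rightarrow> ennreal" where
  "lp_norm M p f =
     (if p = \<infinity> then esssup M (\<lambda>x. ennreal (norm (f x)))
      else let I = (\<integral>\<^sup>+ x. ennreal (norm (f x) powr enn2real p) \<partial>M)
           in if I = \<infinity> then \<infinity> else ennreal (enn2real I powr (1 / enn2real p)))"

definition lp_loc :: "ennreal \<Rightarrow> ('a::euclidean_space \<Rightarrow> real) \<Rightarrow> bool" where
  "lp_loc p f \<longleftrightarrow> f \<in> borel_measurable lebesgue \<and>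
     (\<forall>K. compact K \<longrightarrow> lp_norm (lebesgue_on K) p f < \<infinity>)"

text \<open>With the ennreal conventions \<open>1 / 0 = \<infinity>\<close> and \<open>1 / \<infinity> = 0\<close>, this
  also covers \<open>q = 1\<close> and \<open>q = \<infinity>\<close>.\<close>

definition conj_exponent :: "ennreal \<Rightarrow> ennreal" where
  "conj_exponent q = inverse (1 - inverse q)"

lemma conj_exponent_1: "conj_exponent 1 = \<infinity>"
  by (simp add: conj_exponent_def)

lemma conj_exponent_infinity: "conj_exponent \<infinity> = 1"
  by (simp add: conj_exponent_def)

lemma conj_exponent_sum:
  assumes "1 \<le> q"
  shows "inverse q + inverse (conj_exponent q) = 1"
proof -
  have "inverse q \<le> 1"
    using assms
    by (cases q) (auto simp: inverse_ennreal ennreal_le_1 field_simps simp flip: ennreal_1)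
  moreover have "inverse (inverse x) = x" for x :: ennreal
    by (cases x; cases "x = 0") (auto simp: inverse_ennreal ennreal_eq_0_iff less_le)
  ultimately show ?thesis
    by (simp add: conj_exponent_def add_diff_inverse_ennreal)
qed

definition has_parity :: "nat \<Rightarrow> ('a::euclidean_space \<Rightarrow> real) \<Rightarrow> bool" where
  "has_parity r P \<longleftrightarrow> (\<forall>x. P (- x) = (-1) ^ r * P x)"

abbreviation eventually_nonneg :: "('a::euclidean_space \<Rightarrow> real) \<Rightarrow> bool" where
  "eventually_nonneg f \<equiv> (\<forall>\<^sub>F x in at_infinity. 0 \<le> f x)"

definition sign_radius :: "('a::euclidean_space \<Rightarrow> real) \<Rightarrow> real" where
  "sign_radius f = Inf {r. 0 < r \<and> (\<forall>x. r \<le> norm x \<longrightarrow> 0 \<le> f x)}"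

text \<open>The parity \<open>r\<close> of \<open>P\<close> is an explicit argument of the notions below. Elements of the
  class are genuine functions rather than equivalence classes; as they are continuous and
  integrable, the Fourier identity is required everywhere.\<close>

definition sign_class :: "nat \<Rightarrow> real \<Rightarrow> ('a::euclidean_space \<Rightarrow> real) \<Rightarrow> ('a \<Rightarrow> real) set" where
  "sign_class r s P = {f.
     continuous_on UNIV f \<and> integrable lebesgue f \<and> f \<noteq> (\<lambda>x. 0) \<and>
     (\<forall>\<xi>. fourier (\<lambda>x. complex_of_real (f x)) \<xi> = complex_of_real s * \<i> ^ r * complex_of_real (f \<xi>)) \<and>
     integrable lebesgue (\<lambda>x. P x * f x) \<and>
     (\<integral>x. P x * f x \<partial>lebesgue) \<le> 0 \<and>
     eventually_nonneg (\<lambda>x. P x * f x)}"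

text \<open>A real infimum, hence only meaningful when the class is non-empty.\<close>

definition sign_const :: "nat \<Rightarrow> real \<Rightarrow> ('a::euclidean_space \<Rightarrow> real) \<Rightarrow> real" where
  "sign_const r s P = (INF f\<in>sign_class r s P. sign_radius (\<lambda>x. P x * f x))"

text \<open>Here \<open>f\<close> ranges over complex-valued \<open>L\<^sup>1\<close> functions, so the Fourier identity is an
  identity almost everywhere.\<close>

definition admissibility_inequality ::
    "nat \<Rightarrow> ('a::euclidean_space \<Rightarrow> real) \<Rightarrow> ennreal \<Rightarrow> real \<Rightarrow> bool" where
  "admissibility_inequality r P q C \<longleftrightarrow>
     (\<forall>f :: 'a \<Rightarrow> complex. \<forall>s \<in> {1, -1 :: real}.
        integrable lebesgue f \<longrightarrow>
        (AE \<xi> in lebesgue. fourier f \<xi> = complex_of_real s * \<i> ^ r * f \<xi>) \<longrightarrow>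
        integrable lebesgue (\<lambda>x. complex_of_real (P x) * f x) \<longrightarrow>
        lp_norm lebesgue q f \<le> ennreal C * lp_norm lebesgue 1 (\<lambda>x. complex_of_real (P x) * f x))"

definition admissible :: "nat \<Rightarrow> ('a::euclidean_space \<Rightarrow> real) \<Rightarrow> ennreal \<Rightarrow> bool" where
  "admissible r P q \<longleftrightarrow>
     (\<exists>C>0. admissibility_inequality r P q C) \<and>
     (1 < q \<longrightarrow> lp_loc (conj_exponent q) P) \<and>
     (q = 1 \<longrightarrow> ((\<lambda>\<rho>. lp_norm (lebesgue_on (ball 0 \<rho>)) \<infinity> P) \<longlongrightarrow> 0) (at_right 0))"

definition homogeneous :: "real \<Rightarrow> ('a::euclidean_space \<Rightarrow> real) \<Rightarrow> bool" where
  "homogeneous \<gamma> P \<longleftrightarrow> (\<forall>\<delta>>0. \<forall>x. P (\<delta> *\<^sub>R x) = \<delta> powr \<gamma> * P x)"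

definition explicit_bound :: "nat \<Rightarrow> real \<Rightarrow> ennreal \<Rightarrow> real \<Rightarrow> real \<Rightarrow> real" where
  "explicit_bound d \<gamma> q K C =
     (if q = 1 then (2 * K * C) powr (- 1 / \<gamma>)
      else let q' = enn2real (conj_exponent q) in
        ((real d + \<gamma> * q') * Gamma (real d / 2) / (2 * pi powr (real d / 2) * (2 * K * C) powr q'))
          powr (1 / (real d + \<gamma> * q')))"

end

theory Submission
  imports Defs
begin

text \<open>Write \<open>\<bar>g\<bar>\<^sub>1\<close> for the \<open>L\<^sup>1\<close> norm and let \<open>f\<close> be in the class, with \<open>P f \<ge> 0\<close> outside the ball
of radius \<open>\<rho>\<close>. As \<open>\<integral> P f \<le> 0\<close>, at least half of \<open>\<bar>P f\<bar>\<^sub>1\<close> lies inside that ball, so the Hoelder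
inequality and the admissibility inequality give
\<open>\<bar>P f\<bar>\<^sub>1 \<le> 2 \<parallel>P\<parallel> \<parallel>f\<parallel> \<le> 2 C \<parallel>P\<parallel> \<bar>P f\<bar>\<^sub>1\<close>, where \<open>\<parallel>P\<parallel>\<close> is the norm with the conjugate exponent
over the ball and \<open>\<parallel>f\<parallel>\<close> the norm with exponent \<open>q\<close>. Dividing by \<open>\<bar>P f\<bar>\<^sub>1 > 0\<close> yields
\<open>1 \<le> 2 C \<parallel>P\<parallel>\<close> (\<open>one_le_lp_norm_ball\<close>). Since \<open>\<parallel>P\<parallel>\<close> tends to \<open>0\<close> with \<open>\<rho>\<close>, the radius is bounded
below. For homogeneous \<open>P\<close> the norm over the ball is bounded in terms of \<open>K\<close> and \<open>\<rho>\<close>, and solving for \<open>\<rho>\<close> gives the explicit bound (\<open>explicit_bound_le\<close>).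

For extremizers, take a minimizing sequence \<open>f\<^sub>n\<close>, normalized by \<open>\<bar>P f\<^sub>n\<bar>\<^sub>1 = 1\<close>. The finite
sub-level set of \<open>P\<close> turns the admissibility inequality into a bound for \<open>\<bar>f\<^sub>n\<bar>\<^sub>1\<close>, hence, as
\<open>f\<^sub>n\<close> is up to a unit factor its own Fourier transform, also into a uniform bound for \<open>f\<^sub>n\<close>.
With the normalization relaxed to \<open>\<bar>P f\<^sub>n\<bar>\<^sub>1 \<le> 1\<close>, all the conditions on \<open>f\<^sub>n\<close> are
convex. So weak compactness is replaced by the parallelogram law: any decreasing sequence of nonempty
midpoint-convex sets, bounded in \<open>L\<^sup>2\<close>, contains a selection that converges almost everywhere
(\<open>decreasing_convex_L2_AE_convergent\<close>). The eigenfunction equation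
passes to such a limit (\<open>fourier_eq_limit\<close>) because it can be tested against Gaussian smoothings,
whose transforms are integrable; the sign condition passes to the limit almost everywhere, and the
density hypothesis upgrades it to every point outside the ball (\<open>sign_nonneg_of_AE\<close>).

What could go wrong is that the limit vanishes. This is excluded by two kinds of continuous linear
functionals, the integral of \<open>P f\<close> over a large ball and the values of the Fourier transform of
\<open>f\<close> restricted to that ball. If they were all small, almost no mass of \<open>f\<close> would lie outside
the large ball, so \<open>f\<close>, being its own transform, would be uniformly small near the origin,
which contradicts \<open>\<bar>P f\<bar>\<^sub>1 = 1\<close> (\<open>normalized_functional_lower_bound\<close>). After passing to a subsequence
these functionals converge, not all to \<open>0\<close>, and closeness to the limit values is made part of the
convex conditions.\<close>

section \<open>Hoelder inequality for the extended norms\<close>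

text \<open>Young's inequality, applied to \<open>u / a\<close> and \<open>v / b\<close> with \<open>a\<close> and \<open>b\<close> slightly larger than the two
norms and integrated; the excess then tends to \<open>0\<close>.\<close>

lemma Holder_nn_integral:
  fixes u v :: "'a \<Rightarrow> real"
  assumes pq: "p > 1" "q > 1" "1/p + 1/q = 1"
    and [measurable]: "u \<in> borel_measurable M" "v \<in> borel_measurable M"
    and nonneg: "\<And>x. 0 \<le> u x" "\<And>x. 0 \<le> v x"
    and fin: "(\<integral>\<^sup>+x. ennreal (u x powr p) \<partial>M) < \<infinity>" "(\<integral>\<^sup>+x. ennreal (v x powr q) \<partial>M) < \<infinity>"
  shows "(\<integral>\<^sup>+x. ennreal (u x * v x) \<partial>M) \<le>
    ennreal (enn2real (\<integral>\<^sup>+x. ennreal (u x powr p) \<partial>M) powr (1/p)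
           * enn2real (\<integral>\<^sup>+x. ennreal (v x powr q) \<partial>M) powr (1/q))"
    (is "?I \<le> ennreal (?a * ?b)")
proof -
  let ?A = "\<integral>\<^sup>+x. ennreal (u x powr p) \<partial>M" and ?B = "\<integral>\<^sup>+x. ennreal (v x powr q) \<partial>M"
  \<comment> \<open>The positive excess \<open>e\<close> keeps the divisors positive even if one of the norms vanishes.\<close>
  have bound: "?I \<le> ennreal ((?a + e) * (?b + e))" if "e > 0" for e
  proof -
    define a b where "a = ?a + e" and "b = ?b + e"
    have "a > 0" "b > 0"
      using \<open>e > 0\<close> by (auto simp: a_def b_def intro!: add_nonneg_pos)
    have A: "?A \<le> ennreal (a powr p)"
    proof -
      have "enn2real ?A = ?a powr p"
        using pq by (simp add: powr_powr)
      also have "\<dots> \<le> a powr p"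
        using pq \<open>e > 0\<close> by (intro powr_mono2) (auto simp: a_def)
      finally show ?thesis
        using fin(1) by (metis ennreal_enn2real ennreal_leI infinity_ennreal_def)
    qed
    have B: "?B \<le> ennreal (b powr q)"
    proof -
      have "enn2real ?B = ?b powr q"
        using pq by (simp add: powr_powr)
      also have "\<dots> \<le> b powr q"
        using pq \<open>e > 0\<close> by (intro powr_mono2) (auto simp: b_def)
      finally show ?thesis
        using fin(2) by (metis ennreal_enn2real ennreal_leI infinity_ennreal_def)
    qed
    have young: "u x * v x \<le> a * b / (p * a powr p) * u x powr p + a * b / (q * b powr q) * v x powr q" for x
    proof -
      have "(u x / a) * (v x / b) \<le> (u x / a) powr p / p + (v x / b) powr q / q"
        using pq nonneg \<open>a > 0\<close> \<open>b > 0\<close> by (intro Youngs_inequality) auto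
      then have "u x * v x \<le> a * b * ((u x / a) powr p / p + (v x / b) powr q / q)"
        using \<open>a > 0\<close> \<open>b > 0\<close> by (simp add: field_simps)
      also have "\<dots> = a * b / (p * a powr p) * u x powr p + a * b / (q * b powr q) * v x powr q"
        using nonneg \<open>a > 0\<close> \<open>b > 0\<close> pq by (simp add: powr_divide field_simps)
      finally show ?thesis .
    qed
    have "?I \<le> (\<integral>\<^sup>+x. ennreal (a * b / (p * a powr p)) * ennreal (u x powr p)
                + ennreal (a * b / (q * b powr q)) * ennreal (v x powr q) \<partial>M)"
      using young pq \<open>a > 0\<close> \<open>b > 0\<close>
      by (intro nn_integral_mono) (auto simp: ennreal_mult'[symmetric] ennreal_plus[symmetric] simp del: ennreal_plus intro!: ennreal_leI)
    also have "\<dots> = ennreal (a * b / (p * a powr p)) * ?A + ennreal (a * b / (q * b powr q)) * ?B"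
      by (simp add: nn_integral_add nn_integral_cmult)
    also have "\<dots> \<le> ennreal (a * b / (p * a powr p)) * ennreal (a powr p)
                   + ennreal (a * b / (q * b powr q)) * ennreal (b powr q)"
      using A B by (intro add_mono mult_left_mono) auto
    also have "\<dots> = ennreal (a * b / p + a * b / q)"
      using pq(1,2) \<open>a > 0\<close> \<open>b > 0\<close>
      by (simp add: ennreal_mult'[symmetric] ennreal_plus[symmetric] del: ennreal_plus)
    also have "a * b / p + a * b / q = a * b * (1/p + 1/q)"
      by (simp add: distrib_left)
    finally show ?thesis
      using pq(3) by (simp add: a_def b_def)
  qed
  have lim: "((\<lambda>e. ennreal ((?a + e) * (?b + e))) \<longlongrightarrow> ennreal ((?a + 0) * (?b + 0))) (at_right 0)"
    by (intro tendsto_ennrealI tendsto_intros)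
  have "?I \<le> ennreal ((?a + 0) * (?b + 0))"
    using bound
    by (intro tendsto_lowerbound[OF lim]) (auto simp: eventually_at_right_less eventually_at_filter)
  then show ?thesis by simp
qed

lemma lp_norm_1: "lp_norm M 1 f = (\<integral>\<^sup>+x. ennreal (norm (f x)) \<partial>M)"
  by (auto simp: lp_norm_def Let_def less_top)

lemma lp_norm_finite_exponent:
  assumes "p < \<infinity>" "(\<integral>\<^sup>+x. ennreal (norm (f x) powr enn2real p) \<partial>M) < \<infinity>"
  shows "lp_norm M p f =
    ennreal (enn2real (\<integral>\<^sup>+x. ennreal (norm (f x) powr enn2real p) \<partial>M) powr (1 / enn2real p))"
  using assms by (auto simp: lp_norm_def Let_def)

lemma AE_le_lp_norm_infinity: "AE x in M. ennreal (norm (f x)) \<le> lp_norm M \<infinity> f"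
  using esssup_AE[where M = M and f = "\<lambda>x. ennreal (norm (f x))"] by (simp add: lp_norm_def)

lemma lp_norm_infinity_le:
  assumes "f \<in> borel_measurable M" "AE x in M. ennreal (norm (f x)) \<le> c"
  shows "lp_norm M \<infinity> f \<le> c"
  using assms by (auto simp: lp_norm_def intro!: esssup_I)

lemma conj_exponent_finite:
  assumes "1 < q" "q < \<infinity>"
  shows "1 < enn2real q" "1 < enn2real (conj_exponent q)"
    "1 / enn2real (conj_exponent q) + 1 / enn2real q = 1" "conj_exponent q < \<infinity>"
proof -
  obtain t where t: "q = ennreal t" "t > 1"
    using assms by (cases q) (auto simp: ennreal_less_iff simp flip: ennreal_1)
  have "inverse q = ennreal (1/t)"
    using t by (simp add: inverse_ennreal divide_inverse)
  then have "1 - inverse q = ennreal (1 - 1/t)"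
    using t by (simp add: ennreal_minus flip: ennreal_1)
  moreover have "1 - 1/t > 0" using t by simp
  ultimately have c: "conj_exponent q = ennreal (inverse (1 - 1/t))"
    by (simp add: conj_exponent_def inverse_ennreal)
  have e: "enn2real q = t" "enn2real (conj_exponent q) = inverse (1 - 1/t)"
    using t c \<open>1 - 1/t > 0\<close> by (auto simp: less_imp_le)
  show "1 < enn2real q" "1 < enn2real (conj_exponent q)"
    "1 / enn2real (conj_exponent q) + 1 / enn2real q = 1" "conj_exponent q < \<infinity>"
    unfolding e using t c by (auto simp: field_simps)
qed

lemma conj_exponent_less_infinity:
  assumes "1 < q"
  shows "conj_exponent q < \<infinity>" "1 \<le> enn2real (conj_exponent q)"
proof -
  have "conj_exponent q < \<infinity> \<and> 1 \<le> enn2real (conj_exponent q)"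
  proof (cases "q = \<infinity>")
    case True
    then show ?thesis using conj_exponent_infinity by simp
  next
    case False
    then have "q < \<infinity>" by (simp add: less_top)
    then show ?thesis using conj_exponent_finite[OF assms] by auto
  qed
  then show "conj_exponent q < \<infinity>" "1 \<le> enn2real (conj_exponent q)" by auto
qed

text \<open>The form used below: the first factor is measured only on \<open>S\<close>, with the conjugate exponent, and the
endpoints \<open>q = 1\<close> and \<open>q = \<infinity>\<close> are included. It is applied with \<open>u = P\<close> on a ball and with \<open>u = 1\<close> on
a sub-level set of \<open>P\<close>.\<close>

lemma Holder_lp_norm:
  fixes u :: "'a \<Rightarrow> real" and f :: "'a \<Rightarrow> 'b::{real_normed_vector, second_countable_topology}"
  assumes q: "1 \<le> q" and S[measurable]: "S \<in> sets M"
    and u: "u \<in> borel_measurable M"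
    and f[measurable]: "f \<in> borel_measurable M"
    and fin: "lp_norm (restrict_space M S) (conj_exponent q) u < \<infinity>" "lp_norm M q f < \<infinity>"
  shows "(\<integral>\<^sup>+x\<in>S. ennreal (\<bar>u x\<bar> * norm (f x)) \<partial>M) \<le>
    lp_norm (restrict_space M S) (conj_exponent q) u * lp_norm M q f"
proof -
  let ?R = "restrict_space M S"
  note [measurable] = u
  have uR[measurable]: "u \<in> borel_measurable ?R" and fR[measurable]: "f \<in> borel_measurable ?R"
    by (auto intro!: measurable_restrict_space1)
  have sp: "S \<inter> space M \<in> sets M" by simp
  have eq: "(\<integral>\<^sup>+x\<in>S. g x \<partial>M) = (\<integral>\<^sup>+x. g x \<partial>?R)" for g
    by (rule nn_integral_restrict_space[OF sp, symmetric])
  have le: "(\<integral>\<^sup>+x. g x \<partial>?R) \<le> (\<integral>\<^sup>+x. g x \<partial>M)" for g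
    unfolding eq[symmetric] by (intro nn_integral_mono) (auto split: split_indicator)
  have split: "ennreal (\<bar>u x\<bar> * norm (f x)) = ennreal \<bar>u x\<bar> * ennreal (norm (f x))" for x
    by (simp add: ennreal_mult)
  consider "q = 1" | "q = \<infinity>" | "1 < q" "q < \<infinity>"
    using q by (metis less_top infinity_ennreal_def order_le_less)
  then show ?thesis
  proof cases
    case 1
    have "(\<integral>\<^sup>+x. ennreal \<bar>u x\<bar> * ennreal (norm (f x)) \<partial>?R)
        \<le> (\<integral>\<^sup>+x. lp_norm ?R \<infinity> u * ennreal (norm (f x)) \<partial>?R)"
      using AE_le_lp_norm_infinity[where M = ?R and f = u]
      by (intro nn_integral_mono_AE) (auto elim!: eventually_mono intro!: mult_right_mono)
    also have "\<dots> = lp_norm ?R \<infinity> u * (\<integral>\<^sup>+x. ennreal (norm (f x)) \<partial>?R)"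
      by (rule nn_integral_cmult) simp
    also have "\<dots> \<le> lp_norm ?R \<infinity> u * (\<integral>\<^sup>+x. ennreal (norm (f x)) \<partial>M)"
      by (intro mult_left_mono le) simp
    finally show ?thesis
      by (simp add: 1 conj_exponent_1 lp_norm_1 eq split)
  next
    case 2
    have "AE x in ?R. ennreal (norm (f x)) \<le> lp_norm M \<infinity> f"
      using AE_le_lp_norm_infinity[where M = M and f = f] by (subst AE_restrict_space_iff[OF sp]) auto
    then have "(\<integral>\<^sup>+x. ennreal \<bar>u x\<bar> * ennreal (norm (f x)) \<partial>?R)
        \<le> (\<integral>\<^sup>+x. ennreal \<bar>u x\<bar> * lp_norm M \<infinity> f \<partial>?R)"
      by (intro nn_integral_mono_AE) (auto elim!: eventually_mono intro!: mult_left_mono)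
    also have "\<dots> = (\<integral>\<^sup>+x. ennreal \<bar>u x\<bar> \<partial>?R) * lp_norm M \<infinity> f"
      by (rule nn_integral_multc) simp
    finally show ?thesis
      using conj_exponent_infinity by (simp add: 2 lp_norm_1 eq split)
  next
    case 3
    note pq = conj_exponent_finite[OF 3]
    let ?p = "enn2real (conj_exponent q)" and ?q = "enn2real q"
    have finu: "(\<integral>\<^sup>+x. ennreal (\<bar>u x\<bar> powr ?p) \<partial>?R) < \<infinity>"
      using fin(1) pq(4) by (auto simp: lp_norm_def Let_def less_top split: if_splits)
    have finf: "(\<integral>\<^sup>+x. ennreal (norm (f x) powr ?q) \<partial>M) < \<infinity>"
      using fin(2) 3 by (auto simp: lp_norm_def Let_def less_top split: if_splits)
    have finfR: "(\<integral>\<^sup>+x. ennreal (norm (f x) powr ?q) \<partial>?R) < \<infinity>"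
      using le finf by (rule le_less_trans)
    have "(\<integral>\<^sup>+x. ennreal (\<bar>u x\<bar> * norm (f x)) \<partial>?R) \<le>
       ennreal (enn2real (\<integral>\<^sup>+x. ennreal (\<bar>u x\<bar> powr ?p) \<partial>?R) powr (1/?p)
           * enn2real (\<integral>\<^sup>+x. ennreal (norm (f x) powr ?q) \<partial>?R) powr (1/?q))"
      using pq finu finfR by (intro Holder_nn_integral) auto
    also have "\<dots> \<le> ennreal (enn2real (\<integral>\<^sup>+x. ennreal (\<bar>u x\<bar> powr ?p) \<partial>?R) powr (1/?p)
           * enn2real (\<integral>\<^sup>+x. ennreal (norm (f x) powr ?q) \<partial>M) powr (1/?q))"
      using pq finf by (intro ennreal_leI mult_left_mono powr_mono2 enn2real_mono le) auto
    also have "\<dots> = lp_norm ?R (conj_exponent q) u * lp_norm M q f"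
      using finu finf 3 pq(4) by (simp add: lp_norm_finite_exponent ennreal_mult)
    finally show ?thesis
      by (simp add: eq)
  qed
qed

section \<open>Lower bound for the sign radius\<close>

lemma sign_class_radius_set:
  assumes "f \<in> sign_class r s P"
  shows "{\<rho>. 0 < \<rho> \<and> (\<forall>x. \<rho> \<le> norm x \<longrightarrow> 0 \<le> P x * f x)} \<noteq> {}"
proof -
  have "\<forall>\<^sub>F x in at_infinity. 0 \<le> P x * f x"
    using assms by (simp add: sign_class_def)
  then obtain b where "\<forall>x. b \<le> norm x \<longrightarrow> 0 \<le> P x * f x"
    by (auto simp: eventually_at_infinity)
  then have "max b 1 \<in> {\<rho>. 0 < \<rho> \<and> (\<forall>x. \<rho> \<le> norm x \<longrightarrow> 0 \<le> P x * f x)}"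
    by auto
  then show ?thesis by blast
qed

lemma sign_radius_nonneg:
  assumes "f \<in> sign_class r s P"
  shows "0 \<le> sign_radius (\<lambda>x. P x * f x)"
  unfolding sign_radius_def using sign_class_radius_set[OF assms] by (intro cInf_greatest) auto

lemma sign_radius_le:
  assumes "0 < \<rho>" "\<And>x. \<rho> \<le> norm x \<Longrightarrow> 0 \<le> f x"
  shows "sign_radius f \<le> \<rho>"
  unfolding sign_radius_def using assms by (intro cInf_lower bdd_belowI[where m=0]) auto

lemma sign_const_le_sign_radius:
  assumes "f \<in> sign_class r s P"
  shows "sign_const r s P \<le> sign_radius (\<lambda>x. P x * f x)"
  unfolding sign_const_def using assms sign_radius_nonneg
  by (intro cINF_lower bdd_belowI2[where m=0]) auto

text \<open>Both infima, over the class and over the radii, are unfolded at once, so that lower bounds only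
have to be proved for single radii beyond which \<open>P f\<close> is nonnegative.\<close>

lemma sign_const_greatest:
  assumes "sign_class r s P \<noteq> {}"
    and "\<And>f \<rho>. f \<in> sign_class r s P \<Longrightarrow> 0 < \<rho> \<Longrightarrow> (\<And>x. \<rho> \<le> norm x \<Longrightarrow> 0 \<le> P x * f x) \<Longrightarrow> c \<le> \<rho>"
  shows "c \<le> sign_const r s P"
  unfolding sign_const_def
proof (rule cINF_greatest[OF assms(1)])
  fix f assume f: "f \<in> sign_class r s P"
  show "c \<le> sign_radius (\<lambda>x. P x * f x)"
    unfolding sign_radius_def using sign_class_radius_set[OF f] assms(2)[OF f]
    by (intro cInf_greatest) auto
qed

lemma sign_class_lp_norm_le:
  fixes P :: "'a::euclidean_space \<Rightarrow> real"
  assumes f: "f \<in> sign_class r s P" and s: "s \<in> {1, -1}"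
    and C: "admissibility_inequality r P q C"
  shows "lp_norm lebesgue q (\<lambda>x. complex_of_real (f x))
       \<le> ennreal C * (\<integral>\<^sup>+x. ennreal \<bar>P x * f x\<bar> \<partial>lebesgue)"
proof -
  have 1: "integrable lebesgue (\<lambda>x. complex_of_real (f x))"
    and 2: "AE \<xi> in lebesgue. fourier (\<lambda>x. complex_of_real (f x)) \<xi>
              = complex_of_real s * \<i> ^ r * complex_of_real (f \<xi>)"
    and 3: "integrable lebesgue (\<lambda>x. complex_of_real (P x) * complex_of_real (f x))"
    using f by (auto simp: sign_class_def simp flip: of_real_mult)
  show ?thesis
    using C s 1 2 3 unfolding admissibility_inequality_def lp_norm_1
    by (force simp: norm_mult abs_mult)
qed

text \<open>A nonempty open set is not negligible.\<close>

lemma continuous_AE_zero_imp_zero: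
  fixes f :: "'a::euclidean_space \<Rightarrow> 'b::real_normed_vector"
  assumes "continuous_on UNIV f" "AE x in lebesgue. f x = 0"
  shows "f = (\<lambda>x. 0)"
proof (rule ccontr)
  assume "f \<noteq> (\<lambda>x. 0)"
  then obtain x where x: "f x \<noteq> 0" by auto
  have op: "open {x. f x \<noteq> 0}"
    using assms(1) by (intro open_Collect_neq) auto
  then have "{x. f x \<noteq> 0} \<in> sets lebesgue"
    by simp
  moreover have "AE y in lebesgue. y \<notin> {x. f x \<noteq> 0}"
    using assms(2) by simp
  ultimately have "negligible {x. f x \<noteq> 0}"
    unfolding negligible_iff_null_sets by (subst AE_iff_null_sets)
  then show False
    using x op open_not_negligible by blast
qed

text \<open>Otherwise the admissibility inequality forces \<open>f = 0\<close> almost everywhere, hence everywhere by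
continuity. This positivity is what allows dividing by the norm of \<open>P f\<close>.\<close>

lemma sign_class_nn_integral_pos:
  fixes P :: "'a::euclidean_space \<Rightarrow> real"
  assumes f: "f \<in> sign_class r s P" and s: "s \<in> {1, -1}" and q: "1 \<le> q"
    and C: "admissibility_inequality r P q C"
  shows "0 < (\<integral>\<^sup>+x. ennreal \<bar>P x * f x\<bar> \<partial>lebesgue)" (is "0 < ?I")
proof (rule ccontr)
  assume "\<not> 0 < ?I"
  then have I: "?I = 0" by (simp add: not_less)
  have [measurable]: "f \<in> borel_measurable lebesgue"
    using f by (auto simp: sign_class_def)
  have "lp_norm lebesgue q (\<lambda>x. complex_of_real (f x)) = 0"
    using sign_class_lp_norm_le[OF f s C] I by simp
  then have "AE x in lebesgue. f x = 0"
  proof (cases "q = \<infinity>")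
    case True
    assume *: "lp_norm lebesgue q (\<lambda>x. complex_of_real (f x)) = 0"
    show ?thesis
      using AE_le_lp_norm_infinity[where M = lebesgue and f = "\<lambda>x. complex_of_real (f x)"] * True
      by auto
  next
    case False
    assume *: "lp_norm lebesgue q (\<lambda>x. complex_of_real (f x)) = 0"
    let ?J = "\<integral>\<^sup>+x. ennreal (\<bar>f x\<bar> powr enn2real q) \<partial>lebesgue"
    have J: "?J \<noteq> \<infinity>" "ennreal (enn2real ?J powr (1 / enn2real q)) = 0"
      using * False by (auto simp: lp_norm_def Let_def split: if_splits)
    then have "enn2real ?J = 0" by (simp add: ennreal_eq_0_iff)
    then have "?J = 0"
      using J(1) by (simp add: enn2real_eq_0_iff)
    then have "AE x in lebesgue. ennreal (\<bar>f x\<bar> powr enn2real q) = 0"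
      by (subst (asm) nn_integral_0_iff_AE) auto
    then show ?thesis
      by eventually_elim (auto simp: ennreal_eq_0_iff)
  qed
  moreover have "continuous_on UNIV f" "f \<noteq> (\<lambda>x. 0)"
    using f by (auto simp: sign_class_def)
  ultimately show False
    using continuous_AE_zero_imp_zero by blast
qed

text \<open>As the integral of \<open>h\<close> is at most \<open>0\<close>, the positive part of \<open>h\<close> has no more mass than the negative
part, which lives on \<open>S\<close>.\<close>

lemma nn_integral_abs_le_twice_negative_part:
  fixes h :: "'a \<Rightarrow> real"
  assumes h: "integrable M h" "(\<integral>x. h x \<partial>M) \<le> 0"
    and S: "S \<in> sets M" "\<And>x. x \<in> space M \<Longrightarrow> x \<notin> S \<Longrightarrow> 0 \<le> h x"
  shows "(\<integral>\<^sup>+x. ennreal \<bar>h x\<bar> \<partial>M) \<le> 2 * (\<integral>\<^sup>+x\<in>S. ennreal \<bar>h x\<bar> \<partial>M)"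
proof -
  have i: "integrable M (\<lambda>x. \<bar>h x\<bar>)" "integrable M (\<lambda>x. indicator S x * \<bar>h x\<bar>)"
    using h(1) S(1) by (auto intro!: integrable_real_mult_indicator simp: mult.commute)
  have "(\<integral>x. \<bar>h x\<bar> \<partial>M) \<le> (\<integral>x. h x + 2 * (indicator S x * \<bar>h x\<bar>) \<partial>M)"
    using h i S(2) by (intro integral_mono) (auto split: split_indicator)
  also have "\<dots> = (\<integral>x. h x \<partial>M) + 2 * (\<integral>x. indicator S x * \<bar>h x\<bar> \<partial>M)"
    using h i by simp
  also have "\<dots> \<le> 2 * (\<integral>x. indicator S x * \<bar>h x\<bar> \<partial>M)"
    using h(2) by simp
  finally have "ennreal (\<integral>x. \<bar>h x\<bar> \<partial>M) \<le> ennreal (2 * (\<integral>x. indicator S x * \<bar>h x\<bar> \<partial>M))"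
    by (rule ennreal_leI)
  also have "\<dots> = 2 * ennreal (\<integral>x. indicator S x * \<bar>h x\<bar> \<partial>M)"
    by (simp add: ennreal_mult')
  also have "ennreal (\<integral>x. \<bar>h x\<bar> \<partial>M) = (\<integral>\<^sup>+x. ennreal \<bar>h x\<bar> \<partial>M)"
    using i by (intro nn_integral_eq_integral[symmetric]) auto
  also have "ennreal (\<integral>x. indicator S x * \<bar>h x\<bar> \<partial>M) = (\<integral>\<^sup>+x. ennreal (indicator S x * \<bar>h x\<bar>) \<partial>M)"
    using i by (intro nn_integral_eq_integral[symmetric]) auto
  also have "\<dots> = (\<integral>\<^sup>+x\<in>S. ennreal \<bar>h x\<bar> \<partial>M)"
    by (intro nn_integral_cong) (auto split: split_indicator)
  finally show ?thesis .
qed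

text \<open>The core of the lower bound: half of the mass of \<open>P f\<close> lies in the ball, where it is controlled by
the Hoelder inequality and then, through the admissibility inequality, by the mass itself.\<close>

lemma one_le_lp_norm_ball:
  fixes P :: "'a::euclidean_space \<Rightarrow> real"
  assumes P: "P \<in> borel_measurable lebesgue" and q: "1 \<le> q"
    and C: "0 < C" "admissibility_inequality r P q C"
    and f: "f \<in> sign_class r s P" and s: "s \<in> {1, -1}"
    and nonneg: "\<And>x. \<rho> \<le> norm x \<Longrightarrow> 0 \<le> P x * f x"
  shows "1 \<le> ennreal (2 * C) * lp_norm (lebesgue_on (ball 0 \<rho>)) (conj_exponent q) P"
proof (cases "lp_norm (lebesgue_on (ball 0 \<rho>)) (conj_exponent q) P < \<infinity>")
  case False
  then have "lp_norm (lebesgue_on (ball 0 \<rho>)) (conj_exponent q) P = top"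
    by (simp add: less_top[symmetric])
  then show ?thesis using C(1) by (simp add: ennreal_mult_top)
next
  case True
  let ?I = "\<integral>\<^sup>+x. ennreal \<bar>P x * f x\<bar> \<partial>lebesgue"
  let ?N = "lp_norm (lebesgue_on (ball 0 \<rho>)) (conj_exponent q) P"
  let ?F = "lp_norm lebesgue q (\<lambda>x. complex_of_real (f x))"
  have i: "integrable lebesgue (\<lambda>x. P x * f x)" "(\<integral>x. P x * f x \<partial>lebesgue) \<le> 0"
    and [measurable]: "f \<in> borel_measurable lebesgue"
    using f by (auto simp: sign_class_def)
  have Ifin: "?I < \<infinity>"
    using i(1) by (auto simp: integrable_iff_bounded)
  have Ipos: "0 < ?I"
    by (rule sign_class_nn_integral_pos[OF f s q C(2)])
  have F: "?F \<le> ennreal C * ?I"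
    by (rule sign_class_lp_norm_le[OF f s C(2)])
  moreover have "ennreal C * ?I < \<infinity>"
    using Ifin by (simp add: ennreal_mult_less_top)
  ultimately have Ffin: "?F < \<infinity>"
    by (rule le_less_trans)
  have "(\<integral>\<^sup>+x\<in>ball 0 \<rho>. ennreal \<bar>P x * f x\<bar> \<partial>lebesgue)
      = (\<integral>\<^sup>+x\<in>ball 0 \<rho>. ennreal (\<bar>P x\<bar> * norm (complex_of_real (f x))) \<partial>lebesgue)"
    by (simp add: abs_mult)
  also have "\<dots> \<le> ?N * ?F"
    using True Ffin P q by (intro Holder_lp_norm) auto
  also have "\<dots> \<le> ?N * (ennreal C * ?I)"
    by (intro mult_left_mono F) auto
  finally have H: "(\<integral>\<^sup>+x\<in>ball 0 \<rho>. ennreal \<bar>P x * f x\<bar> \<partial>lebesgue) \<le> ?N * (ennreal C * ?I)" .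
  have "?I * 1 \<le> 2 * (\<integral>\<^sup>+x\<in>ball 0 \<rho>. ennreal \<bar>P x * f x\<bar> \<partial>lebesgue)"
    using i nonneg unfolding mult_1_right
    by (intro nn_integral_abs_le_twice_negative_part) auto
  also have "2 * (\<integral>\<^sup>+x\<in>ball 0 \<rho>. ennreal \<bar>P x * f x\<bar> \<partial>lebesgue) \<le> 2 * (?N * (ennreal C * ?I))"
    by (intro mult_left_mono H) auto
  also have "\<dots> = ?I * (ennreal (2 * C) * ?N)"
    using C(1) by (simp add: ennreal_mult mult_ac)
  finally show ?thesis
    using Ipos Ifin by (subst (asm) ennreal_mult_le_mult_iff) auto
qed

section \<open>Homogeneous weights\<close>

lemma lebesgue_scaleR:
  fixes \<delta> :: real
  assumes "0 < \<delta>"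
  shows "lebesgue = density (distr lebesgue lebesgue (\<lambda>x::'a::euclidean_space. \<delta> *\<^sub>R x)) (\<lambda>_. ennreal (\<delta> ^ DIM('a)))"
    and "(\<lambda>x::'a. \<delta> *\<^sub>R x) \<in> lebesgue \<rightarrow>\<^sub>M lebesgue"
proof -
  have "0 + (\<Sum>j\<in>Basis. (\<delta> * (x \<bullet> j)) *\<^sub>R j) = \<delta> *\<^sub>R x" for x :: 'a
    by (simp add: euclidean_representation flip: scaleR_scaleR scaleR_sum_right)
  then show "lebesgue = density (distr lebesgue lebesgue (\<lambda>x::'a. \<delta> *\<^sub>R x)) (\<lambda>_. ennreal (\<delta> ^ DIM('a)))"
    "(\<lambda>x::'a. \<delta> *\<^sub>R x) \<in> lebesgue \<rightarrow>\<^sub>M lebesgue"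
    using assms lebesgue_affine_euclidean[of "\<lambda>_::'a. \<delta>" 0] lebesgue_affine_measurable[of "\<lambda>_::'a. \<delta>" 0]
    by simp_all
qed

lemma nn_integral_lebesgue_scaleR:
  fixes f :: "'a::euclidean_space \<Rightarrow> ennreal"
  assumes f: "f \<in> borel_measurable lebesgue" and \<delta>: "0 < \<delta>"
  shows "(\<integral>\<^sup>+x. f x \<partial>lebesgue) = ennreal (\<delta> ^ DIM('a)) * (\<integral>\<^sup>+x. f (\<delta> *\<^sub>R x) \<partial>lebesgue)"
proof -
  note T = lebesgue_scaleR(2)[OF \<delta>, where 'a='a]
  have "(\<integral>\<^sup>+x. f x \<partial>lebesgue)
      = (\<integral>\<^sup>+x. f x \<partial>density (distr lebesgue lebesgue (\<lambda>x::'a. \<delta> *\<^sub>R x)) (\<lambda>_. ennreal (\<delta> ^ DIM('a))))"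
    using lebesgue_scaleR(1)[OF \<delta>, where 'a='a] by simp
  also have "\<dots> = (\<integral>\<^sup>+x. ennreal (\<delta> ^ DIM('a)) * f (\<delta> *\<^sub>R x) \<partial>lebesgue)"
    using T f by (subst nn_integral_density) (auto simp: nn_integral_distr)
  also have "\<dots> = ennreal (\<delta> ^ DIM('a)) * (\<integral>\<^sup>+x. f (\<delta> *\<^sub>R x) \<partial>lebesgue)"
    using measurable_compose[OF T f] by (rule nn_integral_cmult)
  finally show ?thesis .
qed

lemma AE_lebesgue_scaleR:
  assumes \<delta>: "0 < \<delta>" and "AE x in lebesgue. Q (x::'a::euclidean_space)"
  shows "AE x in lebesgue. Q (\<delta> *\<^sub>R x)"
proof -
  have "AE x in density (distr lebesgue lebesgue (\<lambda>x::'a. \<delta> *\<^sub>R x)) (\<lambda>_. ennreal (\<delta> ^ DIM('a))). Q x"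
    using assms(2) by (subst lebesgue_scaleR(1)[OF \<delta>, where 'a='a, symmetric])
  then have "AE x in distr lebesgue lebesgue (\<lambda>x::'a. \<delta> *\<^sub>R x). Q x"
    using \<delta> by (subst (asm) AE_density) auto
  then show ?thesis
    by (rule AE_distrD[OF lebesgue_scaleR(2)[OF \<delta>]])
qed

lemma homogeneous_lp_norm_infinity_ball_le:
  fixes P :: "'a::euclidean_space \<Rightarrow> real"
  assumes P[measurable]: "P \<in> borel_measurable lebesgue" and hom: "homogeneous \<gamma> P" and \<delta>: "0 < \<delta>"
  shows "lp_norm (lebesgue_on (ball 0 (\<delta> * \<rho>))) \<infinity> P
       \<le> ennreal (\<delta> powr \<gamma>) * lp_norm (lebesgue_on (ball 0 \<rho>)) \<infinity> P"
proof (rule lp_norm_infinity_le)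
  let ?N = "lp_norm (lebesgue_on (ball 0 \<rho>)) \<infinity> P"
  have "AE x in lebesgue. x \<in> ball 0 \<rho> \<longrightarrow> ennreal (norm (P x)) \<le> ?N"
    using AE_le_lp_norm_infinity[where M = "lebesgue_on (ball 0 \<rho>)" and f = P]
    by (subst (asm) AE_restrict_space_iff) auto
  then have "AE x in lebesgue. (1/\<delta>) *\<^sub>R x \<in> ball 0 \<rho> \<longrightarrow> ennreal (norm (P ((1/\<delta>) *\<^sub>R x))) \<le> ?N"
    using \<delta> by (intro AE_lebesgue_scaleR) auto
  then have "AE x in lebesgue. x \<in> ball 0 (\<delta> * \<rho>) \<longrightarrow> ennreal (norm (P x)) \<le> ennreal (\<delta> powr \<gamma>) * ?N"
  proof eventually_elim
    case (elim x)
    show ?case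
    proof
      assume "x \<in> ball 0 (\<delta> * \<rho>)"
      then have "(1/\<delta>) *\<^sub>R x \<in> ball 0 \<rho>"
        using \<delta> by (simp add: field_simps)
      moreover have "P (\<delta> *\<^sub>R (1/\<delta>) *\<^sub>R x) = \<delta> powr \<gamma> * P ((1/\<delta>) *\<^sub>R x)"
        using hom \<delta> unfolding homogeneous_def by blast
      then have "P x = \<delta> powr \<gamma> * P ((1/\<delta>) *\<^sub>R x)"
        using \<delta> by simp
      then have "ennreal (norm (P x)) = ennreal (\<delta> powr \<gamma>) * ennreal (norm (P ((1/\<delta>) *\<^sub>R x)))"
        by (simp only: real_norm_def abs_mult abs_of_nonneg[OF powr_ge_zero] ennreal_mult'[OF powr_ge_zero])
      ultimately show "ennreal (norm (P x)) \<le> ennreal (\<delta> powr \<gamma>) * ?N"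
        using elim by (auto intro!: mult_left_mono)
    qed
  qed
  then show "AE x in lebesgue_on (ball 0 (\<delta> * \<rho>)). ennreal (norm (P x)) \<le> ennreal (\<delta> powr \<gamma>) * ?N"
    by (subst AE_restrict_space_iff) auto
qed (auto intro!: measurable_restrict_space1)

lemma homogeneous_nn_integral_ball:
  fixes P :: "'a::euclidean_space \<Rightarrow> real" and \<gamma> p :: real
  assumes P[measurable]: "P \<in> borel_measurable lebesgue" and hom: "homogeneous \<gamma> P" and \<rho>: "0 < \<rho>"
  shows "(\<integral>\<^sup>+x\<in>ball 0 \<rho>. ennreal (\<bar>P x\<bar> powr p) \<partial>lebesgue)
       = ennreal (\<rho> powr (DIM('a) + \<gamma> * p)) * (\<integral>\<^sup>+x\<in>ball 0 1. ennreal (\<bar>P x\<bar> powr p) \<partial>lebesgue)"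
proof -
  have [measurable]: "ball (0::'a) \<epsilon> \<in> sets lebesgue" for \<epsilon>
    by simp
  have "(\<integral>\<^sup>+x\<in>ball 0 \<rho>. ennreal (\<bar>P x\<bar> powr p) \<partial>lebesgue)
      = ennreal (\<rho> ^ DIM('a)) *
        (\<integral>\<^sup>+x. ennreal (\<bar>P (\<rho> *\<^sub>R x)\<bar> powr p) * indicator (ball 0 \<rho>) (\<rho> *\<^sub>R x) \<partial>lebesgue)"
    using \<rho> by (intro nn_integral_lebesgue_scaleR) auto
  also have "(\<integral>\<^sup>+x. ennreal (\<bar>P (\<rho> *\<^sub>R x)\<bar> powr p) * indicator (ball 0 \<rho>) (\<rho> *\<^sub>R x) \<partial>lebesgue)
     = (\<integral>\<^sup>+x. ennreal (\<rho> powr (\<gamma> * p)) * (ennreal (\<bar>P x\<bar> powr p) * indicator (ball 0 1) x) \<partial>lebesgue)"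
    using hom \<rho>
    by (intro nn_integral_cong)
       (auto simp: homogeneous_def abs_mult powr_mult powr_powr ennreal_mult split: split_indicator)
  also have "\<dots> = ennreal (\<rho> powr (\<gamma> * p)) * (\<integral>\<^sup>+x\<in>ball 0 1. ennreal (\<bar>P x\<bar> powr p) \<partial>lebesgue)"
    by (intro nn_integral_cmult) auto
  finally show ?thesis
    using \<rho> by (simp add: mult.assoc[symmetric] ennreal_mult[symmetric] powr_add powr_realpow)
qed

text \<open>The bound is the integral of \<open>K\<^sup>p \<bar>x\<bar>\<^bsup>\<gamma> p\<^esup>\<close> in polar coordinates, obtained without them from
self-similarity. Let \<open>j\<close> be the integral over the unit ball, \<open>d\<close> the dimension, \<open>V\<close> the volume of
the unit ball and \<open>m = d + \<gamma> p\<close>. The ball of radius \<open>\<theta>\<close> carries \<open>\<theta>\<^sup>m j\<close>, and the remaining annulus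
at most \<open>K\<^sup>p V (1 - \<theta>\<^sup>d)\<close>; dividing \<open>(1 - \<theta>\<^sup>m) j \<le> K\<^sup>p V (1 - \<theta>\<^sup>d)\<close> by \<open>1 - \<theta>\<close> and letting \<open>\<theta>\<close> tend
to \<open>1\<close> gives \<open>m j \<le> K\<^sup>p V d\<close>.\<close>

lemma homogeneous_integral_unit_ball_le:
  fixes P :: "'a::euclidean_space \<Rightarrow> real" and \<gamma> p :: real
  assumes P[measurable]: "P \<in> borel_measurable lebesgue"
    and hom: "homogeneous \<gamma> P" and \<gamma>: "0 \<le> \<gamma>" and p: "0 < p"
    and fin: "lp_norm (lebesgue_on (ball 0 1)) \<infinity> P < \<infinity>"
  defines "K \<equiv> enn2real (lp_norm (lebesgue_on (ball 0 1)) \<infinity> P)"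
  shows "(\<integral>\<^sup>+x\<in>ball 0 1. ennreal (\<bar>P x\<bar> powr p) \<partial>lebesgue)
       \<le> ennreal (K powr p * (2 * pi powr (DIM('a) / 2)) / (Gamma (DIM('a) / 2) * (DIM('a) + \<gamma> * p)))"
    (is "?J \<le> _")
proof -
  define d where "d = DIM('a)"
  define m where "m = d + \<gamma> * p"
  define V where "V = unit_ball_vol d"
  have d: "d > 0" and m: "m > 0" and V: "V > 0"
    using \<gamma> p by (auto simp: d_def m_def V_def intro!: add_pos_nonneg)
  have K: "0 \<le> K" by (simp add: K_def)
  have em: "emeasure lebesgue (ball (0::'a) \<rho>) = ennreal (V * \<rho> ^ d)" if "0 \<le> \<rho>" for \<rho>
    using emeasure_ball[OF that, of "0::'a"] by (simp add: V_def d_def)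
  have AE: "AE x in lebesgue. x \<in> ball 0 1 \<longrightarrow> ennreal (\<bar>P x\<bar> powr p) \<le> ennreal (K powr p)"
  proof -
    have "AE x in lebesgue. x \<in> ball 0 1 \<longrightarrow> ennreal (norm (P x)) \<le> ennreal K"
      using AE_le_lp_norm_infinity[where M = "lebesgue_on (ball 0 1)" and f = P] fin
      by (subst (asm) AE_restrict_space_iff) (auto simp: K_def)
    then show ?thesis
      by eventually_elim (use p K in \<open>auto intro!: ennreal_leI powr_mono2\<close>)
  qed
  have annulus: "?J \<le> ennreal (\<theta> powr m) * ?J + ennreal (K powr p * (V * (1 - \<theta> ^ d)))" if \<theta>: "0 < \<theta>" "\<theta> < 1" for \<theta>
  proof -
    have [measurable]: "ball (0::'a) \<epsilon> \<in> sets lebesgue" for \<epsilon>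
      by simp
    have sub: "ball (0::'a) \<theta> \<subseteq> ball 0 1" using \<theta> by auto
    have "?J = (\<integral>\<^sup>+x. ennreal (\<bar>P x\<bar> powr p) * indicator (ball 0 \<theta>) x
        + ennreal (\<bar>P x\<bar> powr p) * indicator (ball 0 1 - ball 0 \<theta>) x \<partial>lebesgue)"
      using sub by (intro nn_integral_cong) (auto split: split_indicator)
    also have "\<dots> = (\<integral>\<^sup>+x\<in>ball 0 \<theta>. ennreal (\<bar>P x\<bar> powr p) \<partial>lebesgue)
        + (\<integral>\<^sup>+x\<in>ball 0 1 - ball 0 \<theta>. ennreal (\<bar>P x\<bar> powr p) \<partial>lebesgue)"
      by (intro nn_integral_add) auto
    also have "(\<integral>\<^sup>+x\<in>ball 0 \<theta>. ennreal (\<bar>P x\<bar> powr p) \<partial>lebesgue) = ennreal (\<theta> powr m) * ?J"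
      using homogeneous_nn_integral_ball[OF P hom \<theta>(1)] by (simp add: m_def d_def)
    also have "(\<integral>\<^sup>+x\<in>ball 0 1 - ball 0 \<theta>. ennreal (\<bar>P x\<bar> powr p) \<partial>lebesgue)
        \<le> (\<integral>\<^sup>+x. ennreal (K powr p) * indicator (ball (0::'a) 1 - ball 0 \<theta>) x \<partial>lebesgue)"
      using AE by (intro nn_integral_mono_AE) (auto elim!: eventually_mono split: split_indicator)
    also have "\<dots> = ennreal (K powr p) * emeasure lebesgue (ball 0 1 - ball (0::'a) \<theta>)"
      by (intro nn_integral_cmult_indicator) auto
    also have "emeasure lebesgue (ball 0 1 - ball (0::'a) \<theta>)
        = emeasure lebesgue (ball (0::'a) 1) - emeasure lebesgue (ball (0::'a) \<theta>)"
      using sub em[of \<theta>] \<theta> by (intro emeasure_Diff) auto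
    also have "\<dots> = ennreal (V * (1 - \<theta> ^ d))"
      using em[of 1] em[of \<theta>] \<theta> V by (simp add: ennreal_minus right_diff_distrib)
    finally show ?thesis
      using K V \<theta> by (simp add: ennreal_mult power_le_one add_left_mono)
  qed
  have Jfin: "?J < \<infinity>"
  proof -
    have "?J \<le> (\<integral>\<^sup>+x. ennreal (K powr p) * indicator (ball (0::'a) 1) x \<partial>lebesgue)"
      using AE by (intro nn_integral_mono_AE) (auto elim!: eventually_mono split: split_indicator)
    also have "\<dots> = ennreal (K powr p) * emeasure lebesgue (ball (0::'a) 1)"
      by (intro nn_integral_cmult_indicator) auto
    also have "\<dots> < \<infinity>"
      using em[of 1] by (simp add: ennreal_mult_less_top)
    finally show ?thesis .
  qed
  define j where "j = enn2real ?J"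
  have j: "?J = ennreal j" "0 \<le> j" using Jfin by (auto simp: j_def)
  \<comment> \<open>\<open>\<phi>\<close> is nonnegative on \<open>{0<..<1}\<close> and vanishes at \<open>1\<close>, so its derivative at \<open>1\<close> is at most \<open>0\<close>.\<close>
  define \<phi> where "\<phi> \<theta> = K powr p * (V * (1 - \<theta> ^ d)) - j * (1 - \<theta> powr m)" for \<theta>
  have \<phi>: "0 \<le> \<phi> \<theta>" if \<theta>: "0 < \<theta>" "\<theta> < 1" for \<theta>
  proof -
    have "0 \<le> K powr p * (V * (1 - \<theta> ^ d))"
      using K V \<theta> by (simp add: power_le_one)
    then have "j \<le> \<theta> powr m * j + K powr p * (V * (1 - \<theta> ^ d))"
      using annulus[OF \<theta>] j by (simp add: ennreal_mult[symmetric] ennreal_plus[symmetric] del: ennreal_plus)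
    then show ?thesis by (simp add: \<phi>_def algebra_simps)
  qed
  have deriv: "(\<phi> has_real_derivative (j * m - K powr p * (V * d))) (at 1)"
    unfolding \<phi>_def using d by (auto intro!: derivative_eq_intros)
  have "j * m \<le> K powr p * (V * d)"
  proof (rule ccontr)
    assume "\<not> ?thesis"
    then obtain e where e: "e > 0" "\<And>h. h > 0 \<Longrightarrow> h < e \<Longrightarrow> \<phi> (1 - h) < \<phi> 1"
      using DERIV_pos_inc_left[OF deriv] by auto
    have "\<phi> (1 - min (e/2) (1/2)) < \<phi> 1" using e by auto
    moreover have "\<phi> 1 = 0" by (simp add: \<phi>_def)
    moreover have "0 \<le> \<phi> (1 - min (e/2) (1/2))"
      by (rule \<phi>) (use e(1) in \<open>auto simp: min_def\<close>)
    ultimately show False by simp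
  qed
  then have "j \<le> K powr p * (V * d) / m"
    using m by (simp add: field_simps)
  also have "V * d = 2 * pi powr (d/2) / Gamma (d/2)"
  proof -
    have "Gamma (d/2 + 1) = d/2 * Gamma (d/2)"
      using d by (intro Gamma_plus1) auto
    moreover have "Gamma (d/2) > 0" using d by (intro Gamma_real_pos) auto
    ultimately show ?thesis
      using d by (simp only: V_def unit_ball_vol_def) (simp add: divide_simps)
  qed
  finally show ?thesis
    unfolding j(1) by (intro ennreal_leI) (simp add: m_def d_def)
qed

lemma lp_loc_infinity_imp_finite_ball:
  assumes "lp_loc \<infinity> P"
  shows "lp_norm (lebesgue_on (ball 0 \<rho>)) \<infinity> P < \<infinity>"
proof -
  let ?N = "lp_norm (lebesgue_on (cball 0 \<rho>)) \<infinity> P"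
  have P: "P \<in> borel_measurable lebesgue" and fin: "?N < \<infinity>"
    using assms by (auto simp: lp_loc_def)
  have "AE x in lebesgue. x \<in> cball 0 \<rho> \<longrightarrow> ennreal (norm (P x)) \<le> ?N"
    using AE_le_lp_norm_infinity[where M = "lebesgue_on (cball 0 \<rho>)" and f = P]
    by (subst (asm) AE_restrict_space_iff) auto
  then have "AE x in lebesgue_on (ball 0 \<rho>). ennreal (norm (P x)) \<le> ?N"
    by (subst AE_restrict_space_iff) (auto elim!: eventually_mono)
  then have "lp_norm (lebesgue_on (ball 0 \<rho>)) \<infinity> P \<le> ?N"
    using P by (intro lp_norm_infinity_le) (auto intro!: measurable_restrict_space1)
  then show ?thesis using fin by simp
qed

text \<open>Solves \<open>1 \<le> 2 C \<parallel>P\<parallel>\<close> for the radius. If \<open>q = 1\<close> and \<open>\<gamma> = 0\<close>, the essential supremum of \<open>P\<close> over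
balls does not depend on the radius, so the smallness hypothesis forces it to vanish and the case
is contradictory.\<close>

lemma explicit_bound_le:
  fixes P :: "'a::euclidean_space \<Rightarrow> real"
  assumes q: "1 \<le> q" and loc: "lp_loc \<infinity> P" and hom: "homogeneous \<gamma> P" and \<gamma>: "0 \<le> \<gamma>"
    and C: "0 < C" and \<rho>: "0 < \<rho>"
    and small: "q = 1 \<Longrightarrow> ((\<lambda>\<rho>. lp_norm (lebesgue_on (ball 0 \<rho>)) \<infinity> P) \<longlongrightarrow> 0) (at_right 0)"
    and one: "1 \<le> ennreal (2 * C) * lp_norm (lebesgue_on (ball 0 \<rho>)) (conj_exponent q) P"
  shows "explicit_bound DIM('a) \<gamma> q (enn2real (lp_norm (lebesgue_on (ball 0 1)) \<infinity> P)) C \<le> \<rho>"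
proof -
  have P[measurable]: "P \<in> borel_measurable lebesgue"
    using loc by (simp add: lp_loc_def)
  let ?N = "\<lambda>\<rho>. lp_norm (lebesgue_on (ball 0 \<rho>)) \<infinity> P"
  define K where "K = enn2real (?N 1)"
  have fin: "?N 1 < \<infinity>"
    by (rule lp_loc_infinity_imp_finite_ball[OF loc])
  then have K: "?N 1 = ennreal K" "0 \<le> K" by (auto simp: K_def)
  show ?thesis
  proof (cases "q = 1")
    case True
    have "1 \<le> ennreal (2 * C) * ?N \<rho>"
      using one True by (simp add: conj_exponent_1)
    also have "\<dots> \<le> ennreal (2 * C) * (ennreal (\<rho> powr \<gamma>) * ennreal K)"
      using homogeneous_lp_norm_infinity_ball_le[OF P hom \<rho>, of 1] K
      by (intro mult_left_mono) auto
    finally have le: "1 \<le> 2 * K * C * \<rho> powr \<gamma>"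
      using C K by (simp add: ennreal_mult[symmetric] mult_ac)
    show ?thesis
    proof (cases "\<gamma> = 0")
      case True
      have "ennreal K \<le> ?N \<epsilon>" if "0 < \<epsilon>" for \<epsilon>
        using homogeneous_lp_norm_infinity_ball_le[OF P hom, of "1/\<epsilon>" \<epsilon>] that K True by simp
      then have "eventually (\<lambda>\<epsilon>. ennreal K \<le> ?N \<epsilon>) (at_right 0)"
        by (auto simp: eventually_at_filter)
      then have "ennreal K \<le> 0"
        using \<open>q = 1\<close> by (intro tendsto_lowerbound[OF small]) auto
      then have "K = 0" using K by (simp add: ennreal_eq_0_iff)
      then show ?thesis using le by simp
    next
      case False
      then have "\<gamma> > 0" using \<gamma> by simp
      have KC: "0 < 2 * K * C" using le C K \<rho> by (cases "K = 0") auto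
      have "1 / (2 * K * C) \<le> \<rho> powr \<gamma>"
        using le KC by (simp add: field_simps)
      then have "(1 / (2 * K * C)) powr (1/\<gamma>) \<le> (\<rho> powr \<gamma>) powr (1/\<gamma>)"
        using KC \<open>\<gamma> > 0\<close> by (intro powr_mono2) auto
      also have "\<dots> = \<rho>" using \<rho> \<open>\<gamma> > 0\<close> by (simp add: powr_powr)
      also have "(1 / (2 * K * C)) powr (1/\<gamma>) = (2 * K * C) powr (-1/\<gamma>)"
        using KC by (simp add: powr_divide powr_minus_divide)
      finally show ?thesis using \<open>q = 1\<close> by (simp add: explicit_bound_def K_def)
    qed
  next
    case False
    then have "1 < q" using q by simp
    define p where "p = enn2real (conj_exponent q)"
    have p: "conj_exponent q < \<infinity>" "1 \<le> p"
      using conj_exponent_less_infinity[OF \<open>1 < q\<close>] by (auto simp: p_def)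
    define d where "d = DIM('a)"
    define m where "m = d + \<gamma> * p"
    have d: "d > 0" and m: "m > 0"
      using \<gamma> p by (auto simp: d_def m_def intro!: add_pos_nonneg)
    define W where "W = (2 * pi powr (d / 2)) / (Gamma (d / 2) * m)"
    have W: "W > 0" using d m by (simp add: W_def)
    let ?J = "\<integral>\<^sup>+x\<in>ball 0 \<rho>. ennreal (\<bar>P x\<bar> powr p) \<partial>lebesgue"
    have "?J = ennreal (\<rho> powr m) * (\<integral>\<^sup>+x\<in>ball 0 1. ennreal (\<bar>P x\<bar> powr p) \<partial>lebesgue)"
      using homogeneous_nn_integral_ball[OF P hom \<rho>, of p] by (simp add: m_def d_def)
    also have "\<dots> \<le> ennreal (\<rho> powr m) * ennreal (K powr p * W)"
      using homogeneous_integral_unit_ball_le[OF P hom \<gamma> _ fin, of p] p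
      by (intro mult_left_mono) (auto simp: K_def W_def m_def d_def)
    finally have J: "?J \<le> ennreal (\<rho> powr m * (K powr p * W))"
      by (simp add: ennreal_mult')
    then have Jfin: "?J < \<infinity>"
      by (rule le_less_trans) simp
    have eq: "(\<integral>\<^sup>+x. ennreal (norm (P x) powr p) \<partial>lebesgue_on (ball 0 \<rho>)) = ?J"
      by (subst nn_integral_restrict_space) auto
    have "lp_norm (lebesgue_on (ball 0 \<rho>)) (conj_exponent q) P = ennreal (enn2real ?J powr (1/p))"
      using p Jfin eq by (subst lp_norm_finite_exponent) (auto simp: p_def)
    then have "1 \<le> 2 * C * enn2real ?J powr (1/p)"
      using one C by (simp add: ennreal_mult[symmetric])
    also have "\<dots> \<le> 2 * C * (\<rho> powr m * (K powr p * W)) powr (1/p)"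
      using C p enn2real_mono[OF J] W by (intro mult_left_mono powr_mono2) auto
    finally have "1 powr p \<le> (2 * C * (\<rho> powr m * (K powr p * W)) powr (1/p)) powr p"
      using p by (intro powr_mono2) auto
    also have "\<dots> = (2 * C) powr p * (\<rho> powr m * (K powr p * W))"
      using C p W K(2) by (simp add: powr_mult powr_powr)
    also have "\<dots> = (2 * K * C) powr p * W * \<rho> powr m"
      using C K by (simp add: powr_mult mult_ac)
    finally have le: "1 \<le> (2 * K * C) powr p * W * \<rho> powr m" by simp
    then have KC: "0 < (2 * K * C) powr p"
      by (cases "K = 0") (use C K in auto)
    have "1 / ((2 * K * C) powr p * W) \<le> \<rho> powr m"
      using le KC W by (simp add: field_simps)
    then have "(1 / ((2 * K * C) powr p * W)) powr (1/m) \<le> (\<rho> powr m) powr (1/m)"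
      using KC W m by (intro powr_mono2) auto
    also have "\<dots> = \<rho>" using \<rho> m by (simp add: powr_powr)
    also have "1 / ((2 * K * C) powr p * W) = m * Gamma (d / 2) / (2 * pi powr (d / 2) * (2 * K * C) powr p)"
      by (simp add: W_def mult_ac)
    finally show ?thesis
      using False by (simp add: explicit_bound_def Let_def m_def d_def p_def K_def)
  qed
qed

section \<open>Almost everywhere convergent sequences in decreasing convex sets\<close>

text \<open>Nearly minimal elements of the sets \<open>K n\<close> form a Cauchy sequence in \<open>L\<^sup>2\<close>: the midpoint of two of
them cannot have a norm much below the infimum, so by the parallelogram law their difference is
small. A rapidly convergent subsequence converges almost everywhere. For convex conditions this
takes the place of weak compactness.\<close>

lemma decreasing_convex_L2_AE_convergent:
  fixes K :: "nat \<Rightarrow> ('a \<Rightarrow> real) set"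
  assumes ne: "\<And>n. K n \<noteq> {}" and dec: "\<And>n. K (Suc n) \<subseteq> K n"
    and meas: "\<And>f. f \<in> K 0 \<Longrightarrow> f \<in> borel_measurable M"
    and sq: "\<And>f. f \<in> K 0 \<Longrightarrow> integrable M (\<lambda>x. (f x)\<^sup>2)"
    and bound: "\<And>f. f \<in> K 0 \<Longrightarrow> (\<integral>x. (f x)\<^sup>2 \<partial>M) \<le> B"
    and mid: "\<And>n f g. f \<in> K n \<Longrightarrow> g \<in> K n \<Longrightarrow> (\<lambda>x. (f x + g x) / 2) \<in> K n"
  shows "\<exists>g. (\<forall>n. g n \<in> K n) \<and> (AE x in M. convergent (\<lambda>n. g n x))"
proof -
  have mono: "K n \<subseteq> K m" if "m \<le> n" for m n
    using dec that by (rule lift_Suc_antimono_le)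
  have K0: "f \<in> K 0" if "f \<in> K n" for f n
    using mono[of 0 n] that by auto
  define \<alpha> where "\<alpha> n = (INF f\<in>K n. \<integral>x. (f x)\<^sup>2 \<partial>M)" for n
  have bdd: "bdd_below ((\<lambda>f. \<integral>x. (f x)\<^sup>2 \<partial>M) ` K n)" for n
    by (rule bdd_belowI2[where m=0]) simp
  have \<alpha>_le: "\<alpha> n \<le> (\<integral>x. (f x)\<^sup>2 \<partial>M)" if "f \<in> K n" for f n
    unfolding \<alpha>_def using bdd that by (rule cINF_lower)
  have "incseq \<alpha>"
    unfolding \<alpha>_def using ne bdd mono by (intro monoI cINF_superset_mono) auto
  moreover have "\<alpha> n \<le> B" for n
  proof -
    obtain f where "f \<in> K n" using ne[of n] by auto
    then show ?thesis using \<alpha>_le[of f n] bound[of f] K0 by force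
  qed
  ultimately obtain A where "\<alpha> \<longlonglongrightarrow> A"
    by (metis incseq_convergent)
  then have cauchy: "Cauchy \<alpha>" by (rule LIMSEQ_imp_Cauchy)
  have "\<exists>f\<in>K n. (\<integral>x. (f x)\<^sup>2 \<partial>M) < \<alpha> n + (1/2)^n" for n
    unfolding \<alpha>_def using cINF_less_iff[OF ne bdd, of n "\<alpha> n + (1/2)^n"]
    unfolding \<alpha>_def by simp
  then obtain h where h: "\<And>n. h n \<in> K n" "\<And>n. (\<integral>x. (h n x)\<^sup>2 \<partial>M) < \<alpha> n + (1/2)^n"
    by metis
  \<comment> \<open>The parallelogram law; the midpoint lies in the larger set \<open>K n\<close>.\<close>
  have dist: "(\<integral>x. (h m x - h n x)\<^sup>2 \<partial>M) \<le> 2 * (\<alpha> m - \<alpha> n) + 2 * (1/2)^m + 2 * (1/2)^n"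
    and dist_int: "integrable M (\<lambda>x. (h m x - h n x)\<^sup>2)" if "n \<le> m" for m n
  proof -
    have "h m \<in> K n" using h(1)[of m] mono[OF that] by auto
    then have midK: "(\<lambda>x. (h m x + h n x) / 2) \<in> K n" using h(1) by (intro mid) auto
    have i: "integrable M (\<lambda>x. (h m x)\<^sup>2)" "integrable M (\<lambda>x. (h n x)\<^sup>2)"
      "integrable M (\<lambda>x. ((h m x + h n x) / 2)\<^sup>2)"
      using sq[OF K0[OF h(1)]] sq[OF K0[OF midK]] by auto
    have eq: "(h m x - h n x)\<^sup>2 = 2 * (h m x)\<^sup>2 + 2 * (h n x)\<^sup>2 - 4 * ((h m x + h n x) / 2)\<^sup>2" for x
      by (simp add: power2_eq_square field_simps)
    show "integrable M (\<lambda>x. (h m x - h n x)\<^sup>2)"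
      unfolding eq using i by auto
    have "(\<integral>x. (h m x - h n x)\<^sup>2 \<partial>M)
        = 2 * (\<integral>x. (h m x)\<^sup>2 \<partial>M) + 2 * (\<integral>x. (h n x)\<^sup>2 \<partial>M) - 4 * (\<integral>x. ((h m x + h n x) / 2)\<^sup>2 \<partial>M)"
      unfolding eq using i by simp
    also have "\<dots> \<le> 2 * (\<alpha> m + (1/2)^m) + 2 * (\<alpha> n + (1/2)^n) - 4 * \<alpha> n"
    proof -
      have "2 * a + 2 * b - 4 * c \<le> 2 * (x + e) + 2 * (y + e') - 4 * y"
        if "a < x + e" "b < y + e'" "y \<le> c" for a b c x y e e' :: real
        using that by argo
      then show ?thesis using h(2) \<alpha>_le[OF midK] by blast
    qed
    finally show "(\<integral>x. (h m x - h n x)\<^sup>2 \<partial>M) \<le> 2 * (\<alpha> m - \<alpha> n) + 2 * (1/2)^m + 2 * (1/2)^n"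
      by simp
  qed
  have "\<exists>N. \<forall>n\<ge>N. \<forall>m\<ge>n. (\<integral>x. (h m x - h n x)\<^sup>2 \<partial>M) \<le> (1/4)^i" for i :: nat
  proof -
    have "(0::real) < (1/4)^i / 6" by simp
    from CauchyD[OF cauchy this] obtain N1 where
      N1: "\<And>m n. m \<ge> N1 \<Longrightarrow> n \<ge> N1 \<Longrightarrow> norm (\<alpha> m - \<alpha> n) < (1/4)^i / 6" by blast
    have "(\<lambda>n. (1/2::real)^n) \<longlonglongrightarrow> 0" by (rule LIMSEQ_power_zero) simp
    from order_tendstoD(2)[OF this \<open>(0::real) < (1/4)^i / 6\<close>] obtain N2 where
      N2: "\<And>n. n \<ge> N2 \<Longrightarrow> (1/2::real)^n < (1/4)^i / 6"
      by (auto simp: eventually_sequentially)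
    have "(\<integral>x. (h m x - h n x)\<^sup>2 \<partial>M) \<le> (1/4)^i" if "n \<ge> max N1 N2" "m \<ge> n" for m n
      using dist[OF that(2)] N1[of m n] N2[of m] N2[of n] that by (auto simp: abs_if split: if_splits)
    then show ?thesis by blast
  qed
  then obtain N where N: "\<And>i n m. N i \<le> n \<Longrightarrow> n \<le> m \<Longrightarrow> (\<integral>x. (h m x - h n x)\<^sup>2 \<partial>M) \<le> (1/4)^i"
    by metis
  \<comment> \<open>The sum makes \<open>k\<close> monotone; the summand \<open>i\<close> ensures that \<open>h (k i)\<close> still lies in \<open>K i\<close>.\<close>
  define k where "k i = i + (\<Sum>j\<le>i. N j)" for i
  have k: "i \<le> k i" "N i \<le> k i" "k i \<le> k (Suc i)" for i
    using member_le_sum[of i "{..i}" N] by (auto simp: k_def)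
  define g where "g i = h (k i)" for i
  have gK: "g i \<in> K i" for i
    using h(1)[of "k i"] mono[OF k(1)[of i]] by (auto simp: g_def)
  define \<Delta> where "\<Delta> i x = g (Suc i) x - g i x" for i x
  have g_meas[measurable]: "g i \<in> borel_measurable M" for i
    using gK K0 meas by blast
  have \<Delta>_meas[measurable]: "\<Delta> i \<in> borel_measurable M" for i
    unfolding \<Delta>_def by measurable
  \<comment> \<open>The increments have squared norm at most \<open>(1/4)^i\<close>, which leaves room for the weight \<open>2^i\<close>. Together
  with \<open>\<bar>\<Delta>\<bar> \<le> (1/2)^i + 2^i \<Delta>\<^sup>2\<close> this makes the increments absolutely summable at almost every point.\<close>
  have "(\<integral>\<^sup>+x. (\<Sum>i. ennreal (2^i * (\<Delta> i x)\<^sup>2)) \<partial>M) = (\<Sum>i. \<integral>\<^sup>+x. ennreal (2^i * (\<Delta> i x)\<^sup>2) \<partial>M)"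
    by (rule nn_integral_suminf) measurable
  also have "\<dots> \<le> (\<Sum>i. ennreal ((1/2)^i))"
  proof (intro suminf_le)
    fix i
    have int: "integrable M (\<lambda>x. (\<Delta> i x)\<^sup>2)"
      unfolding \<Delta>_def g_def by (rule dist_int[OF k(3)])
    have "(\<integral>\<^sup>+x. ennreal (2^i * (\<Delta> i x)\<^sup>2) \<partial>M) = ennreal (\<integral>x. 2^i * (\<Delta> i x)\<^sup>2 \<partial>M)"
      using int by (intro nn_integral_eq_integral) auto
    also have "(\<integral>x. 2^i * (\<Delta> i x)\<^sup>2 \<partial>M) = 2^i * (\<integral>x. (\<Delta> i x)\<^sup>2 \<partial>M)"
      by simp
    also have "\<dots> \<le> 2^i * (1/4)^i"
      unfolding \<Delta>_def g_def by (intro mult_left_mono N k) simp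
    also have "2^i * (1/4)^i = (1/2::real)^i"
      by (simp flip: power_mult_distrib)
    finally show "(\<integral>\<^sup>+x. ennreal (2^i * (\<Delta> i x)\<^sup>2) \<partial>M) \<le> ennreal ((1/2)^i)"
      by (simp add: ennreal_leI)
  qed auto
  also have "\<dots> = ennreal (\<Sum>i. (1/2)^i)"
    by (intro suminf_ennreal2 summable_geometric) auto
  also have "\<dots> < \<infinity>" by simp
  finally have "AE x in M. (\<Sum>i. ennreal (2^i * (\<Delta> i x)\<^sup>2)) \<noteq> \<infinity>"
    by (intro nn_integral_PInf_AE) auto
  then have "AE x in M. convergent (\<lambda>n. g n x)"
  proof eventually_elim
    case (elim x)
    then have s: "summable (\<lambda>i. 2^i * (\<Delta> i x)\<^sup>2)"
      by (intro summable_suminf_not_top) auto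
    have le: "norm (\<Delta> i x) \<le> (1/2)^i + 2^i * (\<Delta> i x)\<^sup>2" for i
    proof -
      have "0 \<le> 2^i * (\<bar>\<Delta> i x\<bar> - (1/2)^i)\<^sup>2" by simp
      also have "\<dots> = 2^i * (\<Delta> i x)\<^sup>2 - 2 * (2^i * (1/2)^i) * \<bar>\<Delta> i x\<bar> + (2^i * (1/2)^i) * (1/2)^i"
        by (simp add: power2_eq_square algebra_simps)
      also have "(2::real)^i * (1/2)^i = 1"
        by (simp flip: power_mult_distrib)
      finally have "2 * \<bar>\<Delta> i x\<bar> \<le> 2^i * (\<Delta> i x)\<^sup>2 + (1/2)^i" by simp
      then show ?thesis by simp
    qed
    have "summable (\<lambda>i. \<Delta> i x)"
      using le by (intro summable_comparison_test'[OF summable_add[OF summable_geometric s]]) auto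
    then have "convergent (\<lambda>n. \<Sum>i<n. \<Delta> i x)"
      by (simp add: summable_iff_convergent)
    moreover have "(\<Sum>i<n. \<Delta> i x) = g n x - g 0 x" for n
      unfolding \<Delta>_def by (rule sum_lessThan_telescope)
    ultimately have "convergent (\<lambda>n. g n x - g 0 x)" by simp
    then have "convergent (\<lambda>n. (g n x - g 0 x) + g 0 x)"
      by (intro convergent_add convergent_const)
    then show ?case by simp
  qed
  then show ?thesis using gK by blast
qed

section \<open>Gaussian smoothing and the Fourier transform\<close>

abbreviation fourier_kernel :: "'a::euclidean_space \<Rightarrow> 'a \<Rightarrow> complex" where
  "fourier_kernel \<xi> x \<equiv> exp (- (2 * complex_of_real pi * \<i> * complex_of_real (x \<bullet> \<xi>)))"

lemma norm_fourier_kernel [simp]: "norm (fourier_kernel \<xi> x) = 1"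
  by simp

lemma fourier_eq_lborel:
  fixes f :: "'a::euclidean_space \<Rightarrow> complex"
  assumes [measurable]: "f \<in> borel_measurable borel"
  shows "fourier f \<xi> = (\<integral>x. fourier_kernel \<xi> x * f x \<partial>lborel)"
  unfolding fourier_def by (rule integral_completion) measurable

lemma integrable_fourier_kernel:
  fixes f :: "'a::euclidean_space \<Rightarrow> complex"
  assumes "integrable lebesgue f"
  shows "integrable lebesgue (\<lambda>x. fourier_kernel \<xi> x * f x)"
proof (rule Bochner_Integration.integrable_bound[OF assms])
  have [measurable]: "f \<in> borel_measurable lebesgue" using assms by auto
  have [measurable]: "fourier_kernel \<xi> \<in> borel_measurable lebesgue"
    by (intro measurable_completion) measurable
  show "(\<lambda>x. fourier_kernel \<xi> x * f x) \<in> borel_measurable lebesgue"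
    by measurable
qed (auto simp: norm_mult)

lemma norm_fourier_le:
  fixes f :: "'a::euclidean_space \<Rightarrow> complex"
  shows "norm (fourier f \<xi>) \<le> (\<integral>x. norm (f x) \<partial>lebesgue)"
proof -
  have "norm (fourier f \<xi>) \<le> (\<integral>x. norm (fourier_kernel \<xi> x * f x) \<partial>lebesgue)"
    unfolding fourier_def by (rule integral_norm_bound)
  then show ?thesis by (simp only: norm_mult norm_fourier_kernel mult_1)
qed

lemma continuous_on_fourier:
  fixes f :: "'a::euclidean_space \<Rightarrow> complex"
  assumes "integrable lebesgue f"
  shows "continuous_on UNIV (fourier f)"
  unfolding continuous_on_sequentially
proof (intro allI ballI impI, elim conjE)
  fix \<xi> :: "nat \<Rightarrow> 'a" and a assume "\<xi> \<longlonglongrightarrow> a"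
  then show "(fourier f \<circ> \<xi>) \<longlonglongrightarrow> fourier f a"
    unfolding fourier_def comp_def
    using assms integrable_fourier_kernel[OF assms, THEN borel_measurable_integrable]
    by (intro integral_dominated_convergence[where w = "\<lambda>x. norm (f x)"])
       (auto simp: norm_mult intro!: tendsto_intros)
qed

lemma fourier_cong_AE:
  fixes f g :: "'a::euclidean_space \<Rightarrow> complex"
  assumes "AE x in lebesgue. f x = g x" "f \<in> borel_measurable lebesgue" "g \<in> borel_measurable lebesgue"
  shows "fourier f = fourier g"
proof
  fix \<xi> :: 'a
  have [measurable]: "fourier_kernel \<xi> \<in> borel_measurable lebesgue"
    by (intro measurable_completion) measurable
  show "fourier f \<xi> = fourier g \<xi>"
    unfolding fourier_def using assms by (intro integral_cong_AE) (auto elim: eventually_mono)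
qed

text \<open>The standard normal density, written as a product so that its integral and its characteristic
function reduce to one dimension.\<close>

definition gauss_density :: "'a::euclidean_space \<Rightarrow> real" where
  "gauss_density x = (\<Prod>b\<in>Basis. std_normal_density (x \<bullet> b))"

abbreviation gauss :: "'a::euclidean_space measure" where
  "gauss \<equiv> density lborel (\<lambda>x. ennreal (gauss_density x))"

lemma gauss_density_nonneg: "0 \<le> gauss_density x"
  unfolding gauss_density_def by (intro prod_nonneg) auto

lemma gauss_density_measurable [measurable]: "gauss_density \<in> borel_measurable borel"
  unfolding gauss_density_def by measurable

lemma prob_space_gauss: "prob_space (gauss :: 'a::euclidean_space measure)"
proof
  have "(\<integral>\<^sup>+x. ennreal (gauss_density x) \<partial>(lborel :: 'a measure))
      = (\<integral>\<^sup>+x. (\<Prod>b\<in>Basis. ennreal (std_normal_density (x \<bullet> b))) \<partial>(lborel :: 'a measure))"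
    by (simp add: gauss_density_def prod_ennreal)
  also have "\<dots> = (\<Prod>b\<in>(Basis::'a set). (\<integral>\<^sup>+x. ennreal (std_normal_density x) \<partial>lborel))"
    by (rule nn_integral_lborel_prod) auto
  also have "(\<integral>\<^sup>+x. ennreal (std_normal_density x) \<partial>lborel) = 1"
    using prob_space.emeasure_space_1[OF prob_space_normal_density[of 1 0]]
    by (simp add: emeasure_density)
  finally show "emeasure (gauss :: 'a measure) (space gauss) = 1"
    by (simp add: emeasure_density)
qed

lemma integrable_gauss_density: "integrable lborel (gauss_density :: 'a::euclidean_space \<Rightarrow> real)"
  and integral_gauss_density: "(\<integral>x. gauss_density x \<partial>(lborel :: 'a measure)) = 1"
proof -
  interpret prob_space "gauss :: 'a measure" by (rule prob_space_gauss)
  have "integrable (gauss :: 'a measure) (\<lambda>_. 1::real)" by simp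
  then show "integrable lborel (gauss_density :: 'a \<Rightarrow> real)"
    by (subst (asm) integrable_real_density) (auto simp: gauss_density_nonneg)
  have "(\<integral>x. 1 \<partial>(gauss :: 'a measure)) = (1::real)"
    using prob_space by simp
  then show "(\<integral>x. gauss_density x \<partial>(lborel :: 'a measure)) = 1"
    by (subst (asm) integral_density) (auto simp: gauss_density_nonneg)
qed

lemma norm_square_eq_sum_Basis: "(norm x)\<^sup>2 = (\<Sum>b\<in>Basis. (x \<bullet> b)\<^sup>2)" for x :: "'a::euclidean_space"
  by (subst power2_norm_eq_inner, subst euclidean_inner) (simp add: power2_eq_square)

lemma gauss_density_eq:
  fixes x :: "'a::euclidean_space"
  shows "gauss_density x = (1 / sqrt (2 * pi)) ^ DIM('a) * exp (- (norm x)\<^sup>2 / 2)"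
  by (simp add: gauss_density_def std_normal_density_def prod.distrib exp_sum[symmetric]
        norm_square_eq_sum_Basis sum_negf sum_divide_distrib power_one_over prod_dividef)

lemma integrable_exp_norm_square:
  "integrable lborel (\<lambda>x::'a::euclidean_space. exp (- (norm x)\<^sup>2 / 2))"
proof -
  have "integrable lborel (\<lambda>x::'a. (sqrt (2 * pi)) ^ DIM('a) * gauss_density x)"
    by (intro integrable_mult_right integrable_gauss_density)
  then show ?thesis
    by (simp add: gauss_density_eq flip: power_mult_distrib)
qed

lemma char_gauss:
  fixes t :: "'a::euclidean_space"
  shows "(\<integral>x. iexp (t \<bullet> x) \<partial>gauss) = exp (- (norm t)\<^sup>2 / 2)"
proof -
  interpret product_sigma_finite "\<lambda>_::'a. lborel :: real measure" by standard
  let ?F = "\<lambda>b y. complex_of_real (std_normal_density y) * iexp ((t \<bullet> b) * y)"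
  have int: "integrable lborel (?F b)" for b :: 'a
    by (rule Bochner_Integration.integrable_bound[OF integrable_normal_density[of 1 0]])
       (auto simp: norm_mult)
  have one: "(\<integral>y. ?F b y \<partial>lborel) = exp (- ((t \<bullet> b)\<^sup>2) / 2)" for b
  proof -
    have "(\<integral>y. ?F b y \<partial>lborel) = (\<integral>y. iexp ((t \<bullet> b) * y) \<partial>std_normal_distribution)"
      by (subst integral_density) (auto simp: scaleR_conv_of_real)
    also have "\<dots> = char std_normal_distribution (t \<bullet> b)"
      by (simp add: char_def)
    finally show ?thesis by (simp add: char_std_normal_distribution)
  qed
  have "(\<integral>x. iexp (t \<bullet> x) \<partial>gauss) = (\<integral>x. complex_of_real (gauss_density x) * iexp (t \<bullet> x) \<partial>lborel)"
    by (subst integral_density) (auto simp: gauss_density_nonneg scaleR_conv_of_real)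
  also have "\<dots> = (\<integral>x. (\<Prod>b\<in>Basis. ?F b (x \<bullet> b)) \<partial>lborel)"
  proof (intro Bochner_Integration.integral_cong refl)
    fix x :: 'a
    have "iexp (t \<bullet> x) = (\<Prod>b\<in>Basis. iexp ((t \<bullet> b) * (x \<bullet> b)))"
      by (subst euclidean_inner) (simp add: exp_sum[symmetric] sum_distrib_left)
    then show "complex_of_real (gauss_density x) * iexp (t \<bullet> x) = (\<Prod>b\<in>Basis. ?F b (x \<bullet> b))"
      by (simp add: gauss_density_def prod.distrib)
  qed
  also have "\<dots> = (\<integral>f. (\<Prod>b\<in>Basis. ?F b ((\<Sum>b\<in>Basis. f b *\<^sub>R b) \<bullet> b)) \<partial>(\<Pi>\<^sub>M b\<in>(Basis::'a set). lborel))"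
    by (subst lborel_eq, subst integral_distr) auto
  also have "\<dots> = (\<integral>f. (\<Prod>b\<in>Basis. ?F b (f b)) \<partial>(\<Pi>\<^sub>M b\<in>(Basis::'a set). lborel))"
    by (intro Bochner_Integration.integral_cong refl prod.cong) (simp add: inner_sum_left_Basis)
  also have "\<dots> = (\<Prod>b\<in>(Basis::'a set). \<integral>y. ?F b y \<partial>lborel)"
    using int by (intro product_integral_prod) auto
  also have "\<dots> = exp (- (norm t)\<^sup>2 / 2)"
    unfolding one
    by (simp add: exp_sum[symmetric] norm_square_eq_sum_Basis sum_negf sum_divide_distrib flip: of_real_prod)
  finally show ?thesis .
qed

text \<open>Fubini's theorem, by the symmetry of the kernel.\<close>

lemma fourier_multiplication_formula:
  fixes f g :: "'a::euclidean_space \<Rightarrow> complex"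
  assumes f: "integrable lborel f" and g: "integrable lborel g"
  shows "(\<integral>\<xi>. fourier f \<xi> * g \<xi> \<partial>lborel) = (\<integral>x. f x * fourier g x \<partial>lborel)"
proof -
  have [measurable]: "f \<in> borel_measurable borel" "g \<in> borel_measurable borel"
    using f g by auto
  let ?h = "\<lambda>(x, \<xi>). fourier_kernel \<xi> x * f x * g \<xi>"
  have "integrable (lborel \<Otimes>\<^sub>M lborel) ?h"
  proof (rule lborel_pair.Fubini_integrable)
    show "?h \<in> borel_measurable (lborel \<Otimes>\<^sub>M lborel)"
      by measurable
    have "(\<integral>\<xi>. norm (?h (x, \<xi>)) \<partial>lborel) = norm (f x) * (\<integral>\<xi>. norm (g \<xi>) \<partial>lborel)" for x
      by (simp add: norm_mult del: norm_exp_eq_Re)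
    then show "integrable lborel (\<lambda>x. \<integral>\<xi>. norm (?h (x, \<xi>)) \<partial>lborel)"
      using f by simp
    have "integrable lborel (\<lambda>\<xi>. ?h (x, \<xi>))" for x
    proof (rule Bochner_Integration.integrable_bound)
      show "integrable lborel (\<lambda>\<xi>. norm (f x) * norm (g \<xi>))"
        using g by auto
    qed (auto simp: norm_mult)
    then show "AE x in lborel. integrable lborel (\<lambda>\<xi>. ?h (x, \<xi>))" by simp
  qed
  then have "(\<integral>\<xi>. \<integral>x. fourier_kernel \<xi> x * f x * g \<xi> \<partial>lborel \<partial>lborel)
      = (\<integral>x. \<integral>\<xi>. fourier_kernel \<xi> x * f x * g \<xi> \<partial>lborel \<partial>lborel)"
    by (intro lborel_pair.Fubini_integral) simp
  moreover have "(\<integral>x. fourier_kernel \<xi> x * f x * g \<xi> \<partial>lborel) = fourier f \<xi> * g \<xi>" for \<xi>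
    by (simp add: fourier_eq_lborel)
  moreover have "(\<integral>\<xi>. fourier_kernel \<xi> x * f x * g \<xi> \<partial>lborel) = f x * fourier g x" for x
  proof -
    have "(\<integral>\<xi>. fourier_kernel \<xi> x * f x * g \<xi> \<partial>lborel) = (\<integral>\<xi>. f x * (fourier_kernel x \<xi> * g \<xi>) \<partial>lborel)"
      by (simp add: inner_commute mult_ac)
    then show ?thesis by (simp add: fourier_eq_lborel)
  qed
  ultimately show ?thesis by (simp only:)
qed

lemma integrable_exp_norm_square_scale:
  assumes "0 < \<delta>"
  shows "integrable lborel (\<lambda>x::'a::euclidean_space. exp (- (norm (\<delta> *\<^sub>R x))\<^sup>2 / 2))"
proof -
  let ?e = "\<lambda>x::'a. exp (- (norm x)\<^sup>2 / 2)"
  have "(\<integral>\<^sup>+x. ennreal (?e x) \<partial>lborel) < \<infinity>"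
    using integrable_exp_norm_square[where 'a='a] by (auto simp: integrable_iff_bounded)
  moreover have "(\<integral>\<^sup>+x. ennreal (?e x) \<partial>lborel)
      = ennreal (\<delta> ^ DIM('a)) * (\<integral>\<^sup>+x. ennreal (?e (\<delta> *\<^sub>R x)) \<partial>lborel)"
  proof -
    have "(\<lambda>x::'a. ennreal (?e x)) \<in> borel_measurable lebesgue"
      by (intro measurable_completion) measurable
    from nn_integral_lebesgue_scaleR[OF this assms] show ?thesis
      by (simp add: nn_integral_completion)
  qed
  moreover have "ennreal (\<delta> ^ DIM('a)) \<noteq> 0" using assms by (simp add: ennreal_eq_0_iff not_le)
  ultimately have "(\<integral>\<^sup>+x. ennreal (?e (\<delta> *\<^sub>R x)) \<partial>lborel) < \<infinity>"
    by (auto simp: ennreal_mult_less_top)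
  then show ?thesis
    by (intro integrableI_bounded) auto
qed

lemma lborel_translate:
  fixes f :: "'a::euclidean_space \<Rightarrow> 'b::{banach, second_countable_topology}"
  assumes "integrable lborel f"
  shows "integrable lborel (\<lambda>x. f (x + a))" "(\<integral>x. f (x + a) \<partial>lborel) = (\<integral>x. f x \<partial>lborel)"
proof -
  have d: "lborel = distr lborel borel (\<lambda>x::'a. x + a)"
    using lborel_affine[of 1 a] by (simp add: density_1 add.commute)
  have f: "f \<in> borel_measurable borel" using assms by auto
  show "integrable lborel (\<lambda>x. f (x + a))"
    using assms by (subst (asm) d, subst (asm) integrable_distr_eq) (use f in auto)
  show "(\<integral>x. f (x + a) \<partial>lborel) = (\<integral>x. f x \<partial>lborel)"
    by (subst (2) d, subst integral_distr) (use f in auto)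
qed

text \<open>The convolution of \<open>\<psi>\<close> with the law of \<open>\<epsilon> Z\<close> for a standard normal vector \<open>Z\<close>.\<close>

definition gauss_smooth :: "real \<Rightarrow> ('a::euclidean_space \<Rightarrow> complex) \<Rightarrow> 'a \<Rightarrow> complex" where
  "gauss_smooth \<epsilon> \<psi> x = (\<integral>z. complex_of_real (gauss_density z) * \<psi> (x - \<epsilon> *\<^sub>R z) \<partial>lborel)"

lemma norm_gauss_smooth_le:
  fixes \<psi> :: "'a::euclidean_space \<Rightarrow> complex"
  assumes [measurable]: "\<psi> \<in> borel_measurable borel" and bound: "\<And>x. norm (\<psi> x) \<le> M"
  shows "norm (gauss_smooth \<epsilon> \<psi> x) \<le> M"
proof -
  have i: "integrable lborel (\<lambda>z::'a. gauss_density z * M)"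
    using integrable_gauss_density[where 'a='a] by simp
  have le: "norm (complex_of_real (gauss_density z) * \<psi> (x - \<epsilon> *\<^sub>R z)) \<le> gauss_density z * M" for z
    using bound gauss_density_nonneg[of z] by (simp add: norm_mult mult_left_mono)
  have "integrable lborel (\<lambda>z. complex_of_real (gauss_density z) * \<psi> (x - \<epsilon> *\<^sub>R z))"
    using le by (intro Bochner_Integration.integrable_bound[OF i]) (auto intro: order_trans[OF le abs_ge_self])
  then have "(\<integral>z. norm (complex_of_real (gauss_density z) * \<psi> (x - \<epsilon> *\<^sub>R z)) \<partial>lborel)
      \<le> (\<integral>z. gauss_density z * M \<partial>(lborel :: 'a measure))"
    using le by (intro integral_mono integrable_norm i)
  then have "norm (gauss_smooth \<epsilon> \<psi> x) \<le> (\<integral>z. gauss_density z * M \<partial>(lborel :: 'a measure))"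
    unfolding gauss_smooth_def by (rule order_trans[OF integral_norm_bound])
  then show ?thesis by (simp add: integral_gauss_density)
qed

lemma gauss_smooth_tendsto:
  fixes \<psi> :: "'a::euclidean_space \<Rightarrow> complex"
  assumes cont: "continuous_on UNIV \<psi>" and bound: "\<And>x. norm (\<psi> x) \<le> M" and \<epsilon>: "\<epsilon> \<longlonglongrightarrow> 0"
  shows "(\<lambda>k. gauss_smooth (\<epsilon> k) \<psi> x) \<longlonglongrightarrow> \<psi> x"
proof -
  have [measurable]: "\<psi> \<in> borel_measurable borel"
    using cont by (rule borel_measurable_continuous_onI)
  have "(\<lambda>k. gauss_smooth (\<epsilon> k) \<psi> x) \<longlonglongrightarrow> (\<integral>z. complex_of_real (gauss_density z) * \<psi> x \<partial>(lborel :: 'a measure))"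
    unfolding gauss_smooth_def
  proof (rule integral_dominated_convergence[where w = "\<lambda>z. gauss_density z * M"])
    have "(\<lambda>k. \<psi> (x - \<epsilon> k *\<^sub>R z)) \<longlonglongrightarrow> \<psi> x" for z
    proof -
      have "(\<lambda>k. x - \<epsilon> k *\<^sub>R z) \<longlonglongrightarrow> x - 0 *\<^sub>R z"
        by (intro tendsto_intros \<epsilon>)
      then show ?thesis
        using cont by (intro continuous_on_tendsto_compose[OF cont]) auto
    qed
    then show "AE z in lborel. (\<lambda>k. complex_of_real (gauss_density z) * \<psi> (x - \<epsilon> k *\<^sub>R z))
        \<longlonglongrightarrow> complex_of_real (gauss_density z) * \<psi> x"
      by (intro always_eventually allI tendsto_intros)
    show "integrable lborel (\<lambda>z::'a. gauss_density z * M)"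
      using integrable_gauss_density[where 'a='a] by simp
    show "AE z in lborel. norm (complex_of_real (gauss_density z) * \<psi> (x - \<epsilon> k *\<^sub>R z)) \<le> gauss_density z * M" for k
      using bound by (auto simp: norm_mult gauss_density_nonneg intro!: mult_left_mono)
  qed auto
  also have "(\<integral>z. complex_of_real (gauss_density z) * \<psi> x \<partial>(lborel :: 'a measure)) = \<psi> x"
    by (simp add: integral_gauss_density)
  finally show ?thesis .
qed

lemma
  fixes \<psi> :: "'a::euclidean_space \<Rightarrow> complex"
  assumes \<psi>: "integrable lborel \<psi>"
  shows integrable_gauss_smooth: "integrable lborel (gauss_smooth \<epsilon> \<psi>)"
    and fourier_gauss_smooth: "fourier (gauss_smooth \<epsilon> \<psi>) \<xi>
      = exp (- (norm ((2 * pi * \<epsilon>) *\<^sub>R \<xi>))\<^sup>2 / 2) * fourier \<psi> \<xi>"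
proof -
  have [measurable]: "\<psi> \<in> borel_measurable borel" using \<psi> by auto
  define h where "h \<xi> z x = complex_of_real (gauss_density z) * (fourier_kernel \<xi> x * \<psi> (x - \<epsilon> *\<^sub>R z))"
    for \<xi> z x :: 'a
  have [measurable]: "case_prod (h \<xi>) \<in> borel_measurable (lborel \<Otimes>\<^sub>M lborel)" for \<xi>
    unfolding h_def by measurable
  have shift: "integrable lborel (\<lambda>x. norm (\<psi> (x - \<epsilon> *\<^sub>R z)))"
    "(\<integral>x. norm (\<psi> (x - \<epsilon> *\<^sub>R z)) \<partial>lborel) = (\<integral>x. norm (\<psi> x) \<partial>lborel)" for z
    using lborel_translate[OF integrable_norm[OF \<psi>], of "- (\<epsilon> *\<^sub>R z)"] by auto
  have normh: "norm (h \<xi> z x) = gauss_density z * norm (\<psi> (x - \<epsilon> *\<^sub>R z))" for \<xi> z x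
    by (simp add: h_def norm_mult gauss_density_nonneg)
  have int: "integrable (lborel \<Otimes>\<^sub>M lborel) (case_prod (h \<xi>))" for \<xi>
  proof (rule lborel_pair.Fubini_integrable)
    show "integrable lborel (\<lambda>z. \<integral>x. norm (case_prod (h \<xi>) (z, x)) \<partial>lborel)"
      using integrable_gauss_density[where 'a='a] by (simp add: normh shift)
    have "integrable lborel (\<lambda>x. h \<xi> z x)" for z
      by (rule Bochner_Integration.integrable_bound[OF integrable_mult_right[OF shift(1)[of z], of "gauss_density z"]])
         (simp_all add: h_def norm_mult gauss_density_nonneg)
    then show "AE z in lborel. integrable lborel (\<lambda>x. case_prod (h \<xi>) (z, x))" by simp
  qed measurable
  have snd: "(\<integral>z. h \<xi> z x \<partial>lborel) = fourier_kernel \<xi> x * gauss_smooth \<epsilon> \<psi> x" for \<xi> x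
  proof -
    have "(\<integral>z. h \<xi> z x \<partial>lborel)
        = (\<integral>z. fourier_kernel \<xi> x * (complex_of_real (gauss_density z) * \<psi> (x - \<epsilon> *\<^sub>R z)) \<partial>lborel)"
      unfolding h_def by (rule arg_cong[where f = "integral\<^sup>L lborel"]) (simp add: fun_eq_iff)
    also have "\<dots> = fourier_kernel \<xi> x * gauss_smooth \<epsilon> \<psi> x"
      unfolding gauss_smooth_def by (rule integral_mult_right_zero)
    finally show ?thesis .
  qed
  show intg: "integrable lborel (gauss_smooth \<epsilon> \<psi>)"
    using lborel_pair.integrable_snd[OF int[of 0]] by (simp add: snd)
  then have meas: "gauss_smooth \<epsilon> \<psi> \<in> borel_measurable borel" by auto
  have "fourier (gauss_smooth \<epsilon> \<psi>) \<xi> = (\<integral>x. \<integral>z. h \<xi> z x \<partial>lborel \<partial>lborel)"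
    by (simp add: fourier_eq_lborel[OF meas] snd)
  also have "\<dots> = (\<integral>z. \<integral>x. h \<xi> z x \<partial>lborel \<partial>lborel)"
    by (rule lborel_pair.Fubini_integral[OF int])
  also have "\<dots> = (\<integral>z. complex_of_real (gauss_density z) * (iexp ((- (2 * pi * \<epsilon>) *\<^sub>R \<xi>) \<bullet> z) * fourier \<psi> \<xi>) \<partial>lborel)"
  proof (intro Bochner_Integration.integral_cong refl)
    fix z :: 'a
    have i: "integrable lborel (\<lambda>x. fourier_kernel \<xi> x * \<psi> (x - \<epsilon> *\<^sub>R z))"
      by (rule Bochner_Integration.integrable_bound[OF shift(1)[of z]]) (auto simp: norm_mult)
    have "(\<integral>x. fourier_kernel \<xi> x * \<psi> (x - \<epsilon> *\<^sub>R z) \<partial>lborel)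
        = (\<integral>x. fourier_kernel \<xi> (x + \<epsilon> *\<^sub>R z) * \<psi> x \<partial>lborel)"
      using lborel_translate(2)[OF i, of "\<epsilon> *\<^sub>R z"] by simp
    also have "\<dots> = (\<integral>x. iexp ((- (2 * pi * \<epsilon>) *\<^sub>R \<xi>) \<bullet> z) * (fourier_kernel \<xi> x * \<psi> x) \<partial>lborel)"
      by (intro Bochner_Integration.integral_cong refl)
         (simp add: inner_add_left inner_commute[of z] distrib_left mult_ac flip: exp_add)
    also have "\<dots> = iexp ((- (2 * pi * \<epsilon>) *\<^sub>R \<xi>) \<bullet> z) * fourier \<psi> \<xi>"
      by (subst fourier_eq_lborel) auto
    finally show "(\<integral>x. h \<xi> z x \<partial>lborel)
        = complex_of_real (gauss_density z) * (iexp ((- (2 * pi * \<epsilon>) *\<^sub>R \<xi>) \<bullet> z) * fourier \<psi> \<xi>)"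
      by (simp add: h_def)
  qed
  also have "\<dots> = (\<integral>z. complex_of_real (gauss_density z) * iexp ((- (2 * pi * \<epsilon>) *\<^sub>R \<xi>) \<bullet> z) \<partial>lborel) * fourier \<psi> \<xi>"
    by (simp only: mult.assoc[symmetric] integral_mult_left_zero)
  also have "(\<integral>z. complex_of_real (gauss_density z) * iexp ((- (2 * pi * \<epsilon>) *\<^sub>R \<xi>) \<bullet> z) \<partial>lborel)
      = (\<integral>z. iexp ((- (2 * pi * \<epsilon>) *\<^sub>R \<xi>) \<bullet> z) \<partial>gauss)"
    by (subst integral_density) (auto simp: gauss_density_nonneg scaleR_conv_of_real)
  also have "\<dots> = exp (- (norm ((2 * pi * \<epsilon>) *\<^sub>R \<xi>))\<^sup>2 / 2)"
    by (subst char_gauss) simp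
  finally show "fourier (gauss_smooth \<epsilon> \<psi>) \<xi> = exp (- (norm ((2 * pi * \<epsilon>) *\<^sub>R \<xi>))\<^sup>2 / 2) * fourier \<psi> \<xi>" .
qed

section \<open>Fourier eigenfunctions under almost everywhere limits\<close>

lemma integrable_mult_bounded:
  fixes f g :: "'a::euclidean_space \<Rightarrow> complex"
  assumes f: "integrable lborel f" and g: "g \<in> borel_measurable borel" "\<And>x. norm (g x) \<le> B"
  shows "integrable lborel (\<lambda>x. g x * f x)" "integrable lborel (\<lambda>x. f x * g x)"
proof -
  have [measurable]: "f \<in> borel_measurable borel" using f by auto
  note [measurable] = g(1)
  have "norm (g x * f x) \<le> norm (B * norm (f x))" for x
  proof -
    have "norm (g x) * norm (f x) \<le> B * norm (f x)"
      using g(2) by (intro mult_right_mono) auto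
    then show ?thesis
      unfolding norm_mult real_norm_def by (rule order_trans[OF _ abs_ge_self])
  qed
  moreover have "integrable lborel (\<lambda>x. B * norm (f x))"
    using f by simp
  ultimately show 1: "integrable lborel (\<lambda>x. g x * f x)"
    by (intro Bochner_Integration.integrable_bound[where g = "\<lambda>x. g x * f x" and f = "\<lambda>x. B * norm (f x)"]
          always_eventually allI) measurable
  then show "integrable lborel (\<lambda>x. f x * g x)" by (simp add: mult.commute)
qed

text \<open>The bounded function \<open>cnj h / (1 + \<bar>h\<bar>)\<close> is an almost everywhere limit of continuous functions, which
can be truncated to modulus at most \<open>1\<close> and multiplied by the weight \<open>w\<close> to become test functions.
In the limit the integral of the nonnegative function \<open>w \<bar>h\<bar>\<^sup>2 / (1 + \<bar>h\<bar>)\<close> vanishes.\<close>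

lemma AE_zero_if_orthogonal_to_continuous:
  fixes h :: "'a::euclidean_space \<Rightarrow> complex"
  assumes [measurable]: "h \<in> borel_measurable borel"
    and w: "continuous_on UNIV w" "\<And>x. 0 < w x" "\<And>x. w x \<le> M" "integrable lborel w"
    and wh: "integrable lborel (\<lambda>x. complex_of_real (w x) * h x)"
    and orth: "\<And>\<psi>. continuous_on UNIV \<psi> \<Longrightarrow> (\<And>x. norm (\<psi> x) \<le> M) \<Longrightarrow> integrable lborel \<psi>
        \<Longrightarrow> (\<integral>x. \<psi> x * h x \<partial>lborel) = 0"
  shows "AE x in lborel. h x = 0"
proof -
  define u where "u x = cnj (h x) / complex_of_real (1 + norm (h x))" for x
  have u_le: "norm (u x) \<le> 1" for x
  proof -
    have "0 < 1 + norm (h x)" using norm_ge_zero[of "h x"] by linarith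
    then have "norm (complex_of_real (1 + norm (h x))) = 1 + norm (h x)"
      by (simp only: norm_of_real)
    then show ?thesis
      using \<open>0 < 1 + norm (h x)\<close> by (simp add: u_def norm_divide divide_le_eq del: of_real_add)
  qed
  have "continuous_on UNIV (\<lambda>z. cnj z / complex_of_real (1 + norm z))"
    using norm_ge_zero by (intro continuous_intros) (auto simp: complex_eq_iff add_nonneg_eq_0_iff)
  then have "(\<lambda>z. cnj z / complex_of_real (1 + norm z)) \<in> borel_measurable borel"
    by (rule borel_measurable_continuous_onI)
  from measurable_compose[OF assms(1) this] have u_meas[measurable]: "u \<in> borel_measurable borel"
    unfolding u_def[abs_def] .
  have "u measurable_on UNIV"
    by (intro lebesgue_measurable_imp_measurable_on measurable_completion) auto
  then obtain N g where N: "negligible N" and g: "\<And>n. continuous_on UNIV (g n)"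
    and lim: "\<And>x. x \<notin> N \<Longrightarrow> (\<lambda>n. g n x) \<longlonglongrightarrow> u x"
    unfolding measurable_on_def by auto
  define v where "v n x = g n x / complex_of_real (max 1 (norm (g n x)))" for n x
  have v_le: "norm (v n x) \<le> 1" for n x
    by (simp add: v_def norm_divide)
  have v_cont: "continuous_on UNIV (v n)" for n
    unfolding v_def using g by (intro continuous_intros) (auto simp: max_def)
  have v_meas[measurable]: "v n \<in> borel_measurable borel" for n
    using v_cont by (rule borel_measurable_continuous_onI)
  have v_lim: "(\<lambda>n. v n x) \<longlonglongrightarrow> u x" if "x \<notin> N" for x
  proof -
    have "(\<lambda>n. v n x) \<longlonglongrightarrow> u x / complex_of_real (max 1 (norm (u x)))"
      unfolding v_def by (intro tendsto_intros lim that) (auto simp: max_def)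
    then show ?thesis using u_le[of x] by (simp add: max_def split: if_splits)
  qed
  have wmeas[measurable]: "w \<in> borel_measurable borel"
    using w(1) by (rule borel_measurable_continuous_onI)
  have "(\<integral>x. (v n x * complex_of_real (w x)) * h x \<partial>lborel) = 0" for n
  proof (rule orth)
    show "continuous_on UNIV (\<lambda>x. v n x * complex_of_real (w x))"
      by (intro continuous_intros v_cont w)
    have le: "norm (v n x * complex_of_real (w x)) \<le> w x" for x
      using v_le[of n x] w(2)[of x] by (simp add: norm_mult mult_left_le_one_le)
    then show "norm (v n x * complex_of_real (w x)) \<le> M" for x
      using w(3)[of x] by (meson order_trans)
    show "integrable lborel (\<lambda>x. v n x * complex_of_real (w x))"
      using le by (intro Bochner_Integration.integrable_bound[OF w(4)]) (auto intro: order_trans[OF le abs_ge_self])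
  qed
  moreover have "(\<lambda>n. \<integral>x. (v n x * complex_of_real (w x)) * h x \<partial>lborel)
      \<longlonglongrightarrow> (\<integral>x. (u x * complex_of_real (w x)) * h x \<partial>lborel)"
  proof (rule integral_dominated_convergence[where w = "\<lambda>x. norm (complex_of_real (w x) * h x)"])
    show "integrable lborel (\<lambda>x. norm (complex_of_real (w x) * h x))"
      using wh by (rule integrable_norm)
    have "AE x in lebesgue. x \<notin> N"
      using N by (simp add: negligible_iff_null_sets AE_not_in)
    then have "AE x in lborel. x \<notin> N" by (simp add: AE_completion_iff)
    then show "AE x in lborel. (\<lambda>n. v n x * complex_of_real (w x) * h x) \<longlonglongrightarrow> u x * complex_of_real (w x) * h x"
      by eventually_elim (intro tendsto_intros v_lim)
    have "norm (v n x * complex_of_real (w x) * h x) \<le> norm (complex_of_real (w x) * h x)" for n x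
      using v_le[of n x] by (simp add: norm_mult mult.assoc mult_left_le_one_le)
    then show "AE x in lborel. norm (v n x * complex_of_real (w x) * h x) \<le> norm (complex_of_real (w x) * h x)" for n
      by simp
  qed measurable
  ultimately have zero: "(\<integral>x. (u x * complex_of_real (w x)) * h x \<partial>lborel) = 0"
    using LIMSEQ_unique[OF _ tendsto_const] by fastforce
  define k where "k x = w x * (norm (h x))\<^sup>2 / (1 + norm (h x))" for x
  have eq: "(u x * complex_of_real (w x)) * h x = complex_of_real (k x)" for x
    unfolding k_def of_real_mult of_real_divide complex_norm_square u_def by (simp add: mult_ac)
  have k_nonneg: "0 \<le> k x" for x using w(2)[of x] by (simp add: k_def less_imp_le)
  have k_meas: "k \<in> borel_measurable lborel"
    unfolding k_def by measurable
  have k_le: "norm (k x) \<le> norm (complex_of_real (w x) * h x)" for x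
  proof -
    have "norm (complex_of_real (k x)) \<le> norm (complex_of_real (w x) * h x)"
      unfolding eq[symmetric] using u_le[of x] by (simp add: norm_mult mult.assoc mult_left_le_one_le)
    then show ?thesis by (simp only: norm_of_real real_norm_def)
  qed
  have "integrable lborel k"
    by (rule Bochner_Integration.integrable_bound[OF wh k_meas]) (intro always_eventually allI k_le)
  moreover have "(\<integral>x. k x \<partial>lborel) = 0"
    using zero unfolding eq by simp
  ultimately have "AE x in lborel. k x = 0"
    using k_nonneg by (subst (asm) integral_nonneg_eq_0_iff_AE) auto
  then show ?thesis
  proof eventually_elim
    case (elim x)
    moreover have "w x \<noteq> 0" using w(2)[of x] by simp
    moreover have "1 + norm (h x) \<noteq> 0" using norm_ge_zero[of "h x"] by linarith
    ultimately show "h x = 0" by (simp add: k_def)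
  qed
qed

text \<open>Mass of \<open>g n\<close> may escape to infinity, so \<open>fourier (g n)\<close> need not converge to \<open>fourier f\<close>
pointwise. The equation is therefore passed to the limit weakly. Tested against a Gaussian smoothing of \<open>\<psi>\<close>, both
sides of the multiplication formula have an integrable majorant, because the smoothing is integrable
and its transform has Gaussian decay. Removing the smoothing only involves the integrable function \<open>f\<close>.\<close>

lemma fourier_eq_limit:
  fixes f :: "'a::euclidean_space \<Rightarrow> complex"
  assumes g: "\<And>n. integrable lborel (g n)" and gB: "\<And>n x. norm (g n x) \<le> B"
    and f: "integrable lborel f" and lim: "AE x in lborel. (\<lambda>n. g n x) \<longlonglongrightarrow> f x"
    and eig: "\<And>n \<xi>. fourier (g n) \<xi> = c * g n \<xi>"
  shows "AE \<xi> in lborel. fourier f \<xi> = c * f \<xi>"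
proof -
  have [measurable]: "f \<in> borel_measurable borel" "\<And>n. g n \<in> borel_measurable borel" using f g by auto
  have B: "0 \<le> B" using gB norm_ge_zero order_trans by blast
  have lborelI: "integrable lebesgue k" if "integrable lborel k" for k :: "'a \<Rightarrow> complex"
    using that by (simp add: integrable_completion borel_measurable_integrable)
  have four_meas: "fourier k \<in> borel_measurable borel" if "integrable lborel k" for k :: "'a \<Rightarrow> complex"
    using continuous_on_fourier[OF lborelI[OF that]] by (rule borel_measurable_continuous_onI)
  note [measurable] = four_meas[OF f]
  \<comment> \<open>The limit \<open>n \<rightarrow> \<infinity>\<close> for a fixed width \<open>\<epsilon>\<close>.\<close>
  have smooth: "c * (\<integral>x. f x * gauss_smooth \<epsilon> \<psi> x \<partial>lborel)
      = (\<integral>x. f x * (exp (- (norm ((2 * pi * \<epsilon>) *\<^sub>R x))\<^sup>2 / 2) * fourier \<psi> x) \<partial>lborel)"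
    if \<psi>: "integrable lborel \<psi>" and \<epsilon>: "0 < \<epsilon>" for \<psi> \<epsilon>
  proof -
    define E where "E x = exp (- (norm ((2 * pi * \<epsilon>) *\<^sub>R x))\<^sup>2 / 2)" for x :: 'a
    have E: "integrable lborel E" "\<And>x. 0 < E x"
      using integrable_exp_norm_square_scale[of "2 * pi * \<epsilon>", where 'a='a] \<epsilon> by (simp_all add: E_def[abs_def])
    note [measurable] = four_meas[OF \<psi>] borel_measurable_integrable[OF integrable_gauss_smooth[OF \<psi>], of \<epsilon>]
    define L where "L = (\<integral>x. norm (\<psi> x) \<partial>lebesgue)"
    have L: "0 \<le> L" "\<And>x. norm (fourier \<psi> x) \<le> L"
      unfolding L_def by (auto intro: norm_fourier_le)
    have eq: "c * (\<integral>x. g n x * gauss_smooth \<epsilon> \<psi> x \<partial>lborel)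
        = (\<integral>x. g n x * (complex_of_real (E x) * fourier \<psi> x) \<partial>lborel)" for n
    proof -
      have "c * (\<integral>x. g n x * gauss_smooth \<epsilon> \<psi> x \<partial>lborel) = (\<integral>\<xi>. fourier (g n) \<xi> * gauss_smooth \<epsilon> \<psi> \<xi> \<partial>lborel)"
        by (simp add: eig mult.assoc)
      also have "\<dots> = (\<integral>x. g n x * fourier (gauss_smooth \<epsilon> \<psi>) x \<partial>lborel)"
        by (intro fourier_multiplication_formula g integrable_gauss_smooth \<psi>)
      finally show ?thesis by (simp add: fourier_gauss_smooth[OF \<psi>] E_def)
    qed
    have lim1: "(\<lambda>n. c * (\<integral>x. g n x * gauss_smooth \<epsilon> \<psi> x \<partial>lborel))
        \<longlonglongrightarrow> c * (\<integral>x. f x * gauss_smooth \<epsilon> \<psi> x \<partial>lborel)"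
    proof (intro tendsto_mult tendsto_const integral_dominated_convergence[where w = "\<lambda>x. B * norm (gauss_smooth \<epsilon> \<psi> x)"])
      show "integrable lborel (\<lambda>x. B * norm (gauss_smooth \<epsilon> \<psi> x))"
        using integrable_gauss_smooth[OF \<psi>] by auto
      show "AE x in lborel. (\<lambda>n. g n x * gauss_smooth \<epsilon> \<psi> x) \<longlonglongrightarrow> f x * gauss_smooth \<epsilon> \<psi> x"
        using lim by eventually_elim (intro tendsto_intros)
      show "AE x in lborel. norm (g n x * gauss_smooth \<epsilon> \<psi> x) \<le> B * norm (gauss_smooth \<epsilon> \<psi> x)" for n
        using gB by (auto simp: norm_mult intro!: mult_right_mono)
    qed measurable
    have lim2: "(\<lambda>n. \<integral>x. g n x * (complex_of_real (E x) * fourier \<psi> x) \<partial>lborel)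
        \<longlonglongrightarrow> (\<integral>x. f x * (complex_of_real (E x) * fourier \<psi> x) \<partial>lborel)"
    proof (intro integral_dominated_convergence[where w = "\<lambda>x. B * (E x * L)"])
      show "integrable lborel (\<lambda>x. B * (E x * L))"
        using E by auto
      show "AE x in lborel. (\<lambda>n. g n x * (complex_of_real (E x) * fourier \<psi> x)) \<longlonglongrightarrow> f x * (complex_of_real (E x) * fourier \<psi> x)"
        using lim by eventually_elim (intro tendsto_intros)
      show "AE x in lborel. norm (g n x * (complex_of_real (E x) * fourier \<psi> x)) \<le> B * (E x * L)" for n
        using gB L E(2) B by (auto simp: norm_mult less_imp_le intro!: mult_mono)
    qed (use E in auto)
    show ?thesis
      using LIMSEQ_unique[OF lim1[unfolded eq] lim2] by (simp add: E_def)
  qed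
  \<comment> \<open>The limit \<open>\<epsilon> \<rightarrow> 0\<close>.\<close>
  have weak: "(\<integral>x. fourier f x * \<psi> x \<partial>lborel) = c * (\<integral>x. f x * \<psi> x \<partial>lborel)"
    if cont: "continuous_on UNIV \<psi>" and bd: "\<And>x. norm (\<psi> x) \<le> M" and \<psi>: "integrable lborel \<psi>" for \<psi> M
  proof -
    define \<epsilon> where "\<epsilon> k = inverse (real (Suc k))" for k
    have \<epsilon>: "0 < \<epsilon> k" "\<epsilon> \<longlonglongrightarrow> 0" for k
      unfolding \<epsilon>_def by simp (rule LIMSEQ_inverse_real_of_nat)
    have [measurable]: "\<psi> \<in> borel_measurable borel" using \<psi> by auto
    have [measurable]: "fourier \<psi> \<in> borel_measurable borel" "\<And>\<epsilon>. gauss_smooth \<epsilon> \<psi> \<in> borel_measurable borel"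
      using four_meas[OF \<psi>] borel_measurable_integrable[OF integrable_gauss_smooth[OF \<psi>]] by auto
    define L where "L = (\<integral>x. norm (\<psi> x) \<partial>lebesgue)"
    have L: "0 \<le> L" "\<And>x. norm (fourier \<psi> x) \<le> L"
      unfolding L_def by (auto intro: norm_fourier_le)
    have lim1: "(\<lambda>k. c * (\<integral>x. f x * gauss_smooth (\<epsilon> k) \<psi> x \<partial>lborel)) \<longlonglongrightarrow> c * (\<integral>x. f x * \<psi> x \<partial>lborel)"
    proof (intro tendsto_mult tendsto_const integral_dominated_convergence[where w = "\<lambda>x. norm (f x) * M"])
      show "integrable lborel (\<lambda>x. norm (f x) * M)" using f by auto
      show "AE x in lborel. (\<lambda>k. f x * gauss_smooth (\<epsilon> k) \<psi> x) \<longlonglongrightarrow> f x * \<psi> x"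
        by (intro always_eventually allI tendsto_intros gauss_smooth_tendsto[OF cont bd \<epsilon>(2)])
      show "AE x in lborel. norm (f x * gauss_smooth (\<epsilon> k) \<psi> x) \<le> norm (f x) * M" for k
        unfolding norm_mult by (intro always_eventually allI mult_left_mono norm_gauss_smooth_le bd) auto
    qed measurable
    have lim2: "(\<lambda>k. \<integral>x. f x * (exp (- (norm ((2 * pi * \<epsilon> k) *\<^sub>R x))\<^sup>2 / 2) * fourier \<psi> x) \<partial>lborel)
        \<longlonglongrightarrow> (\<integral>x. f x * fourier \<psi> x \<partial>lborel)"
    proof (intro integral_dominated_convergence[where w = "\<lambda>x. norm (f x) * L"])
      show "integrable lborel (\<lambda>x. norm (f x) * L)" using f by auto
      have "(\<lambda>k. f x * (exp (- (norm ((2 * pi * \<epsilon> k) *\<^sub>R x))\<^sup>2 / 2) * fourier \<psi> x))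
        \<longlonglongrightarrow> f x * (exp (- (norm ((2 * pi * 0) *\<^sub>R x))\<^sup>2 / 2) * fourier \<psi> x)" for x
        by (intro tendsto_mult tendsto_const tendsto_of_real tendsto_exp tendsto_divide tendsto_minus
              tendsto_power tendsto_norm tendsto_scaleR \<epsilon>(2)) simp
      then show "AE x in lborel. (\<lambda>k. f x * (exp (- (norm ((2 * pi * \<epsilon> k) *\<^sub>R x))\<^sup>2 / 2) * fourier \<psi> x))
        \<longlonglongrightarrow> f x * fourier \<psi> x" by simp
      show "AE x in lborel. norm (f x * (exp (- (norm ((2 * pi * \<epsilon> k) *\<^sub>R x))\<^sup>2 / 2) * fourier \<psi> x)) \<le> norm (f x) * L" for k
      proof (intro always_eventually allI)
        fix x
        have "norm (complex_of_real (exp (- (norm ((2 * pi * \<epsilon> k) *\<^sub>R x))\<^sup>2 / 2))) * norm (fourier \<psi> x) \<le> 1 * L"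
          using L by (intro mult_mono) auto
        then show "norm (f x * (exp (- (norm ((2 * pi * \<epsilon> k) *\<^sub>R x))\<^sup>2 / 2) * fourier \<psi> x)) \<le> norm (f x) * L"
          unfolding norm_mult by (intro mult_left_mono) auto
      qed
    qed measurable
    have "c * (\<integral>x. f x * \<psi> x \<partial>lborel) = (\<integral>x. f x * fourier \<psi> x \<partial>lborel)"
      using LIMSEQ_unique[OF lim1[unfolded smooth[OF \<psi> \<epsilon>(1)]] lim2] .
    then show ?thesis using fourier_multiplication_formula[OF f \<psi>] by simp
  qed
  define L where "L = (\<integral>x. norm (f x) \<partial>lebesgue)"
  have L: "\<And>x. norm (fourier f x) \<le> L"
    unfolding L_def by (rule norm_fourier_le)
  \<comment> \<open>The weight makes the merely bounded function \<open>fourier f\<close> integrable.\<close>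
  define w where "w x = exp (- (norm x)\<^sup>2 / 2)" for x :: 'a
  have w: "continuous_on UNIV w" "\<And>x. 0 < w x" "\<And>x. w x \<le> 1" "integrable lborel w"
    using integrable_exp_norm_square[where 'a='a] by (auto simp: w_def[abs_def] intro!: continuous_intros)
  have [measurable]: "w \<in> borel_measurable borel" using w by auto
  have "AE x in lborel. fourier f x - c * f x = 0"
  proof (rule AE_zero_if_orthogonal_to_continuous[OF _ w])
    have "integrable lborel (\<lambda>x. complex_of_real (w x) * fourier f x)"
      using w L by (intro integrable_mult_bounded) auto
    moreover have "integrable lborel (\<lambda>x. complex_of_real (w x) * f x)"
      using w f by (intro integrable_mult_bounded[where B=1]) (auto simp: less_imp_le)
    ultimately have "integrable lborel (\<lambda>x. complex_of_real (w x) * fourier f x - c * (complex_of_real (w x) * f x))"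
      by auto
    then show "integrable lborel (\<lambda>x. complex_of_real (w x) * (fourier f x - c * f x))"
      by (simp add: algebra_simps)
    show "(\<integral>x. \<psi> x * (fourier f x - c * f x) \<partial>lborel) = 0"
      if cont: "continuous_on UNIV \<psi>" and bd: "\<And>x. norm (\<psi> x) \<le> 1" and \<psi>: "integrable lborel \<psi>" for \<psi>
    proof -
      have [measurable]: "\<psi> \<in> borel_measurable borel" using \<psi> by auto
      have "integrable lborel (\<lambda>x. fourier f x * \<psi> x)" "integrable lborel (\<lambda>x. f x * \<psi> x)"
        using integrable_mult_bounded[OF \<psi> four_meas[OF f] L] integrable_mult_bounded[OF f _ bd] by auto
      then have "(\<integral>x. fourier f x * \<psi> x - c * (f x * \<psi> x) \<partial>lborel) = 0"
        using weak[OF cont bd \<psi>] by simp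
      then show ?thesis by (simp add: algebra_simps)
    qed
  qed measurable
  then show ?thesis by simp
qed

section \<open>The cone of competitors with sign change inside a fixed ball\<close>

text \<open>The class without the requirement that the function is nonzero and with a prescribed radius for
the sign condition. In contrast to the class itself it is a convex cone.\<close>

definition sign_cone :: "nat \<Rightarrow> real \<Rightarrow> ('a::euclidean_space \<Rightarrow> real) \<Rightarrow> real \<Rightarrow> ('a \<Rightarrow> real) set" where
  "sign_cone r s P \<rho> = {f.
     continuous_on UNIV f \<and> integrable lebesgue f \<and>
     (\<forall>\<xi>. fourier (\<lambda>x. complex_of_real (f x)) \<xi> = complex_of_real s * \<i> ^ r * complex_of_real (f \<xi>)) \<and>
     integrable lebesgue (\<lambda>x. P x * f x) \<and>
     (\<integral>x. P x * f x \<partial>lebesgue) \<le> 0 \<and>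
     (\<forall>x. \<rho> \<le> norm x \<longrightarrow> 0 \<le> P x * f x)}"

lemma sign_coneD:
  assumes "f \<in> sign_cone r s P \<rho>"
  shows "continuous_on UNIV f" "integrable lebesgue f"
    "fourier (\<lambda>x. complex_of_real (f x)) \<xi> = complex_of_real s * \<i> ^ r * complex_of_real (f \<xi>)"
    "integrable lebesgue (\<lambda>x. P x * f x)" "(\<integral>x. P x * f x \<partial>lebesgue) \<le> 0"
    "\<rho> \<le> norm x \<Longrightarrow> 0 \<le> P x * f x"
    "f \<in> borel_measurable borel"
  using assms by (auto simp: sign_cone_def intro: borel_measurable_continuous_onI)

lemma sign_cone_mono: "\<rho> \<le> \<rho>' \<Longrightarrow> sign_cone r s P \<rho> \<subseteq> sign_cone r s P \<rho>'"
  by (auto simp: sign_cone_def)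

lemma sign_class_imp_sign_cone:
  assumes "f \<in> sign_class r s P" "\<And>x. \<rho> \<le> norm x \<Longrightarrow> 0 \<le> P x * f x"
  shows "f \<in> sign_cone r s P \<rho>"
  using assms by (auto simp: sign_class_def sign_cone_def)

lemma sign_cone_imp_sign_class:
  assumes f: "f \<in> sign_cone r s P \<rho>" and "f \<noteq> (\<lambda>x. 0)"
  shows "f \<in> sign_class r s P"
proof -
  have "\<forall>\<^sub>F x in at_infinity. 0 \<le> P x * f x"
    using f by (auto simp: sign_cone_def eventually_at_infinity)
  then show ?thesis
    using assms by (auto simp: sign_class_def sign_cone_def)
qed

lemma fourier_linear:
  fixes f g :: "'a::euclidean_space \<Rightarrow> complex"
  assumes "integrable lebesgue f" "integrable lebesgue g"
  shows "fourier (\<lambda>x. a * f x + b * g x) \<xi> = a * fourier f \<xi> + b * fourier g \<xi>"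
proof -
  note i = integrable_fourier_kernel[OF assms(1), of \<xi>] integrable_fourier_kernel[OF assms(2), of \<xi>]
  have "fourier (\<lambda>x. a * f x + b * g x) \<xi>
      = (\<integral>x. a * (fourier_kernel \<xi> x * f x) + b * (fourier_kernel \<xi> x * g x) \<partial>lebesgue)"
    unfolding fourier_def by (intro Bochner_Integration.integral_cong) (auto simp: algebra_simps)
  also have "\<dots> = (\<integral>x. a * (fourier_kernel \<xi> x * f x) \<partial>lebesgue) + (\<integral>x. b * (fourier_kernel \<xi> x * g x) \<partial>lebesgue)"
    using i by (intro Bochner_Integration.integral_add integrable_mult_right)
  finally show ?thesis
    unfolding fourier_def by (simp only: integral_mult_right_zero)
qed

lemma sign_cone_combination:
  assumes f: "f \<in> sign_cone r s P \<rho>" and g: "g \<in> sign_cone r s P \<rho>" and ab: "0 \<le> a" "0 \<le> b"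
  shows "(\<lambda>x. a * f x + b * g x) \<in> sign_cone r s P \<rho>"
proof -
  note F = sign_coneD[OF f] and G = sign_coneD[OF g]
  have eq: "P x * (a * f x + b * g x) = a * (P x * f x) + b * (P x * g x)" for x
    by (simp add: algebra_simps)
  have int: "integrable lebesgue (\<lambda>x. P x * (a * f x + b * g x))"
    unfolding eq using F(4) G(4) by auto
  have "(\<integral>x. P x * (a * f x + b * g x) \<partial>lebesgue)
      = a * (\<integral>x. P x * f x \<partial>lebesgue) + b * (\<integral>x. P x * g x \<partial>lebesgue)"
    unfolding eq using F(4) G(4) by simp
  also have "\<dots> \<le> 0"
    using F(5) G(5) ab by (intro add_nonpos_nonpos mult_nonneg_nonpos)
  finally have "(\<integral>x. P x * (a * f x + b * g x) \<partial>lebesgue) \<le> 0" .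
  moreover have "fourier (\<lambda>x. complex_of_real (a * f x + b * g x)) \<xi>
      = complex_of_real s * \<i> ^ r * complex_of_real (a * f \<xi> + b * g \<xi>)" for \<xi>
    using fourier_linear[of "\<lambda>x. complex_of_real (f x)" "\<lambda>x. complex_of_real (g x)" a b \<xi>] F(2,3) G(2,3)
    by (simp add: algebra_simps)
  moreover have "0 \<le> P x * (a * f x + b * g x)" if "\<rho> \<le> norm x" for x
    unfolding eq using F(6) G(6) ab that by auto
  ultimately show ?thesis
    using F(1,2) G(1,2) int by (auto simp: sign_cone_def intro!: continuous_intros)
qed

text \<open>The function agrees in modulus with its Fourier transform.\<close>

lemma sign_cone_abs_le:
  assumes f: "f \<in> sign_cone r s P \<rho>" and s: "s \<in> {1, -1}"
  shows "\<bar>f x\<bar> \<le> (\<integral>y. \<bar>f y\<bar> \<partial>lebesgue)"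
proof -
  have "\<bar>f x\<bar> = norm (fourier (\<lambda>x. complex_of_real (f x)) x)"
    unfolding sign_coneD(3)[OF f] using s by (auto simp: norm_mult norm_power)
  also have "\<dots> \<le> (\<integral>y. norm (complex_of_real (f y)) \<partial>lebesgue)"
    by (rule norm_fourier_le)
  finally show ?thesis by simp
qed

text \<open>On the sub-level set of \<open>P\<close>, which has finite measure, the Hoelder and the admissibility inequality
apply; off that set \<open>\<bar>f\<bar> \<le> \<bar>P f\<bar> / t\<close>.\<close>

lemma sign_cone_L1_bound:
  fixes P :: "'a::euclidean_space \<Rightarrow> real"
  assumes P[measurable]: "P \<in> borel_measurable lebesgue" and q: "1 \<le> q"
    and C: "0 < C" "admissibility_inequality r P q C"
    and t: "0 < t" "emeasure lebesgue {x. \<bar>P x\<bar> \<le> t} < \<infinity>"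
  shows "\<exists>D\<ge>0. \<forall>s\<in>{1, -1}. \<forall>\<rho>. \<forall>f\<in>sign_cone r s P \<rho>.
      (\<integral>x. \<bar>f x\<bar> \<partial>lebesgue) \<le> D * (\<integral>x. \<bar>P x * f x\<bar> \<partial>lebesgue)"
proof -
  let ?S = "{x. \<bar>P x\<bar> \<le> t}"
  let ?N = "lp_norm (lebesgue_on ?S) (conj_exponent q) (\<lambda>_. 1::real)"
  have "{x \<in> space lebesgue. \<bar>P x\<bar> \<le> t} \<in> sets lebesgue" by measurable
  then have S[measurable]: "?S \<in> sets lebesgue" by simp
  have N: "?N < \<infinity>"
  proof (cases "q = 1")
    case True
    have "?N \<le> 1"
      unfolding True conj_exponent_1 by (rule lp_norm_infinity_le) auto
    then show ?thesis by (rule le_less_trans) simp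
  next
    case False
    then have "1 < q" using q by simp
    note p = conj_exponent_less_infinity[OF this]
    have "(\<integral>\<^sup>+x. ennreal (norm (1::real) powr enn2real (conj_exponent q)) \<partial>lebesgue_on ?S) = emeasure lebesgue ?S"
      by (simp add: emeasure_restrict_space)
    then show ?thesis
      using p t by (subst lp_norm_finite_exponent) auto
  qed
  define D where "D = enn2real ?N * C + 1 / t"
  have D: "0 \<le> D" using C t by (simp add: D_def)
  have "(\<integral>x. \<bar>f x\<bar> \<partial>lebesgue) \<le> D * (\<integral>x. \<bar>P x * f x\<bar> \<partial>lebesgue)"
    if s: "s \<in> {1, -1}" and f: "f \<in> sign_cone r s P \<rho>" for s \<rho> f
  proof (cases "f = (\<lambda>x. 0)")
    case False
    note F = sign_coneD[OF f]
    have [measurable]: "f \<in> borel_measurable lebesgue" using F(2) by auto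
    let ?I = "\<integral>\<^sup>+x. ennreal \<bar>P x * f x\<bar> \<partial>lebesgue"
    have I: "?I = ennreal (\<integral>x. \<bar>P x * f x\<bar> \<partial>lebesgue)"
      using F(4) by (intro nn_integral_eq_integral) auto
    let ?F = "lp_norm lebesgue q (\<lambda>x. complex_of_real (f x))"
    have Fq: "?F \<le> ennreal C * ?I"
      by (rule sign_class_lp_norm_le[OF sign_cone_imp_sign_class[OF f False] s C(2)])
    also have "\<dots> < \<infinity>" by (simp add: I ennreal_mult_less_top)
    finally have Ffin: "?F < \<infinity>" .
    have "(\<integral>\<^sup>+x\<in>?S. ennreal \<bar>f x\<bar> \<partial>lebesgue)
        = (\<integral>\<^sup>+x\<in>?S. ennreal (\<bar>1::real\<bar> * norm (complex_of_real (f x))) \<partial>lebesgue)"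
      by simp
    also have "\<dots> \<le> ?N * ?F"
      using q N Ffin by (intro Holder_lp_norm) auto
    also have "\<dots> \<le> ?N * (ennreal C * ?I)"
      by (intro mult_left_mono Fq) auto
    finally have on_S: "(\<integral>\<^sup>+x\<in>?S. ennreal \<bar>f x\<bar> \<partial>lebesgue) \<le> ?N * (ennreal C * ?I)" .
    have "ennreal \<bar>f x\<bar> \<le> ennreal \<bar>f x\<bar> * indicator ?S x + ennreal (1/t) * ennreal \<bar>P x * f x\<bar>" for x
    proof (cases "x \<in> ?S")
      case False
      then have "t * \<bar>f x\<bar> \<le> \<bar>P x * f x\<bar>" by (simp add: abs_mult mult_right_mono)
      then have "\<bar>f x\<bar> \<le> 1/t * \<bar>P x * f x\<bar>" using t by (simp add: field_simps)
      then show ?thesis using False t by (simp add: ennreal_mult'[symmetric] ennreal_leI)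
    qed auto
    then have "(\<integral>\<^sup>+x. ennreal \<bar>f x\<bar> \<partial>lebesgue)
        \<le> (\<integral>\<^sup>+x. ennreal \<bar>f x\<bar> * indicator ?S x + ennreal (1/t) * ennreal \<bar>P x * f x\<bar> \<partial>lebesgue)"
      by (intro nn_integral_mono)
    also have "\<dots> = (\<integral>\<^sup>+x\<in>?S. ennreal \<bar>f x\<bar> \<partial>lebesgue) + ennreal (1/t) * ?I"
      by (subst nn_integral_add) (auto simp: nn_integral_cmult)
    also have "\<dots> \<le> ?N * (ennreal C * ?I) + ennreal (1/t) * ?I"
      by (intro add_right_mono on_S)
    also have "?N = ennreal (enn2real ?N)" using N by simp
    also have "ennreal (enn2real ?N) * (ennreal C * ?I) + ennreal (1/t) * ?I
        = ennreal (D * (\<integral>x. \<bar>P x * f x\<bar> \<partial>lebesgue))"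
      unfolding I using C t
      by (simp add: ennreal_mult'[symmetric] ennreal_plus[symmetric] D_def algebra_simps del: ennreal_plus)
    also have "(\<integral>\<^sup>+x. ennreal \<bar>f x\<bar> \<partial>lebesgue) = ennreal (\<integral>x. \<bar>f x\<bar> \<partial>lebesgue)"
      using F(2) by (intro nn_integral_eq_integral) auto
    finally show ?thesis
      using D by (subst (asm) ennreal_le_iff) auto
  qed simp
  then show ?thesis using D by blast
qed

text \<open>If \<open>P x * f x < 0\<close>, then \<open>f\<close> keeps its sign near \<open>x\<close>, while by the density hypothesis \<open>P\<close> has the
sign of \<open>P x\<close> on a set of positive measure in every small ball around \<open>x\<close>. There \<open>P f < 0\<close>, which
contradicts the almost everywhere inequality.\<close>

lemma sign_nonneg_of_AE:
  fixes P f :: "'a::euclidean_space \<Rightarrow> real"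
  assumes [measurable]: "P \<in> borel_measurable lebesgue" and f: "continuous_on UNIV f" and A: "0 \<le> A"
    and AE: "AE y in lebesgue. A < norm y \<longrightarrow> 0 \<le> P y * f y"
    and dens: "\<And>x. x \<noteq> 0 \<Longrightarrow> P x \<noteq> 0 \<Longrightarrow>
         0 < Liminf (at_right 0) (\<lambda>\<epsilon>. emeasure lebesgue ({y. P y * P x > 0} \<inter> ball x \<epsilon>)
                                      / emeasure lebesgue (ball x \<epsilon>))"
    and x: "A < norm x"
  shows "0 \<le> P x * f x"
proof (rule ccontr)
  assume "\<not> 0 \<le> P x * f x"
  then have neg: "P x * f x < 0" by simp
  then have "P x \<noteq> 0" "f x \<noteq> 0" "x \<noteq> 0" using x A by auto
  let ?U = "{y. 0 < f y * f x \<and> A < norm y}"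
  have "open ?U"
    using f by (intro open_Collect_conj open_Collect_less continuous_intros) auto
  moreover have "x \<in> ?U" using \<open>f x \<noteq> 0\<close> x by (simp add: zero_less_mult_iff) linarith
  ultimately obtain e where e: "0 < e" "ball x e \<subseteq> ?U"
    by (metis open_contains_ball)
  have "eventually (\<lambda>\<epsilon>. 0 < emeasure lebesgue ({y. P y * P x > 0} \<inter> ball x \<epsilon>) / emeasure lebesgue (ball x \<epsilon>)) (at_right 0)"
    using less_LiminfD[OF dens[OF \<open>x \<noteq> 0\<close> \<open>P x \<noteq> 0\<close>]] .
  moreover have "eventually (\<lambda>\<epsilon>. \<epsilon> < e) (at_right 0)"
    using e(1) by (auto simp: eventually_at_right_field intro!: exI[of _ e])
  ultimately have "eventually (\<lambda>\<epsilon>. 0 < emeasure lebesgue ({y. P y * P x > 0} \<inter> ball x \<epsilon>) / emeasure lebesgue (ball x \<epsilon>) \<and> \<epsilon> < e) (at_right 0)"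
    by (rule eventually_conj)
  then obtain \<epsilon> where \<epsilon>: "0 < emeasure lebesgue ({y. P y * P x > 0} \<inter> ball x \<epsilon>) / emeasure lebesgue (ball x \<epsilon>)" "\<epsilon> < e"
    using eventually_happens'[OF trivial_limit_at_right_real] by blast
  let ?T = "{y. P y * P x > 0} \<inter> ball x \<epsilon>"
  have "{y \<in> space lebesgue. P y * P x > 0} \<in> sets lebesgue" by measurable
  then have T: "?T \<in> sets lebesgue" by (intro sets.Int) auto
  have "AE y in lebesgue. y \<notin> ?T"
    using AE
  proof eventually_elim
    case (elim y)
    show "y \<notin> ?T"
    proof
      assume y: "y \<in> ?T"
      then have "y \<in> ball x e" using \<epsilon>(2) by auto
      then have "y \<in> ?U" using e(2) by (rule subsetD[rotated])
      then have "0 < (P y * P x) * (f y * f x)" using y by auto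
      also have "\<dots> = (P y * f y) * (P x * f x)" by simp
      finally have "P y * f y < 0"
        using neg zero_less_mult_iff[of "P y * f y" "P x * f x"] by linarith
      then show False using elim \<open>y \<in> ?U\<close> by simp
    qed
  qed
  then have "emeasure lebesgue ?T = 0"
    using AE_iff_null_sets[OF T] by auto
  then show False using \<epsilon>(1) by simp
qed

section \<open>Limits of competitors\<close>

lemma Fatou_norm_bound:
  fixes g :: "nat \<Rightarrow> 'a \<Rightarrow> 'b::{banach, second_countable_topology}"
  assumes [measurable]: "\<And>n. g n \<in> borel_measurable M" "f \<in> borel_measurable M"
    and lim: "AE x in M. (\<lambda>n. g n x) \<longlonglongrightarrow> f x"
    and bound: "\<And>n. (\<integral>\<^sup>+x. ennreal (norm (g n x)) \<partial>M) \<le> B"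
  shows "(\<integral>\<^sup>+x. ennreal (norm (f x)) \<partial>M) \<le> B"
proof -
  have "(\<integral>\<^sup>+x. ennreal (norm (f x)) \<partial>M) = (\<integral>\<^sup>+x. liminf (\<lambda>n. ennreal (norm (g n x))) \<partial>M)"
  proof (rule nn_integral_cong_AE)
    show "AE x in M. ennreal (norm (f x)) = liminf (\<lambda>n. ennreal (norm (g n x)))"
      using lim
    proof eventually_elim
      case (elim x)
      then have "(\<lambda>n. ennreal (norm (g n x))) \<longlonglongrightarrow> ennreal (norm (f x))"
        by (intro tendsto_ennrealI tendsto_norm)
      then show ?case by (intro lim_imp_Liminf[symmetric]) auto
    qed
  qed
  also have "\<dots> \<le> liminf (\<lambda>n. \<integral>\<^sup>+x. ennreal (norm (g n x)) \<partial>M)"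
    by (rule nn_integral_liminf) measurable
  also have "\<dots> \<le> liminf (\<lambda>n::nat. B)"
    using bound by (intro Liminf_mono always_eventually allI)
  also have "\<dots> = B" by (simp add: Liminf_const)
  finally show ?thesis .
qed

lemma bounded_AE_limit_integral:
  fixes k :: "'a \<Rightarrow> 'b::{real_normed_field, banach, second_countable_topology}"
  assumes k: "integrable M k" and [measurable]: "\<And>n. g n \<in> borel_measurable M" "f \<in> borel_measurable M"
    and lim: "AE x in M. (\<lambda>n. g n x) \<longlonglongrightarrow> f x" and bound: "\<And>n x. \<bar>g n x\<bar> \<le> B"
  shows "(\<lambda>n. \<integral>x. k x * of_real (g n x) \<partial>M) \<longlonglongrightarrow> (\<integral>x. k x * of_real (f x) \<partial>M)"
proof (rule integral_dominated_convergence[where w = "\<lambda>x. norm (k x) * B"])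
  have [measurable]: "k \<in> borel_measurable M" using k by auto
  show "(\<lambda>x. k x * of_real (f x)) \<in> borel_measurable M" by measurable
  show "(\<lambda>x. k x * of_real (g n x)) \<in> borel_measurable M" for n by measurable
  show "integrable M (\<lambda>x. norm (k x) * B)" using k by simp
  show "AE x in M. (\<lambda>n. k x * of_real (g n x)) \<longlonglongrightarrow> k x * of_real (f x)"
    using lim by eventually_elim (intro tendsto_intros)
  show "AE x in M. norm (k x * of_real (g n x)) \<le> norm (k x) * B" for n
    using bound by (auto simp: norm_mult intro!: mult_left_mono)
qed

lemma lp_loc_1_imp_integrable_ball:
  fixes P :: "'a::euclidean_space \<Rightarrow> real"
  assumes "lp_loc 1 P"
  shows "integrable lebesgue (\<lambda>x. indicator (cball 0 R) x * P x)"
    "integrable lebesgue (\<lambda>x. indicator (ball 0 R) x * P x)"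
proof -
  have [measurable]: "P \<in> borel_measurable lebesgue"
    using assms by (simp add: lp_loc_def)
  have [measurable]: "cball (0::'a) R \<in> sets lebesgue" by simp
  have "lp_norm (lebesgue_on (cball 0 R)) 1 P < \<infinity>"
    using assms by (auto simp: lp_loc_def)
  then have "(\<integral>\<^sup>+x\<in>cball 0 R. ennreal \<bar>P x\<bar> \<partial>lebesgue) < \<infinity>"
    by (simp add: lp_norm_1 nn_integral_restrict_space)
  also have "(\<integral>\<^sup>+x\<in>cball 0 R. ennreal \<bar>P x\<bar> \<partial>lebesgue)
      = (\<integral>\<^sup>+x. ennreal (norm (indicator (cball 0 R) x * P x)) \<partial>lebesgue)"
    by (intro nn_integral_cong) (auto split: split_indicator)
  finally show c: "integrable lebesgue (\<lambda>x. indicator (cball 0 R) x * P x)"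
    by (intro integrableI_bounded) auto
  have "integrable lebesgue (\<lambda>x. (indicator (cball 0 R) x * P x) * indicator (ball 0 R) x)"
    using c by (intro integrable_real_mult_indicator) auto
  also have "(\<lambda>x. (indicator (cball 0 R) x * P x) * indicator (ball 0 R) x) = (\<lambda>x::'a. indicator (ball 0 R) x * P x)"
    by (auto simp: fun_eq_iff split: split_indicator)
  finally show "integrable lebesgue (\<lambda>x. indicator (ball 0 R) x * P x)" .
qed

text \<open>The uniform \<open>L\<^sup>1\<close> bounds pass to the limit by Fatou's lemma and the eigenfunction equation by
\<open>fourier_eq_limit\<close>, which also supplies a continuous version. The radii vary along the sequence, since
a minimizing sequence only comes with radii that tend to the infimum.\<close>

lemma sign_cone_limit:
  fixes P :: "'a::euclidean_space \<Rightarrow> real"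
  assumes P: "lp_loc 1 P" and s: "s \<in> {1, -1}" and A: "0 \<le> A"
    and dens: "\<And>x. x \<noteq> 0 \<Longrightarrow> P x \<noteq> 0 \<Longrightarrow>
         0 < Liminf (at_right 0) (\<lambda>\<epsilon>. emeasure lebesgue ({y. P y * P x > 0} \<inter> ball x \<epsilon>)
                                      / emeasure lebesgue (ball x \<epsilon>))"
    and g: "\<And>n. g n \<in> sign_cone r s P (\<rho> n)" and \<rho>: "\<rho> \<longlonglongrightarrow> A" "\<And>n. \<rho> n \<le> R0"
    and gL1: "\<And>n. (\<integral>x. \<bar>g n x\<bar> \<partial>lebesgue) \<le> D"
    and gP: "\<And>n. (\<integral>x. \<bar>P x * g n x\<bar> \<partial>lebesgue) \<le> E"
    and conv: "AE x in lborel. convergent (\<lambda>n. g n x)"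
  shows "\<exists>f. (AE x in lebesgue. (\<lambda>n. g n x) \<longlonglongrightarrow> f x) \<and> (\<forall>\<rho>>A. f \<in> sign_cone r s P \<rho>)"
proof -
  note G = sign_coneD[OF g]
  have [measurable]: "P \<in> borel_measurable lebesgue"
    using P by (simp add: lp_loc_def)
  have g_meas[measurable]: "g n \<in> borel_measurable borel" "g n \<in> borel_measurable lebesgue" for n
    using G(7) by (auto intro: measurable_completion)
  have gD: "\<bar>g n x\<bar> \<le> D" for n x
    using sign_cone_abs_le[OF g s] gL1 by (rule order_trans)
  define h where "h x = lim (\<lambda>n. g n x)" for x
  have h_meas[measurable]: "h \<in> borel_measurable borel" "h \<in> borel_measurable lebesgue"
  proof -
    show "h \<in> borel_measurable borel"
      unfolding h_def by (rule borel_measurable_lim_metric) measurable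
    then show "h \<in> borel_measurable lebesgue" by (intro measurable_completion) simp
  qed
  have lim_lborel: "AE x in lborel. (\<lambda>n. g n x) \<longlonglongrightarrow> h x"
    using conv by eventually_elim (simp add: h_def convergent_LIMSEQ_iff)
  then have lim: "AE x in lebesgue. (\<lambda>n. g n x) \<longlonglongrightarrow> h x"
    by (rule AE_completion)
  have h_int: "integrable lebesgue h"
  proof (rule integrableI_bounded)
    have "(\<integral>\<^sup>+x. ennreal (norm (h x)) \<partial>lebesgue) \<le> ennreal D"
    proof (rule Fatou_norm_bound[OF _ _ lim])
      show "(\<integral>\<^sup>+x. ennreal (norm (g n x)) \<partial>lebesgue) \<le> ennreal D" for n
        using gL1 G(2) by (subst nn_integral_eq_integral) (auto intro: ennreal_leI)
    qed measurable
    then show "(\<integral>\<^sup>+x. ennreal (norm (h x)) \<partial>lebesgue) < \<infinity>"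
      by (rule le_less_trans) simp
  qed measurable
  have Ph_int: "integrable lebesgue (\<lambda>x. P x * h x)"
  proof (rule integrableI_bounded)
    have "(\<integral>\<^sup>+x. ennreal (norm (P x * h x)) \<partial>lebesgue) \<le> ennreal E"
    proof (rule Fatou_norm_bound[where g = "\<lambda>n x. P x * g n x"])
      show "AE x in lebesgue. (\<lambda>n. P x * g n x) \<longlonglongrightarrow> P x * h x"
        using lim by eventually_elim (intro tendsto_intros)
      show "(\<integral>\<^sup>+x. ennreal (norm (P x * g n x)) \<partial>lebesgue) \<le> ennreal E" for n
        using gP G(4) by (subst nn_integral_eq_integral) (auto intro: ennreal_leI)
    qed measurable
    then show "(\<integral>\<^sup>+x. ennreal (norm (P x * h x)) \<partial>lebesgue) < \<infinity>"
      by (rule le_less_trans) simp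
  qed measurable
  let ?c = "complex_of_real s * \<i> ^ r"
  let ?H = "\<lambda>x. complex_of_real (h x)"
  have c: "?c \<noteq> 0" using s by auto
  have H_int: "integrable lebesgue ?H" using h_int by auto
  have "AE \<xi> in lborel. fourier ?H \<xi> = ?c * ?H \<xi>"
  proof (rule fourier_eq_limit)
    show "integrable lborel (\<lambda>x. complex_of_real (g n x))" for n
      using G(2) by (simp add: integrable_completion)
    show "norm (complex_of_real (g n x)) \<le> D" for n x
      using gD by simp
    show "integrable lborel ?H"
      using H_int by (simp add: integrable_completion)
    show "AE x in lborel. (\<lambda>n. complex_of_real (g n x)) \<longlonglongrightarrow> ?H x"
      using lim_lborel by eventually_elim (intro tendsto_intros)
    show "fourier (\<lambda>x. complex_of_real (g n x)) \<xi> = ?c * complex_of_real (g n \<xi>)" for n \<xi>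
      by (rule G(3))
  qed
  then have eig: "AE \<xi> in lebesgue. fourier ?H \<xi> = ?c * ?H \<xi>"
    by (rule AE_completion)
  \<comment> \<open>The continuous representative of \<open>h\<close> is read off its Fourier transform.\<close>
  define f where "f x = Re (fourier ?H x / ?c)" for x
  have H_cont: "continuous_on UNIV (fourier ?H)"
    by (rule continuous_on_fourier[OF H_int])
  have f_cont: "continuous_on UNIV f"
    unfolding f_def by (intro continuous_intros H_cont) (use c in auto)
  then have f_meas[measurable]: "f \<in> borel_measurable borel"
    by (rule borel_measurable_continuous_onI)
  then have f_meas'[measurable]: "f \<in> borel_measurable lebesgue"
    by (intro measurable_completion) simp
  have fh: "AE x in lebesgue. f x = h x"
    using eig
  proof eventually_elim
    case (elim x)
    have "fourier ?H x / ?c = ?H x" unfolding elim using c by simp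
    then show ?case by (simp only: f_def Re_complex_of_real)
  qed
  have "(\<lambda>x. fourier ?H x - ?c * complex_of_real (f x)) = (\<lambda>x. 0)"
  proof (rule continuous_AE_zero_imp_zero)
    show "continuous_on UNIV (\<lambda>x. fourier ?H x - ?c * complex_of_real (f x))"
      by (intro continuous_intros H_cont f_cont)
    show "AE x in lebesgue. fourier ?H x - ?c * complex_of_real (f x) = 0"
      using eig fh by eventually_elim simp
  qed
  then have four_H: "fourier ?H x = ?c * complex_of_real (f x)" for x
    by (simp add: fun_eq_iff)
  have four: "fourier (\<lambda>x. complex_of_real (f x)) \<xi> = ?c * complex_of_real (f \<xi>)" for \<xi>
  proof -
    have "fourier (\<lambda>x. complex_of_real (f x)) = fourier ?H"
    proof (rule fourier_cong_AE)
      show "AE x in lebesgue. complex_of_real (f x) = ?H x"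
        using fh by eventually_elim simp
    qed measurable
    then show ?thesis by (simp add: four_H)
  qed
  have f_int: "integrable lebesgue f"
    using h_int fh by (subst integrable_cong_AE[of _ _ h]) auto
  have Pf_int: "integrable lebesgue (\<lambda>x. P x * f x)"
  proof (subst integrable_cong_AE)
    show "AE x in lebesgue. P x * f x = P x * h x"
      using fh by eventually_elim simp
    show "integrable lebesgue (\<lambda>x. P x * h x)" by (rule Ph_int)
  qed measurable
  have limf: "AE x in lebesgue. (\<lambda>n. g n x) \<longlonglongrightarrow> f x"
    using lim fh by eventually_elim simp
  \<comment> \<open>Dropping the outside of the ball only removes nonnegative contributions of \<open>P g\<close>, and on the ball
  dominated convergence applies. Over the whole space the integral need not be continuous.\<close>
  have ball_le: "(\<integral>x. indicator (ball 0 R) x * (P x * f x) \<partial>lebesgue) \<le> 0" if R: "R0 \<le> R" for R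
  proof (rule LIMSEQ_le_const2)
    have [measurable]: "ball (0::'a) R \<in> sets lebesgue" by simp
    show "(\<lambda>n. \<integral>x. indicator (ball 0 R) x * (P x * g n x) \<partial>lebesgue)
        \<longlonglongrightarrow> (\<integral>x. indicator (ball 0 R) x * (P x * f x) \<partial>lebesgue)"
      using bounded_AE_limit_integral[OF lp_loc_1_imp_integrable_ball(2)[OF P, of R] g_meas(2) f_meas' limf gD]
      by (simp add: mult.assoc)
    have "(\<integral>x. indicator (ball 0 R) x * (P x * g n x) \<partial>lebesgue) \<le> (\<integral>x. P x * g n x \<partial>lebesgue)" for n
    proof (rule integral_mono)
      show "integrable lebesgue (\<lambda>x. indicator (ball 0 R) x * (P x * g n x))"
        using integrable_real_mult_indicator[OF _ G(4)[of n], of "ball 0 R"] by (simp add: mult.commute)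
      show "indicator (ball 0 R) x * (P x * g n x) \<le> P x * g n x" for x
        using G(6)[of n x] \<rho>(2)[of n] R by (auto split: split_indicator)
    qed (rule G(4))
    then show "\<exists>N. \<forall>n\<ge>N. (\<integral>x. indicator (ball 0 R) x * (P x * g n x) \<partial>lebesgue) \<le> 0"
      using G(5) order_trans by blast
  qed
  have Pf_le: "(\<integral>x. P x * f x \<partial>lebesgue) \<le> 0"
  proof (rule LIMSEQ_le_const2)
    show "(\<lambda>n. \<integral>x. indicator (ball 0 (real n)) x * (P x * f x) \<partial>lebesgue) \<longlonglongrightarrow> (\<integral>x. P x * f x \<partial>lebesgue)"
    proof (rule integral_dominated_convergence[where w = "\<lambda>x. \<bar>P x * f x\<bar>"])
      have [measurable]: "ball (0::'a) (real n) \<in> sets lebesgue" for n by simp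
      show "(\<lambda>x. indicator (ball 0 (real n)) x * (P x * f x)) \<in> borel_measurable lebesgue" for n
        by measurable
      show "AE x in lebesgue. (\<lambda>n. indicator (ball 0 (real n)) x * (P x * f x)) \<longlonglongrightarrow> P x * f x"
      proof (intro always_eventually allI)
        fix x :: 'a
        obtain N where "norm x < real N" using reals_Archimedean2 by blast
        then have "eventually (\<lambda>n. indicator (ball 0 (real n)) x * (P x * f x) = P x * f x) sequentially"
          by (intro eventually_sequentiallyI[of N]) (auto split: split_indicator)
        then show "(\<lambda>n. indicator (ball 0 (real n)) x * (P x * f x)) \<longlonglongrightarrow> P x * f x"
          by (rule tendsto_eventually)
      qed
    qed (use Pf_int in \<open>auto split: split_indicator\<close>)
    obtain N where "R0 \<le> real N" using real_arch_simple by blast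
    then show "\<exists>N. \<forall>n\<ge>N. (\<integral>x. indicator (ball 0 (real n)) x * (P x * f x) \<partial>lebesgue) \<le> 0"
      using ball_le by (intro exI[of _ N]) auto
  qed
  have AE_nonneg: "AE x in lebesgue. A < norm x \<longrightarrow> 0 \<le> P x * f x"
    using limf
  proof eventually_elim
    case (elim x)
    show ?case
    proof
      assume "A < norm x"
      then have "eventually (\<lambda>n. \<rho> n < norm x) sequentially"
        using \<rho>(1) by (simp add: order_tendstoD)
      then have ev: "eventually (\<lambda>n. 0 \<le> P x * g n x) sequentially"
        by eventually_elim (use G(6) in auto)
      have "(\<lambda>n. P x * g n x) \<longlonglongrightarrow> P x * f x" using elim by (intro tendsto_intros)
      then show "0 \<le> P x * f x"
        using ev by (rule tendsto_lowerbound) simp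
    qed
  qed
  have "0 \<le> P x * f x" if "A < norm x" for x
    by (rule sign_nonneg_of_AE[OF _ f_cont A AE_nonneg dens that]) measurable
  then have "\<forall>\<rho>>A. f \<in> sign_cone r s P \<rho>"
    using f_cont f_int four Pf_int Pf_le by (auto simp: sign_cone_def)
  then show ?thesis using limf by blast
qed

section \<open>Existence of extremizers\<close>

lemma bounded_finite_measure_tail:
  assumes S: "S \<in> sets lebesgue" "emeasure lebesgue S < \<infinity>" and e: "0 < e"
  shows "\<exists>R\<ge>0. emeasure lebesgue (S - ball (0::'a::euclidean_space) R) < ennreal e"
proof -
  have "(\<lambda>n. emeasure lebesgue (S - ball 0 (real n))) \<longlonglongrightarrow> emeasure lebesgue (\<Inter>n. S - ball (0::'a) (real n))"
  proof (rule Lim_emeasure_decseq)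
    show "range (\<lambda>n. S - ball 0 (real n)) \<subseteq> sets lebesgue"
      using S by auto
    show "decseq (\<lambda>n. S - ball 0 (real n))"
      by (auto simp: decseq_def)
    show "emeasure lebesgue (S - ball 0 (real n)) \<noteq> \<infinity>" for n
    proof -
      have "emeasure lebesgue (S - ball 0 (real n)) \<le> emeasure lebesgue S"
        using S(1) by (intro emeasure_mono) auto
      also have "\<dots> < \<infinity>" by (rule S(2))
      finally show ?thesis by simp
    qed
  qed
  also have "(\<Inter>n. S - ball (0::'a) (real n)) = {}"
    using reals_Archimedean2 by fastforce
  finally have "(\<lambda>n. emeasure lebesgue (S - ball 0 (real n))) \<longlonglongrightarrow> 0" by simp
  then have "eventually (\<lambda>n. emeasure lebesgue (S - ball 0 (real n)) < ennreal e) sequentially"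
    using e by (intro order_tendstoD(2)) auto
  then obtain n where "emeasure lebesgue (S - ball 0 (real n)) < ennreal e"
    by (auto simp: eventually_sequentially)
  then show ?thesis by (intro exI[of _ "real n"]) auto
qed

text \<open>The reason why minimizing sequences do not converge weakly to \<open>0\<close>. Suppose that both alternatives
fail. Since \<open>\<integral> P f \<le> 0\<close>, the integral of \<open>P f \<ge> 0\<close> outside the ball of radius \<open>R\<close> is small, hence so is
that of \<open>\<bar>f\<bar>\<close>: where \<open>\<bar>P\<bar> > t\<close> by comparison with \<open>P f\<close>, and elsewhere because \<open>f\<close> is bounded and
little of the sub-level set lies outside the ball. Then the transform of \<open>f\<close>, which is \<open>f\<close>
itself up to a unit factor, is small on the ball of radius \<open>R0\<close>, where at least half of the mass of
\<open>P f\<close> lies: a contradiction.\<close>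

lemma normalized_functional_lower_bound:
  fixes P :: "'a::euclidean_space \<Rightarrow> real"
  assumes P: "lp_loc 1 P" and s: "s \<in> {1, -1}"
    and t: "0 < t" "emeasure lebesgue {x. \<bar>P x\<bar> \<le> t} < \<infinity>" and D: "0 \<le> D"
  shows "\<exists>R \<eta>. 0 \<le> R \<and> 0 < \<eta> \<and> (\<forall>f\<in>sign_cone r s P R0.
      (\<integral>x. \<bar>P x * f x\<bar> \<partial>lebesgue) = 1 \<longrightarrow> (\<integral>x. \<bar>f x\<bar> \<partial>lebesgue) \<le> D \<longrightarrow>
      (\<integral>x. indicator (ball 0 R) x * (P x * f x) \<partial>lebesgue) \<le> - \<eta> \<or>
      (\<exists>x\<in>cball 0 R0. \<eta> \<le> norm (fourier (\<lambda>y. complex_of_real (indicator (ball 0 R) y * f y)) x)))"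
proof -
  have [measurable]: "P \<in> borel_measurable lebesgue"
    using P by (simp add: lp_loc_def)
  let ?S = "{x. \<bar>P x\<bar> \<le> t}"
  have "{x \<in> space lebesgue. \<bar>P x\<bar> \<le> t} \<in> sets lebesgue" by measurable
  then have S[measurable]: "?S \<in> sets lebesgue" by simp
  note P0_int = lp_loc_1_imp_integrable_ball(1)[OF P, of R0]
  define I where "I = (\<integral>x. \<bar>indicator (cball 0 R0) x * P x\<bar> \<partial>lebesgue)"
  have I: "0 \<le> I" by (simp add: I_def)
  \<comment> \<open>If \<open>\<bar>f\<bar> \<le> \<delta>\<close> on the ball of radius \<open>R0\<close>, then the mass of \<open>P f\<close> there is less than \<open>1/2\<close>.\<close>
  define \<delta> where "\<delta> = 1 / (2 * (1 + I))"
  have \<delta>: "0 < \<delta>" using I by (simp add: \<delta>_def)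
  have "0 < \<delta> / (4 * (D + 1))" using D \<delta> by simp
  then obtain R1 where R1: "0 \<le> R1" "emeasure lebesgue (?S - ball 0 R1) < ennreal (\<delta> / (4 * (D + 1)))"
    using bounded_finite_measure_tail[OF S t(2)] by blast
  \<comment> \<open>\<open>R1\<close> makes the part of the sub-level set outside the ball contribute at most \<open>\<delta> / 4\<close> to the
  integral of \<open>\<bar>f\<bar>\<close>; \<open>R0 \<le> R\<close> ensures that \<open>P f\<close> is nonnegative outside the ball.\<close>
  define R where "R = max R0 R1"
  have [measurable]: "ball (0::'a) R \<in> sets lebesgue" "cball (0::'a) R0 \<in> sets lebesgue"
    by simp_all
  have [measurable]: "- ball (0::'a) R \<in> sets lebesgue"
    unfolding Compl_eq_Diff_UNIV by (rule sets.Diff) auto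
  let ?T = "?S - ball 0 R"
  have T[measurable]: "?T \<in> sets lebesgue" by measurable
  have "emeasure lebesgue ?T \<le> emeasure lebesgue (?S - ball 0 R1)"
    by (intro emeasure_mono) (auto simp: R_def)
  also note R1(2)
  finally have T_em: "emeasure lebesgue ?T < ennreal (\<delta> / (4 * (D + 1)))" .
  then have T_fin: "emeasure lebesgue ?T < \<infinity>"
    by (rule less_trans) simp
  have T_meas: "D * measure lebesgue ?T \<le> \<delta> / 4"
  proof -
    have "measure lebesgue ?T \<le> \<delta> / (4 * (D + 1))"
    proof -
      have "emeasure lebesgue ?T = ennreal (measure lebesgue ?T)"
        using T_fin by (intro emeasure_eq_ennreal_measure) simp
      then show ?thesis
        using T_em by (simp only: ennreal_less_iff[OF measure_nonneg] less_imp_le)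
    qed
    then have "D * measure lebesgue ?T \<le> D * (\<delta> / (4 * (D + 1)))"
      using D by (rule mult_left_mono)
    also have "\<dots> \<le> (D + 1) * (\<delta> / (4 * (D + 1)))"
      using D \<delta> by (intro mult_right_mono) auto
    also have "\<dots> = \<delta> / 4" using D by (simp add: field_simps)
    finally show ?thesis .
  qed
  define \<eta> where "\<eta> = min (t * \<delta> / 4) (\<delta> / 2)"
  have \<eta>: "0 < \<eta>" using t \<delta> by (simp add: \<eta>_def)
  have "(\<integral>x. indicator (ball 0 R) x * (P x * f x) \<partial>lebesgue) \<le> - \<eta> \<or>
      (\<exists>x\<in>cball 0 R0. \<eta> \<le> norm (fourier (\<lambda>y. complex_of_real (indicator (ball 0 R) y * f y)) x))"
    if f: "f \<in> sign_cone r s P R0" and one: "(\<integral>x. \<bar>P x * f x\<bar> \<partial>lebesgue) = 1"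
      and L1: "(\<integral>x. \<bar>f x\<bar> \<partial>lebesgue) \<le> D" for f
  proof (rule ccontr)
    assume "\<not> ?thesis"
    then have small1: "- \<eta> < (\<integral>x. indicator (ball 0 R) x * (P x * f x) \<partial>lebesgue)"
      and small2: "\<And>x. norm x \<le> R0 \<Longrightarrow> norm (fourier (\<lambda>y. complex_of_real (indicator (ball 0 R) y * f y)) x) < \<eta>"
      by (auto simp: not_le)
    note F = sign_coneD[OF f]
    have [measurable]: "f \<in> borel_measurable lebesgue" using F(2) by auto
    have fD: "\<bar>f x\<bar> \<le> D" for x
      using sign_cone_abs_le[OF f s] L1 by (rule order_trans)
    have int: "integrable lebesgue (\<lambda>x. indicator X x * k x)"
      if "integrable lebesgue k" "X \<in> sets lebesgue" for k :: "'a \<Rightarrow> real" and X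
      using integrable_real_mult_indicator[OF that(2,1)] by (simp add: mult.commute)
    have off_Pf: "(\<integral>x. indicator (- ball 0 R) x * (P x * f x) \<partial>lebesgue) \<le> \<eta>"
    proof -
      have "(\<integral>x. indicator (- ball 0 R) x * (P x * f x) \<partial>lebesgue)
          = (\<integral>x. P x * f x - indicator (ball 0 R) x * (P x * f x) \<partial>lebesgue)"
        by (intro Bochner_Integration.integral_cong) (auto split: split_indicator)
      also have "\<dots> = (\<integral>x. P x * f x \<partial>lebesgue) - (\<integral>x. indicator (ball 0 R) x * (P x * f x) \<partial>lebesgue)"
        by (intro Bochner_Integration.integral_diff F(4) int) auto
      finally show ?thesis using F(5) small1 by linarith
    qed
    have off_f: "(\<integral>x. indicator (- ball 0 R) x * \<bar>f x\<bar> \<partial>lebesgue) \<le> \<delta> / 2"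
    proof -
      have iT: "integrable lebesgue (\<lambda>x. indicator ?T x :: real)"
        using T_fin by (intro integrable_real_indicator T)
      have iPf: "integrable lebesgue (\<lambda>x. indicator (- ball 0 R) x * (P x * f x))"
        by (intro int F(4)) auto
      have "(\<integral>x. indicator (- ball 0 R) x * \<bar>f x\<bar> \<partial>lebesgue)
          \<le> (\<integral>x. D * indicator ?T x + 1/t * (indicator (- ball 0 R) x * (P x * f x)) \<partial>lebesgue)"
      proof (rule integral_mono)
        show "integrable lebesgue (\<lambda>x. indicator (- ball 0 R) x * \<bar>f x\<bar>)"
          using F(2) by (intro int) auto
        show "integrable lebesgue (\<lambda>x. D * indicator ?T x + 1/t * (indicator (- ball 0 R) x * (P x * f x)))"
          by (intro Bochner_Integration.integrable_add integrable_mult_right iT iPf)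
        show "indicator (- ball 0 R) x * \<bar>f x\<bar> \<le> D * indicator ?T x + 1/t * (indicator (- ball 0 R) x * (P x * f x))" for x
        proof (cases "x \<in> ball 0 R")
          case False
          then have nonneg: "0 \<le> P x * f x" by (intro F(6)) (auto simp: R_def)
          show ?thesis
          proof (cases "x \<in> ?S")
            case True
            have "0 \<le> 1/t * (P x * f x)" using nonneg t by simp
            then show ?thesis using fD[of x] False True by simp
          next
            case notS: False
            have "\<bar>P x\<bar> * \<bar>f x\<bar> = P x * f x" using nonneg by (simp add: abs_mult[symmetric])
            moreover have "t * \<bar>f x\<bar> \<le> \<bar>P x\<bar> * \<bar>f x\<bar>" using notS by (intro mult_right_mono) auto
            ultimately show ?thesis using False notS t by (simp add: field_simps)
          qed
        qed auto
      qed
      also have "\<dots> = D * measure lebesgue ?T + 1/t * (\<integral>x. indicator (- ball 0 R) x * (P x * f x) \<partial>lebesgue)"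
        using iT iPf by simp
      also have "\<dots> \<le> \<delta> / 4 + 1/t * (t * \<delta> / 4)"
        using T_meas off_Pf t by (intro add_mono mult_left_mono) (auto simp: \<eta>_def)
      finally show ?thesis using t by simp
    qed
    have small: "\<bar>f x\<bar> \<le> \<delta>" if x: "norm x \<le> R0" for x
    proof -
      let ?u = "\<lambda>X y. complex_of_real (indicator X y * f y)"
      have i: "integrable lebesgue (?u X)" if "X \<in> sets lebesgue" for X
        using int[OF F(2) that] by (rule integrable_of_real)
      have "(\<lambda>y. complex_of_real (f y)) = (\<lambda>y. 1 * ?u (ball 0 R) y + 1 * ?u (- ball 0 R) y)"
        by (auto simp: fun_eq_iff split: split_indicator)
      then have split: "fourier (\<lambda>y. complex_of_real (f y)) x = fourier (?u (ball 0 R)) x + fourier (?u (- ball 0 R)) x"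
        using fourier_linear[OF i i, of "ball 0 R" "- ball 0 R" 1 1 x] by simp
      have eig: "\<bar>f x\<bar> = norm (fourier (\<lambda>y. complex_of_real (f y)) x)"
        unfolding F(3) using s by (auto simp: norm_mult norm_power)
      have off: "norm (fourier (?u (- ball 0 R)) x) \<le> \<delta> / 2"
      proof -
        have "norm (fourier (?u (- ball 0 R)) x) \<le> (\<integral>y. norm (?u (- ball 0 R) y) \<partial>lebesgue)"
          by (rule norm_fourier_le)
        also have "\<dots> = (\<integral>y. indicator (- ball 0 R) y * \<bar>f y\<bar> \<partial>lebesgue)"
          by (intro Bochner_Integration.integral_cong) (auto split: split_indicator)
        finally show ?thesis using off_f by simp
      qed
      have on: "norm (fourier (?u (ball 0 R)) x) \<le> \<delta> / 2"
        using small2[OF x] by (simp add: \<eta>_def)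
      have "\<bar>f x\<bar> \<le> norm (fourier (?u (ball 0 R)) x) + norm (fourier (?u (- ball 0 R)) x)"
        unfolding eig split by (rule norm_triangle_ineq)
      also have "\<dots> \<le> \<delta> / 2 + \<delta> / 2"
        using on off by (rule add_mono)
      finally show ?thesis by simp
    qed
    let ?J = "\<integral>\<^sup>+x\<in>cball 0 R0. ennreal \<bar>P x * f x\<bar> \<partial>lebesgue"
    have "(\<integral>\<^sup>+x. ennreal \<bar>P x * f x\<bar> \<partial>lebesgue) \<le> 2 * ?J"
      using F(4,5,6) by (intro nn_integral_abs_le_twice_negative_part) auto
    moreover have "(\<integral>\<^sup>+x. ennreal \<bar>P x * f x\<bar> \<partial>lebesgue) = 1"
      using F(4) one by (subst nn_integral_eq_integral) auto
    ultimately have "1 \<le> 2 * ?J" by simp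
    moreover have "?J \<le> (\<integral>\<^sup>+x. ennreal (\<delta> * \<bar>indicator (cball 0 R0) x * P x\<bar>) \<partial>lebesgue)"
    proof (rule nn_integral_mono)
      fix x :: 'a
      have "\<bar>P x * f x\<bar> \<le> \<delta> * \<bar>P x\<bar>" if "norm x \<le> R0"
        using mult_left_mono[OF small[OF that], of "\<bar>P x\<bar>"] by (simp add: abs_mult mult.commute)
      then show "ennreal \<bar>P x * f x\<bar> * indicator (cball 0 R0) x \<le> ennreal (\<delta> * \<bar>indicator (cball 0 R0) x * P x\<bar>)"
        by (auto split: split_indicator intro!: ennreal_leI)
    qed
    ultimately have "1 \<le> 2 * (\<integral>\<^sup>+x. ennreal (\<delta> * \<bar>indicator (cball 0 R0) x * P x\<bar>) \<partial>lebesgue)"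
      by (meson mult_left_mono order_trans zero_le)
    also have "(\<integral>\<^sup>+x. ennreal (\<delta> * \<bar>indicator (cball 0 R0) x * P x\<bar>) \<partial>lebesgue) = ennreal (\<delta> * I)"
      unfolding I_def using P0_int \<delta> by (subst nn_integral_eq_integral) auto
    also have "2 * ennreal (\<delta> * I) = ennreal (2 * (\<delta> * I))"
      by (simp add: ennreal_mult')
    finally have "1 \<le> 2 * (\<delta> * I)"
      using \<delta> I by simp
    moreover have "2 * (\<delta> * I) < 1" using I by (simp add: \<delta>_def field_simps)
    ultimately show False by simp
  qed
  moreover have "0 \<le> R" using R1(1) by (simp add: R_def)
  ultimately show ?thesis using \<eta> by blast
qed

lemma fourier_kernel_diff_le:
  "norm (fourier_kernel \<xi> x - fourier_kernel \<zeta> x) \<le> 2 * pi * norm x * norm (\<xi> - \<zeta>)"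
proof -
  define a b where "a = - (2 * pi * (x \<bullet> \<xi>))" and "b = - (2 * pi * (x \<bullet> \<zeta>))"
  have k: "fourier_kernel \<xi> x = exp (\<i> * of_real a)" "fourier_kernel \<zeta> x = exp (\<i> * of_real b)"
    by (simp_all add: a_def b_def mult_ac)
  have "exp (\<i> * of_real a) - exp (\<i> * of_real b) = exp (\<i> * of_real b) * (exp (\<i> * of_real (a - b)) - 1)"
  proof -
    have "\<i> * complex_of_real b + \<i> * of_real (a - b) = \<i> * of_real a"
      by (simp add: algebra_simps)
    then have "exp (\<i> * complex_of_real b) * exp (\<i> * of_real (a - b)) = exp (\<i> * of_real a)"
      by (simp only: exp_add[symmetric])
    then show ?thesis by (simp only: right_diff_distrib mult_1_right)
  qed
  then have "norm (exp (\<i> * of_real a) - exp (\<i> * of_real b)) = norm (exp (\<i> * of_real (a - b)) - 1)"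
    by (simp only: norm_mult norm_exp_i_times mult_1)
  also have "\<dots> = 2 * \<bar>sin ((a - b) / 2)\<bar>" by (rule dist_exp_i_1)
  also have "\<dots> \<le> \<bar>a - b\<bar>"
    using abs_sin_x_le_abs_x[of "(a - b) / 2"] by simp
  also have "a - b = - (2 * pi * (x \<bullet> (\<xi> - \<zeta>)))"
    by (simp add: a_def b_def inner_diff_right algebra_simps)
  also have "\<bar>- (2 * pi * (x \<bullet> (\<xi> - \<zeta>)))\<bar> = 2 * pi * \<bar>x \<bullet> (\<xi> - \<zeta>)\<bar>"
    by (simp add: abs_mult)
  also have "\<dots> \<le> 2 * pi * (norm x * norm (\<xi> - \<zeta>))"
    by (intro mult_left_mono Cauchy_Schwarz_ineq2) auto
  finally show ?thesis unfolding k by (simp add: mult_ac)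
qed

text \<open>The bound is uniform over functions with \<open>L\<^sup>1\<close> norm at most \<open>D\<close>. It allows moving the point at
which a truncated transform is evaluated to the limit of such points.\<close>

lemma fourier_ball_Lipschitz:
  fixes f :: "'a::euclidean_space \<Rightarrow> real"
  assumes f: "integrable lebesgue f" and D: "(\<integral>x. \<bar>f x\<bar> \<partial>lebesgue) \<le> D" and R: "0 \<le> R"
  shows "norm (fourier (\<lambda>y. complex_of_real (indicator (ball 0 R) y * f y)) \<xi>
             - fourier (\<lambda>y. complex_of_real (indicator (ball 0 R) y * f y)) \<zeta>)
       \<le> 2 * pi * R * D * norm (\<xi> - \<zeta>)"
proof -
  let ?u = "\<lambda>y. complex_of_real (indicator (ball 0 R) y * f y)"
  have "integrable lebesgue (\<lambda>y. indicator (ball 0 R) y * f y)"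
    using integrable_real_mult_indicator[OF _ f, of "ball 0 R"] by (simp add: mult.commute)
  then have u: "integrable lebesgue ?u" by (rule integrable_of_real)
  note i = integrable_fourier_kernel[OF u]
  have eq: "fourier ?u \<xi> - fourier ?u \<zeta> = (\<integral>y. fourier_kernel \<xi> y * ?u y - fourier_kernel \<zeta> y * ?u y \<partial>lebesgue)"
    unfolding fourier_def by (intro Bochner_Integration.integral_diff[symmetric] i)
  have "norm (fourier ?u \<xi> - fourier ?u \<zeta>)
      \<le> (\<integral>y. norm (fourier_kernel \<xi> y * ?u y - fourier_kernel \<zeta> y * ?u y) \<partial>lebesgue)"
    unfolding eq by (rule integral_norm_bound)
  also have "\<dots> \<le> (\<integral>y. (2 * pi * R * norm (\<xi> - \<zeta>)) * \<bar>f y\<bar> \<partial>lebesgue)"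
  proof (rule integral_mono)
    show "integrable lebesgue (\<lambda>y. norm (fourier_kernel \<xi> y * ?u y - fourier_kernel \<zeta> y * ?u y))"
      by (intro integrable_norm Bochner_Integration.integrable_diff i)
    show "integrable lebesgue (\<lambda>y. (2 * pi * R * norm (\<xi> - \<zeta>)) * \<bar>f y\<bar>)"
      by (intro integrable_mult_right integrable_abs f)
    show "norm (fourier_kernel \<xi> y * ?u y - fourier_kernel \<zeta> y * ?u y) \<le> (2 * pi * R * norm (\<xi> - \<zeta>)) * \<bar>f y\<bar>" for y
    proof (cases "y \<in> ball 0 R")
      case True
      have "norm (fourier_kernel \<xi> y - fourier_kernel \<zeta> y) \<le> 2 * pi * norm y * norm (\<xi> - \<zeta>)"
        by (rule fourier_kernel_diff_le)
      also have "\<dots> \<le> 2 * pi * R * norm (\<xi> - \<zeta>)"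
        using True by (intro mult_right_mono mult_left_mono) auto
      finally have "norm (fourier_kernel \<xi> y - fourier_kernel \<zeta> y) * \<bar>f y\<bar> \<le> 2 * pi * R * norm (\<xi> - \<zeta>) * \<bar>f y\<bar>"
        by (rule mult_right_mono) simp
      moreover have "norm (fourier_kernel \<xi> y * ?u y - fourier_kernel \<zeta> y * ?u y)
          = norm (fourier_kernel \<xi> y - fourier_kernel \<zeta> y) * \<bar>f y\<bar>"
        using True by (simp only: left_diff_distrib[symmetric] norm_mult norm_of_real) (simp add: indicator_def)
      ultimately show ?thesis by simp
    qed (use R in auto)
  qed
  also have "\<dots> = (2 * pi * R * norm (\<xi> - \<zeta>)) * (\<integral>y. \<bar>f y\<bar> \<partial>lebesgue)"
    by simp
  also have "\<dots> \<le> (2 * pi * R * norm (\<xi> - \<zeta>)) * D"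
    using R by (intro mult_left_mono D) auto
  finally show ?thesis by (simp add: mult_ac)
qed

text \<open>A normalized minimizing sequence fixes limit values \<open>v\<close> and \<open>m\<close>, not both zero, of the two
functionals that detect nonvanishing. The convex sets \<open>K n\<close> collect the competitors whose
functionals are close to these values and whose radii are close to the infimum \<open>A\<close>; a selection
from them converges almost everywhere to a competitor with functionals exactly \<open>v\<close> and \<open>m\<close>.\<close>

lemma sign_class_extremizer:
  fixes P :: "'a::euclidean_space \<Rightarrow> real"
  assumes P: "lp_loc 1 P" and q: "1 \<le> q" and adm: "0 < C" "admissibility_inequality r P q C"
    and t: "0 < t" "emeasure lebesgue {x. \<bar>P x\<bar> \<le> t} < \<infinity>"
    and dens: "\<And>x. x \<noteq> 0 \<Longrightarrow> P x \<noteq> 0 \<Longrightarrow>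
         0 < Liminf (at_right 0) (\<lambda>\<epsilon>. emeasure lebesgue ({y. P y * P x > 0} \<inter> ball x \<epsilon>)
                                      / emeasure lebesgue (ball x \<epsilon>))"
    and s: "s \<in> {1, -1}" and ne: "sign_class r s P \<noteq> {}"
  shows "\<exists>f\<in>sign_class r s P. sign_radius (\<lambda>x. P x * f x) = sign_const r s P"
proof -
  have P_meas[measurable]: "P \<in> borel_measurable lebesgue"
    using P by (simp add: lp_loc_def)
  define A where "A = sign_const r s P"
  have A: "0 \<le> A"
    unfolding A_def by (rule sign_const_greatest[OF ne]) simp
  obtain D where D: "0 \<le> D"
    "\<And>\<rho> f. f \<in> sign_cone r s P \<rho> \<Longrightarrow> (\<integral>x. \<bar>f x\<bar> \<partial>lebesgue) \<le> D * (\<integral>x. \<bar>P x * f x\<bar> \<partial>lebesgue)"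
    using sign_cone_L1_bound[OF P_meas q adm t] s by blast
  define \<rho> where "\<rho> n = A + 1 / real (Suc n)" for n
  have \<rho>: "A < \<rho> n" "\<rho> n \<le> A + 1" "\<rho> (Suc n) \<le> \<rho> n" for n
    by (auto simp: \<rho>_def field_simps)
  have \<rho>_lim: "\<rho> \<longlonglongrightarrow> A"
    unfolding \<rho>_def using tendsto_add[OF tendsto_const[of A] LIMSEQ_inverse_real_of_nat] by (simp add: inverse_eq_divide)
  obtain R \<eta> where R: "0 \<le> R" and \<eta>: "0 < \<eta>" and
    lower: "\<And>f. f \<in> sign_cone r s P (A + 1) \<Longrightarrow> (\<integral>x. \<bar>P x * f x\<bar> \<partial>lebesgue) = 1 \<Longrightarrow>
      (\<integral>x. \<bar>f x\<bar> \<partial>lebesgue) \<le> D \<Longrightarrow>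
      (\<integral>x. indicator (ball 0 R) x * (P x * f x) \<partial>lebesgue) \<le> - \<eta> \<or>
      (\<exists>x\<in>cball 0 (A + 1). \<eta> \<le> norm (fourier (\<lambda>y. complex_of_real (indicator (ball 0 R) y * f y)) x))"
    using normalized_functional_lower_bound[OF P s t D(1), of r "A + 1"] by blast
  define \<Lambda> where "\<Lambda> x f = fourier (\<lambda>y. complex_of_real (indicator (ball 0 R) y * f y)) x" for x :: 'a and f
  define \<mu> where "\<mu> f = (\<integral>x. indicator (ball 0 R) x * (P x * f x) \<partial>lebesgue)" for f
  have int: "integrable lebesgue (\<lambda>x. indicator (ball 0 R) x * k x)"
    if "integrable lebesgue k" for k :: "'a \<Rightarrow> real"
    using integrable_real_mult_indicator[OF _ that, of "ball 0 R"] by (simp add: mult.commute)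
  have int_le: "(\<integral>x. \<bar>indicator (ball 0 R) x * k x\<bar> \<partial>lebesgue) \<le> (\<integral>x. \<bar>k x\<bar> \<partial>lebesgue)"
    if "integrable lebesgue k" for k :: "'a \<Rightarrow> real"
    using that int[OF that] by (intro integral_mono integrable_abs) (auto split: split_indicator)

  have "\<exists>f. f \<in> sign_cone r s P (\<rho> n) \<and> (\<integral>x. \<bar>P x * f x\<bar> \<partial>lebesgue) = 1" for n
  proof -
    have "\<exists>f\<in>sign_class r s P. sign_radius (\<lambda>x. P x * f x) < \<rho> n"
    proof (rule ccontr)
      assume "\<not> ?thesis"
      then have "\<rho> n \<le> A"
        unfolding A_def sign_const_def using ne by (intro cINF_greatest) (auto simp: not_less)
      then show False using \<rho>(1)[of n] by simp
    qed
    then obtain f where f: "f \<in> sign_class r s P" "sign_radius (\<lambda>x. P x * f x) < \<rho> n" by blast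
    then obtain r' where "r' < \<rho> n" "\<forall>x. r' \<le> norm x \<longrightarrow> 0 \<le> P x * f x"
      using sign_class_radius_set[OF f(1)] unfolding sign_radius_def
      by (subst (asm) cInf_less_iff) (auto intro: bdd_belowI[where m=0])
    then have cone: "f \<in> sign_cone r s P (\<rho> n)"
      by (intro sign_class_imp_sign_cone[OF f(1)]) auto
    note F = sign_coneD[OF cone]
    let ?J = "\<integral>x. \<bar>P x * f x\<bar> \<partial>lebesgue"
    have "0 < (\<integral>\<^sup>+x. ennreal \<bar>P x * f x\<bar> \<partial>lebesgue)"
      by (rule sign_class_nn_integral_pos[OF f(1) s q adm(2)])
    also have "\<dots> = ennreal ?J"
      using F(4) by (intro nn_integral_eq_integral) auto
    finally have J: "0 < ?J" by simp
    have "(\<lambda>x. 1 / ?J * f x + 0 * f x) \<in> sign_cone r s P (\<rho> n)"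
      using J by (intro sign_cone_combination cone) auto
    moreover have "(\<integral>x. \<bar>P x * (1 / ?J * f x + 0 * f x)\<bar> \<partial>lebesgue) = (\<integral>x. 1 / ?J * \<bar>P x * f x\<bar> \<partial>lebesgue)"
      using J by (intro Bochner_Integration.integral_cong refl) (simp add: abs_mult)
    then have "(\<integral>x. \<bar>P x * (1 / ?J * f x + 0 * f x)\<bar> \<partial>lebesgue) = 1"
      using J by simp
    ultimately show ?thesis by blast
  qed
  then obtain f where f: "\<And>n. f n \<in> sign_cone r s P (\<rho> n)" "\<And>n. (\<integral>x. \<bar>P x * f n x\<bar> \<partial>lebesgue) = 1"
    by metis
  note F = sign_coneD[OF f(1)]
  have fL1: "(\<integral>x. \<bar>f n x\<bar> \<partial>lebesgue) \<le> D" for n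
    using D(2)[OF f(1)[of n]] f(2)[of n] by simp
  have "\<exists>x\<in>cball 0 (A + 1). \<mu> (f n) \<le> - \<eta> \<or> \<eta> \<le> norm (\<Lambda> x (f n))" for n
  proof -
    have "f n \<in> sign_cone r s P (A + 1)"
      using f(1)[of n] sign_cone_mono[OF \<rho>(2)[of n]] by blast
    from lower[OF this f(2) fL1] show ?thesis
      using A unfolding \<mu>_def \<Lambda>_def by (auto intro: bexI[of _ 0])
  qed
  then obtain x where x: "\<And>n. x n \<in> cball 0 (A + 1)" "\<And>n. \<mu> (f n) \<le> - \<eta> \<or> \<eta> \<le> norm (\<Lambda> (x n) (f n))"
    by metis
  \<comment> \<open>The alternative is a closed condition, so it survives in the limit of a subsequence.\<close>
  let ?T = "(cball 0 (A + 1) \<times> cball 0 D \<times> cball 0 1) \<inter> {z::'a \<times> complex \<times> real. snd (snd z) \<le> - \<eta> \<or> \<eta> \<le> norm (fst (snd z))}"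
  have cpt: "compact ?T"
    by (intro compact_Int_closed compact_Times compact_cball closed_Collect_disj closed_Collect_le continuous_intros)
  have mem: "(x n, \<Lambda> (x n) (f n), \<mu> (f n)) \<in> ?T" for n
  proof -
    have "norm (\<Lambda> (x n) (f n)) \<le> (\<integral>y. norm (complex_of_real (indicator (ball 0 R) y * f n y)) \<partial>lebesgue)"
      unfolding \<Lambda>_def by (rule norm_fourier_le)
    also have "\<dots> = (\<integral>y. \<bar>indicator (ball 0 R) y * f n y\<bar> \<partial>lebesgue)"
      by (simp only: norm_of_real)
    also have "\<dots> \<le> D"
      using int_le[OF F(2)[of n]] fL1[of n] by (rule order_trans)
    finally have 1: "norm (\<Lambda> (x n) (f n)) \<le> D" .
    have "norm (\<mu> (f n)) \<le> (\<integral>y. norm (indicator (ball 0 R) y * (P y * f n y)) \<partial>lebesgue)"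
      unfolding \<mu>_def by (rule integral_norm_bound)
    also have "\<dots> \<le> 1"
      using int_le[OF F(4)[of n]] f(2)[of n] by simp
    finally show ?thesis using 1 x[of n] by auto
  qed
  obtain z \<phi> where z: "z \<in> ?T" "strict_mono \<phi>"
    "((\<lambda>n. (x n, \<Lambda> (x n) (f n), \<mu> (f n))) \<circ> \<phi>) \<longlonglongrightarrow> z"
    by (rule seq_compactE[OF compact_imp_seq_compact[OF cpt], of "\<lambda>n. (x n, \<Lambda> (x n) (f n), \<mu> (f n))"])
       (use mem in blast)+
  obtain x0 v m where zz: "z = (x0, v, m)" by (cases z)
  have vm: "m \<le> - \<eta> \<or> \<eta> \<le> norm v" using z(1) by (simp add: zz)
  have lim_x: "(\<lambda>n. x (\<phi> n)) \<longlonglongrightarrow> x0"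
    and lim_v: "(\<lambda>n. \<Lambda> (x (\<phi> n)) (f (\<phi> n))) \<longlonglongrightarrow> v"
    and lim_m: "(\<lambda>n. \<mu> (f (\<phi> n))) \<longlonglongrightarrow> m"
    using tendsto_fst[OF z(3)] tendsto_fst[OF tendsto_snd[OF z(3)]] tendsto_snd[OF tendsto_snd[OF z(3)]]
    by (simp_all add: zz comp_def)
  have "(\<lambda>n. \<Lambda> x0 (f (\<phi> n)) - \<Lambda> (x (\<phi> n)) (f (\<phi> n))) \<longlonglongrightarrow> 0"
  proof (rule Lim_null_comparison)
    show "eventually (\<lambda>n. norm (\<Lambda> x0 (f (\<phi> n)) - \<Lambda> (x (\<phi> n)) (f (\<phi> n)))
        \<le> 2 * pi * R * D * norm (x0 - x (\<phi> n))) sequentially"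
      unfolding \<Lambda>_def by (intro always_eventually allI fourier_ball_Lipschitz F(2) fL1 R)
    have "(\<lambda>n. 2 * pi * R * D * norm (x0 - x (\<phi> n))) \<longlonglongrightarrow> 2 * pi * R * D * norm (x0 - x0)"
      by (intro tendsto_mult tendsto_const tendsto_norm tendsto_diff lim_x)
    then show "(\<lambda>n. 2 * pi * R * D * norm (x0 - x (\<phi> n))) \<longlonglongrightarrow> 0" by simp
  qed
  from tendsto_add[OF this lim_v] have lim_v0: "(\<lambda>n. \<Lambda> x0 (f (\<phi> n))) \<longlonglongrightarrow> v" by simp

  \<comment> \<open>Every condition is convex, and \<open>\<bar>P g\<bar>\<^sub>1 \<le> 1\<close> replaces the normalization, which is not.\<close>
  define K where "K n = {g. g \<in> sign_cone r s P (\<rho> n) \<and> (\<integral>x. \<bar>P x * g x\<bar> \<partial>lebesgue) \<le> 1 \<and>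
      (\<integral>x. \<bar>g x\<bar> \<partial>lebesgue) \<le> D \<and> norm (\<Lambda> x0 g - v) \<le> 1 / real (Suc n) \<and> \<bar>\<mu> g - m\<bar> \<le> 1 / real (Suc n)}" for n
  have K_ne: "K n \<noteq> {}" for n
  proof -
    have pos: "0 < 1 / real (Suc n)" by simp
    have "eventually (\<lambda>k. dist (\<Lambda> x0 (f (\<phi> k))) v < 1 / real (Suc n)) sequentially"
      "eventually (\<lambda>k. dist (\<mu> (f (\<phi> k))) m < 1 / real (Suc n)) sequentially"
      "eventually (\<lambda>k. n \<le> k) sequentially"
      using tendstoD[OF lim_v0 pos] tendstoD[OF lim_m pos] eventually_ge_at_top by auto
    then have "eventually (\<lambda>k. f (\<phi> k) \<in> K n) sequentially"
    proof eventually_elim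
      case (elim k)
      have "n \<le> \<phi> k" using elim(3) seq_suble[OF z(2), of k] by simp
      then have "\<rho> (\<phi> k) \<le> \<rho> n" by (simp add: \<rho>_def field_simps)
      then have "f (\<phi> k) \<in> sign_cone r s P (\<rho> n)"
        using f(1)[of "\<phi> k"] sign_cone_mono by blast
      then show ?case
        using elim f(2)[of "\<phi> k"] fL1[of "\<phi> k"] by (simp add: K_def dist_norm less_imp_le)
    qed
    then show ?thesis by (auto simp: eventually_sequentially)
  qed
  have K_dec: "K (Suc n) \<subseteq> K n" for n
  proof -
    have "1 / real (Suc (Suc n)) \<le> 1 / real (Suc n)" by (simp add: field_simps)
    then show ?thesis
      using sign_cone_mono[OF \<rho>(3)[of n], of r s P] by (force simp: K_def)
  qed
  have K_bound: "\<bar>g y\<bar> \<le> D" if "g \<in> K n" for g n y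
    using that sign_cone_abs_le[OF _ s, of g r P "\<rho> n" y] by (auto simp: K_def intro: order_trans)
  have K_sq: "integrable lborel (\<lambda>y. (g y)\<^sup>2) \<and> (\<integral>y. (g y)\<^sup>2 \<partial>lborel) \<le> D * D" if g: "g \<in> K 0" for g
  proof -
    have cone: "g \<in> sign_cone r s P (\<rho> 0)" and L1: "(\<integral>x. \<bar>g x\<bar> \<partial>lebesgue) \<le> D"
      using g by (auto simp: K_def)
    note G = sign_coneD[OF cone]
    have [measurable]: "g \<in> borel_measurable borel" by (rule G(7))
    have le: "(g y)\<^sup>2 \<le> D * \<bar>g y\<bar>" for y
      using mult_right_mono[OF K_bound[OF g, of y], of "\<bar>g y\<bar>"] by (simp add: power2_eq_square abs_mult_self_eq)
    have gi: "integrable lborel (\<lambda>y. D * \<bar>g y\<bar>)"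
      using G(2) by (simp add: integrable_completion)
    have i: "integrable lborel (\<lambda>y. (g y)\<^sup>2)"
      using le D(1) by (intro Bochner_Integration.integrable_bound[OF gi] always_eventually allI) (auto simp: abs_mult)
    have "(\<integral>y. (g y)\<^sup>2 \<partial>lborel) \<le> (\<integral>y. D * \<bar>g y\<bar> \<partial>lborel)"
      using i gi le by (intro integral_mono)
    also have "\<dots> = D * (\<integral>y. \<bar>g y\<bar> \<partial>lebesgue)"
      by (simp add: integral_completion)
    also have "\<dots> \<le> D * D"
      using L1 D(1) by (rule mult_left_mono)
    finally show ?thesis using i by simp
  qed
  have K_mid: "(\<lambda>y. (g y + h y) / 2) \<in> K n" if g: "g \<in> K n" and h: "h \<in> K n" for g h n
  proof -
    have gc: "g \<in> sign_cone r s P (\<rho> n)" and hc: "h \<in> sign_cone r s P (\<rho> n)"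
      using g h by (auto simp: K_def)
    note G = sign_coneD[OF gc] and H = sign_coneD[OF hc]
    have mid: "(\<lambda>y. (g y + h y) / 2) = (\<lambda>y. 1/2 * g y + 1/2 * h y)"
      by (simp add: fun_eq_iff field_simps)
    have cone: "(\<lambda>y. (g y + h y) / 2) \<in> sign_cone r s P (\<rho> n)"
      unfolding mid by (intro sign_cone_combination gc hc) auto
    note M = sign_coneD[OF cone]
    have half: "(\<integral>y. \<bar>(k y + l y) / 2\<bar> \<partial>lebesgue) \<le> c"
      if "integrable lebesgue k" "integrable lebesgue l" "(\<integral>y. \<bar>k y\<bar> \<partial>lebesgue) \<le> c" "(\<integral>y. \<bar>l y\<bar> \<partial>lebesgue) \<le> c"
      for k l :: "'a \<Rightarrow> real" and c
    proof -
      have "(\<integral>y. \<bar>(k y + l y) / 2\<bar> \<partial>lebesgue) \<le> (\<integral>y. 1/2 * \<bar>k y\<bar> + 1/2 * \<bar>l y\<bar> \<partial>lebesgue)"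
        using that by (intro integral_mono) auto
      also have "\<dots> = 1/2 * (\<integral>y. \<bar>k y\<bar> \<partial>lebesgue) + 1/2 * (\<integral>y. \<bar>l y\<bar> \<partial>lebesgue)"
        using that by simp
      finally show ?thesis using that by simp
    qed
    have a: "(\<integral>y. \<bar>P y * ((g y + h y) / 2)\<bar> \<partial>lebesgue) \<le> 1"
      using half[OF G(4) H(4), of 1] g h by (simp add: K_def distrib_left)
    have b: "(\<integral>y. \<bar>(g y + h y) / 2\<bar> \<partial>lebesgue) \<le> D"
      using half[OF G(2) H(2), of D] g h by (simp add: K_def)
    have \<Lambda>_mid: "\<Lambda> x0 (\<lambda>y. (g y + h y) / 2) - v = ((\<Lambda> x0 g - v) + (\<Lambda> x0 h - v)) / 2"
    proof -
      have "\<Lambda> x0 (\<lambda>y. (g y + h y) / 2) = 1/2 * \<Lambda> x0 g + 1/2 * \<Lambda> x0 h"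
        unfolding \<Lambda>_def
        using fourier_linear[OF integrable_of_real[OF int[OF G(2)]] integrable_of_real[OF int[OF H(2)]], of "1/2" "1/2" x0]
        by (simp add: algebra_simps add_divide_distrib)
      then show ?thesis by (simp add: field_simps)
    qed
    have c: "norm (\<Lambda> x0 (\<lambda>y. (g y + h y) / 2) - v) \<le> 1 / real (Suc n)"
    proof -
      have "norm (\<Lambda> x0 (\<lambda>y. (g y + h y) / 2) - v) = norm ((\<Lambda> x0 g - v) + (\<Lambda> x0 h - v)) / 2"
        unfolding \<Lambda>_mid by (simp add: norm_divide)
      also have "\<dots> \<le> (norm (\<Lambda> x0 g - v) + norm (\<Lambda> x0 h - v)) / 2"
        by (intro divide_right_mono norm_triangle_ineq) simp
      also have "\<dots> \<le> (1 / real (Suc n) + 1 / real (Suc n)) / 2"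
        using g h unfolding K_def by (intro divide_right_mono add_mono) auto
      also have "\<dots> = 1 / real (Suc n)"
        by (rule field_sum_of_halves[unfolded add_divide_distrib[symmetric]])
      finally show ?thesis .
    qed
    have \<mu>_mid: "\<mu> (\<lambda>y. (g y + h y) / 2) = (\<mu> g + \<mu> h) / 2"
    proof -
      have "\<mu> (\<lambda>y. (g y + h y) / 2)
          = (\<integral>y. 1/2 * (indicator (ball 0 R) y * (P y * g y)) + 1/2 * (indicator (ball 0 R) y * (P y * h y)) \<partial>lebesgue)"
      proof -
        have "i * (p * ((a + b) / 2)) = 1/2 * (i * (p * a)) + 1/2 * (i * (p * b))" for i p a b :: real
          by (simp add: algebra_simps add_divide_distrib)
        then show ?thesis unfolding \<mu>_def by (intro Bochner_Integration.integral_cong refl)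
      qed
      also have "\<dots> = 1/2 * \<mu> g + 1/2 * \<mu> h"
        unfolding \<mu>_def using int[OF G(4)] int[OF H(4)] by simp
      finally show ?thesis by simp
    qed
    have d: "\<bar>\<mu> (\<lambda>y. (g y + h y) / 2) - m\<bar> \<le> 1 / real (Suc n)"
    proof -
      have avg: "\<bar>(a + b) / 2 - m\<bar> \<le> e" if "\<bar>a - m\<bar> \<le> e" "\<bar>b - m\<bar> \<le> e" for a b e :: real
        using that unfolding abs_le_iff by argo
      show ?thesis
        unfolding \<mu>_mid by (rule avg) (use g h in \<open>auto simp: K_def\<close>)
    qed
    show ?thesis
      unfolding K_def using cone a b c d by blast
  qed
  have "\<exists>g. (\<forall>n. g n \<in> K n) \<and> (AE y in lborel. convergent (\<lambda>n. g n y))"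
  proof (rule decreasing_convex_L2_AE_convergent[where K = K and B = "D * D"])
    show "K n \<noteq> {}" "K (Suc n) \<subseteq> K n" for n
      by (rule K_ne K_dec)+
    show "g \<in> borel_measurable lborel" if "g \<in> K 0" for g
    proof -
      have "g \<in> sign_cone r s P (\<rho> 0)" using that by (simp add: K_def)
      then show ?thesis using sign_coneD(7) by simp
    qed
    show "integrable lborel (\<lambda>y. (g y)\<^sup>2)" "(\<integral>y. (g y)\<^sup>2 \<partial>lborel) \<le> D * D" if "g \<in> K 0" for g
      using K_sq[OF that] by simp_all
    show "(\<lambda>y. (g y + h y) / 2) \<in> K n" if "g \<in> K n" "h \<in> K n" for g h n
      by (rule K_mid[OF that])
  qed
  then obtain g where g: "\<And>n. g n \<in> K n" and conv: "AE y in lborel. convergent (\<lambda>n. g n y)"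
    by blast
  have gc: "g n \<in> sign_cone r s P (\<rho> n)" and gP: "(\<integral>x. \<bar>P x * g n x\<bar> \<partial>lebesgue) \<le> 1"
    and gL1: "(\<integral>x. \<bar>g n x\<bar> \<partial>lebesgue) \<le> D"
    and g\<Lambda>: "norm (\<Lambda> x0 (g n) - v) \<le> 1 / real (Suc n)" and g\<mu>: "norm (\<mu> (g n) - m) \<le> 1 / real (Suc n)" for n
    using g[of n] by (auto simp: K_def)
  obtain f0 where lim: "AE y in lebesgue. (\<lambda>n. g n y) \<longlonglongrightarrow> f0 y"
    and f0: "\<And>\<rho>. A < \<rho> \<Longrightarrow> f0 \<in> sign_cone r s P \<rho>"
    using sign_cone_limit[OF P s A dens gc \<rho>_lim \<rho>(2) gL1 gP conv] by blast
  have gm: "g n \<in> borel_measurable lebesgue" and f0m: "f0 \<in> borel_measurable lebesgue" for n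
    using sign_coneD(2)[OF gc] sign_coneD(2)[OF f0[OF \<rho>(1)[of 0]]] by auto
  note gD = K_bound[OF g]
  have inv0: "(\<lambda>n. 1 / real (Suc n)) \<longlonglongrightarrow> 0"
    using LIMSEQ_inverse_real_of_nat by (simp add: inverse_eq_divide)
  have v_eq: "\<Lambda> x0 f0 = v"
  proof -
    have "integrable lebesgue (\<lambda>y. indicator (ball (0::'a) R) y :: real)"
      by (intro integrable_real_indicator) (auto simp: emeasure_ball[OF R])
    from integrable_fourier_kernel[OF integrable_of_real[OF this]]
    have k: "integrable lebesgue (\<lambda>y. fourier_kernel x0 y * complex_of_real (indicator (ball 0 R) y))" .
    have "(\<lambda>n. \<Lambda> x0 (g n)) \<longlonglongrightarrow> \<Lambda> x0 f0"
      unfolding \<Lambda>_def fourier_def of_real_mult mult.assoc[symmetric]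
      by (rule bounded_AE_limit_integral[OF k gm f0m lim gD])
    moreover have "(\<lambda>n. \<Lambda> x0 (g n) - v) \<longlonglongrightarrow> 0"
      by (intro Lim_null_comparison[OF _ inv0] always_eventually allI g\<Lambda>)
    then have "(\<lambda>n. \<Lambda> x0 (g n)) \<longlonglongrightarrow> v" by (simp add: LIM_zero_iff)
    ultimately show ?thesis by (rule LIMSEQ_unique)
  qed
  have m_eq: "\<mu> f0 = m"
  proof -
    have "(\<lambda>n. \<mu> (g n)) \<longlonglongrightarrow> \<mu> f0"
      using bounded_AE_limit_integral[OF lp_loc_1_imp_integrable_ball(2)[OF P, of R] gm f0m lim gD]
      by (simp only: \<mu>_def mult.assoc of_real_eq_id id_apply)
    moreover have "(\<lambda>n. \<mu> (g n) - m) \<longlonglongrightarrow> 0"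
      by (intro Lim_null_comparison[OF _ inv0] always_eventually allI g\<mu>)
    then have "(\<lambda>n. \<mu> (g n)) \<longlonglongrightarrow> m" by (simp add: LIM_zero_iff)
    ultimately show ?thesis by (rule LIMSEQ_unique)
  qed
  have "f0 \<noteq> (\<lambda>x. 0)"
  proof
    assume "f0 = (\<lambda>x. 0)"
    then have "v = 0" "m = 0"
      using v_eq m_eq by (auto simp: \<Lambda>_def \<mu>_def fourier_def)
    then show False using vm \<eta> by simp
  qed
  then have cls: "f0 \<in> sign_class r s P"
    using f0[OF \<rho>(1)[of 0]] by (rule sign_cone_imp_sign_class[rotated])
  have "sign_radius (\<lambda>x. P x * f0 x) \<le> A"
  proof (rule field_le_epsilon)
    fix e :: real assume "0 < e"
    then show "sign_radius (\<lambda>x. P x * f0 x) \<le> A + e"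
      using A sign_coneD(6)[OF f0[of "A + e"]] by (intro sign_radius_le) auto
  qed
  then show ?thesis
    using cls sign_const_le_sign_radius[OF cls] A_def by (intro bexI[of _ f0]) auto
qed

section \<open>The sign uncertainty theorem\<close>

text \<open>For \<open>q > 1\<close> the conjugate exponent is finite, and the finite measure with density
\<open>\<bar>P\<bar>\<^sup>p\<close> on the unit ball gives the balls around the origin a mass that decreases to that of a
single point, which is \<open>0\<close>.\<close>

lemma small_lp_norm_near_origin:
  fixes P :: "'a::euclidean_space \<Rightarrow> real"
  assumes q: "1 \<le> q" and C: "0 < C"
    and loc: "1 < q \<Longrightarrow> lp_loc (conj_exponent q) P"
    and lim: "q = 1 \<Longrightarrow> ((\<lambda>\<rho>. lp_norm (lebesgue_on (ball 0 \<rho>)) \<infinity> P) \<longlongrightarrow> 0) (at_right 0)"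
  shows "\<exists>\<rho>0>0. \<forall>\<rho>. 0 < \<rho> \<and> \<rho> < \<rho>0 \<longrightarrow>
    ennreal (2 * C) * lp_norm (lebesgue_on (ball 0 \<rho>)) (conj_exponent q) P < 1"
proof (cases "q = 1")
  case True
  have "eventually (\<lambda>\<rho>. lp_norm (lebesgue_on (ball 0 \<rho>)) \<infinity> P < ennreal (1 / (2 * C))) (at_right 0)"
    using C by (intro order_tendstoD(2)[OF lim[OF True]]) simp
  then obtain b where b: "0 < b" "\<And>\<rho>. 0 < \<rho> \<Longrightarrow> \<rho> < b \<Longrightarrow>
      lp_norm (lebesgue_on (ball 0 \<rho>)) \<infinity> P < ennreal (1 / (2 * C))"
    unfolding eventually_at_right_field by auto
  have "ennreal (2 * C) * lp_norm (lebesgue_on (ball 0 \<rho>)) (conj_exponent q) P < 1" if "0 < \<rho>" "\<rho> < b" for \<rho>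
  proof -
    have "ennreal (2 * C) * lp_norm (lebesgue_on (ball 0 \<rho>)) (conj_exponent q) P
        < ennreal (2 * C) * ennreal (1 / (2 * C))"
      unfolding True conj_exponent_1 using C b(2)[OF that] by (intro ennreal_mult_strict_left_mono) auto
    also have "\<dots> = 1" using C by (simp flip: ennreal_mult')
    finally show ?thesis .
  qed
  then show ?thesis using b(1) by blast
next
  case False
  then have "1 < q" using q by simp
  define p where "p = enn2real (conj_exponent q)"
  have p: "conj_exponent q < \<infinity>" "1 \<le> p"
    using conj_exponent_less_infinity[OF \<open>1 < q\<close>] by (auto simp: p_def)
  have P[measurable]: "P \<in> borel_measurable lebesgue"
    using loc[OF \<open>1 < q\<close>] by (simp add: lp_loc_def)
  define J where "J X = (\<integral>\<^sup>+x\<in>X. ennreal (\<bar>P x\<bar> powr p) \<partial>lebesgue)" for X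
  have restr: "(\<integral>\<^sup>+x. ennreal (norm (P x) powr p) \<partial>lebesgue_on X) = J X" if "X \<in> sets lebesgue" for X
    unfolding J_def using that by (subst nn_integral_restrict_space) auto
  have mono: "J X \<le> J Y" if "X \<subseteq> Y" for X Y
    unfolding J_def using that by (intro nn_integral_mono) (auto split: split_indicator)
  have "lp_norm (lebesgue_on (cball 0 1)) (conj_exponent q) P < \<infinity>"
    using loc[OF \<open>1 < q\<close>] by (auto simp: lp_loc_def)
  then have fin1: "J (cball 0 1) < \<infinity>"
    using p restr[of "cball 0 1"] by (auto simp: lp_norm_def Let_def p_def less_top split: if_splits)
  define \<nu> where "\<nu> = density lebesgue (\<lambda>x. ennreal (\<bar>P x\<bar> powr p))"
  have \<nu>: "emeasure \<nu> X = J X" if "X \<in> sets lebesgue" for X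
    unfolding \<nu>_def J_def using that by (subst emeasure_density) auto
  have "(\<lambda>n. emeasure \<nu> (cball 0 (1 / real (Suc n)))) \<longlonglongrightarrow> emeasure \<nu> (\<Inter>n. cball 0 (1 / real (Suc n)))"
  proof (rule Lim_emeasure_decseq)
    show "range (\<lambda>n. cball 0 (1 / real (Suc n))) \<subseteq> sets \<nu>"
      by (auto simp: \<nu>_def)
    show "decseq (\<lambda>n. cball (0::'a) (1 / real (Suc n)))"
      by (intro decseq_SucI subset_cball) (simp add: field_simps)
    show "emeasure \<nu> (cball 0 (1 / real (Suc n))) \<noteq> \<infinity>" for n
    proof -
      have "emeasure \<nu> (cball 0 (1 / real (Suc n))) \<le> J (cball 0 1)"
        by (subst \<nu>) (auto intro!: mono subset_cball)
      also note fin1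
      finally show ?thesis by simp
    qed
  qed
  also have "(\<Inter>n. cball (0::'a) (1 / real (Suc n))) = {0}"
  proof -
    have "x = 0" if x: "\<And>n. norm x \<le> 1 / real (Suc n)" for x :: 'a
    proof (rule ccontr)
      assume "x \<noteq> 0"
      then obtain n where "1 / real (Suc n) < norm x"
        using nat_approx_posE[of "norm x"] by auto
      then show False using x[of n] by simp
    qed
    then show ?thesis by auto
  qed
  also have "emeasure \<nu> {0} = 0"
  proof -
    have [measurable]: "{0::'a} \<in> sets lebesgue" by simp
    have [measurable]: "{0::'a} \<in> sets lebesgue" by simp
    have [measurable]: "{0::'a} \<in> sets lebesgue" by simp
    have "AE x in lebesgue. x \<noteq> (0::'a)"
      by (rule AE_completion[OF AE_lborel_singleton])
    then have "J {0} = 0"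
      unfolding J_def by (subst nn_integral_0_iff_AE) (auto elim!: eventually_mono)
    then show ?thesis by (subst \<nu>) auto
  qed
  finally have lim0: "(\<lambda>n. emeasure \<nu> (cball 0 (1 / real (Suc n)))) \<longlonglongrightarrow> 0" .
  \<comment> \<open>The factor \<open>1/2\<close> makes the final inequality strict.\<close>
  define e where "e = (1 / (2 * C)) powr p / 2"
  have e: "0 < e" using C by (simp add: e_def)
  have "eventually (\<lambda>n. emeasure \<nu> (cball 0 (1 / real (Suc n))) < ennreal e) sequentially"
    using e by (intro order_tendstoD(2)[OF lim0]) simp
  then obtain n where n: "emeasure \<nu> (cball 0 (1 / real (Suc n))) < ennreal e"
    by (auto simp: eventually_sequentially)
  have "ennreal (2 * C) * lp_norm (lebesgue_on (ball 0 \<rho>)) (conj_exponent q) P < 1"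
    if \<rho>: "0 < \<rho>" "\<rho> < 1 / real (Suc n)" for \<rho>
  proof -
    have "J (ball 0 \<rho>) \<le> J (cball 0 (1 / real (Suc n)))"
      using \<rho> by (intro mono) auto
    also have "\<dots> \<le> ennreal e" using n by (subst (asm) \<nu>) (auto simp: less_imp_le)
    finally have J: "J (ball 0 \<rho>) \<le> ennreal e" .
    then have Jfin: "J (ball 0 \<rho>) < \<infinity>" by (rule le_less_trans) simp
    have "lp_norm (lebesgue_on (ball 0 \<rho>)) (conj_exponent q) P = ennreal (enn2real (J (ball 0 \<rho>)) powr (1/p))"
      using p Jfin restr[of "ball 0 \<rho>"] by (subst lp_norm_finite_exponent) (auto simp: p_def)
    then have "ennreal (2 * C) * lp_norm (lebesgue_on (ball 0 \<rho>)) (conj_exponent q) P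
        = ennreal (2 * C * enn2real (J (ball 0 \<rho>)) powr (1/p))"
      using C by (simp add: ennreal_mult)
    also have "\<dots> < ennreal 1"
    proof (rule ennreal_lessI)
      have "enn2real (J (ball 0 \<rho>)) \<le> e" using enn2real_mono[OF J] e by simp
      then have "enn2real (J (ball 0 \<rho>)) powr (1/p) \<le> e powr (1/p)"
        using p by (intro powr_mono2) auto
      also have "\<dots> < ((1 / (2 * C)) powr p) powr (1/p)"
        using p C by (intro powr_less_mono2) (auto simp: e_def)
      also have "\<dots> = 1 / (2 * C)" using p C by (simp add: powr_powr)
      finally show "2 * C * enn2real (J (ball 0 \<rho>)) powr (1/p) < 1"
        using C by (simp add: field_simps)
    qed simp
    finally show ?thesis by simp
  qed
  then show ?thesis by (intro exI[of _ "1 / real (Suc n)"]) auto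
qed

theorem theorem3:
  fixes P :: "'a::euclidean_space \<Rightarrow> real" and r :: nat and q :: ennreal
  assumes "P \<in> borel_measurable lebesgue"
    and "\<exists>x. x \<noteq> 0 \<and> P x \<noteq> 0"
    and "lp_loc 1 P"
    and "r \<in> {0, 1}" and "has_parity r P"
    and "1 \<le> q" and "admissible r P q"
  shows
    "(\<exists>Cstar>0. \<forall>s\<in>{1, -1}. sign_class r s P \<noteq> {} \<longrightarrow> Cstar \<le> sign_const r s P) \<and>
     ((\<exists>t>0. emeasure lebesgue {x. \<bar>P x\<bar> \<le> t} < \<infinity>) \<and>
      lp_loc \<infinity> P \<and>
      (\<forall>x. x \<noteq> 0 \<and> P x \<noteq> 0 \<longrightarrow>
         0 < Liminf (at_right 0) (\<lambda>\<epsilon>. emeasure lebesgue ({y. P y * P x > 0} \<inter> ball x \<epsilon>)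
                                      / emeasure lebesgue (ball x \<epsilon>)))
      \<longrightarrow> (\<forall>s\<in>{1, -1}. sign_class r s P \<noteq> {} \<longrightarrow>
            (\<exists>f\<in>sign_class r s P. sign_radius (\<lambda>x. P x * f x) = sign_const r s P))) \<and>
     (\<forall>\<gamma>\<ge>0. lp_loc \<infinity> P \<and> homogeneous \<gamma> P \<longrightarrow>
        (\<forall>C>0. admissibility_inequality r P q C \<longrightarrow>
          (\<exists>Cstar>0.
             explicit_bound DIM('a) \<gamma> q (enn2real (lp_norm (lebesgue_on (ball 0 1)) \<infinity> P)) C \<le> Cstar \<and>
             (\<forall>s\<in>{1, -1}. sign_class r s P \<noteq> {} \<longrightarrow> Cstar \<le> sign_const r s P))))"
proof (intro conjI)
  note P = assms(1) and q = \<open>1 \<le> q\<close>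
  have loc: "1 < q \<Longrightarrow> lp_loc (conj_exponent q) P"
    and lim: "q = 1 \<Longrightarrow> ((\<lambda>\<rho>. lp_norm (lebesgue_on (ball 0 \<rho>)) \<infinity> P) \<longlongrightarrow> 0) (at_right 0)"
    using \<open>admissible r P q\<close> by (auto simp: admissible_def)
  obtain C0 where C0: "0 < C0" "admissibility_inequality r P q C0"
    using \<open>admissible r P q\<close> by (auto simp: admissible_def)
  obtain \<rho>0 where \<rho>0: "0 < \<rho>0" "\<And>\<rho>. 0 < \<rho> \<Longrightarrow> \<rho> < \<rho>0 \<Longrightarrow>
      ennreal (2 * C0) * lp_norm (lebesgue_on (ball 0 \<rho>)) (conj_exponent q) P < 1"
    using small_lp_norm_near_origin[OF q C0(1) loc lim] by blast
  have lower: "\<rho>0 \<le> sign_const r s P" if s: "s \<in> {1, -1}" and ne: "sign_class r s P \<noteq> {}" for s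
  proof (rule sign_const_greatest[OF ne])
    fix f \<rho> assume f: "f \<in> sign_class r s P" and \<rho>: "0 < \<rho>" "\<And>x. \<rho> \<le> norm x \<Longrightarrow> 0 \<le> P x * f x"
    show "\<rho>0 \<le> \<rho>"
      using one_le_lp_norm_ball[OF P q C0 f s \<rho>(2)] \<rho>0(2)[OF \<rho>(1)] by (meson not_less leI)
  qed
  then show "\<exists>Cstar>0. \<forall>s\<in>{1, -1}. sign_class r s P \<noteq> {} \<longrightarrow> Cstar \<le> sign_const r s P"
    using \<rho>0(1) by blast
  show "(\<exists>t>0. emeasure lebesgue {x. \<bar>P x\<bar> \<le> t} < \<infinity>) \<and>
      lp_loc \<infinity> P \<and>
      (\<forall>x. x \<noteq> 0 \<and> P x \<noteq> 0 \<longrightarrow>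
         0 < Liminf (at_right 0) (\<lambda>\<epsilon>. emeasure lebesgue ({y. P y * P x > 0} \<inter> ball x \<epsilon>)
                                      / emeasure lebesgue (ball x \<epsilon>)))
      \<longrightarrow> (\<forall>s\<in>{1, -1}. sign_class r s P \<noteq> {} \<longrightarrow>
            (\<exists>f\<in>sign_class r s P. sign_radius (\<lambda>x. P x * f x) = sign_const r s P))"
    using sign_class_extremizer[OF \<open>lp_loc 1 P\<close> q C0] by blast
  show "\<forall>\<gamma>\<ge>0. lp_loc \<infinity> P \<and> homogeneous \<gamma> P \<longrightarrow>
        (\<forall>C>0. admissibility_inequality r P q C \<longrightarrow>
          (\<exists>Cstar>0.
             explicit_bound DIM('a) \<gamma> q (enn2real (lp_norm (lebesgue_on (ball 0 1)) \<infinity> P)) C \<le> Cstar \<and>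
             (\<forall>s\<in>{1, -1}. sign_class r s P \<noteq> {} \<longrightarrow> Cstar \<le> sign_const r s P)))"
  proof (intro allI impI, elim conjE)
    fix \<gamma> C :: real
    assume \<gamma>: "0 \<le> \<gamma>" and bdd: "lp_loc \<infinity> P" and hom: "homogeneous \<gamma> P"
      and C: "0 < C" "admissibility_inequality r P q C"
    let ?b = "explicit_bound DIM('a) \<gamma> q (enn2real (lp_norm (lebesgue_on (ball 0 1)) \<infinity> P)) C"
    have "?b \<le> sign_const r s P" if s: "s \<in> {1, -1}" and ne: "sign_class r s P \<noteq> {}" for s
    proof (rule sign_const_greatest[OF ne])
      fix f \<rho> assume f: "f \<in> sign_class r s P" and \<rho>: "0 < \<rho>" "\<And>x. \<rho> \<le> norm x \<Longrightarrow> 0 \<le> P x * f x"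
      show "?b \<le> \<rho>"
        by (rule explicit_bound_le[OF q bdd hom \<gamma> C(1) \<rho>(1) lim one_le_lp_norm_ball[OF P q C f s \<rho>(2)]])
    qed
    then show "\<exists>Cstar>0. ?b \<le> Cstar \<and> (\<forall>s\<in>{1, -1}. sign_class r s P \<noteq> {} \<longrightarrow> Cstar \<le> sign_const r s P)"
      using lower \<rho>0(1) by (intro exI[of _ "max ?b \<rho>0"]) auto
  qed
qed

end
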